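(* For each $d\in\{1,\dots,n\}$ and $C_\delta\ge1$, there is a (small) constant $C_1>0$ such that the following holds. Let $\mu$ be a doubling measure on $\mathbb{R}^n$ with doubling constant $C_\delta$ and support $\Sigma$, and suppose that $$\int_{B(x,2r)}\int_0^{2r}\alpha_d(y,t)\,\frac{dt\,d\mu(y)}{t}\le C_1\,\mu(B(x,r))\qquad\text{for all }x\in\Sigma\text{ and }r>0.$$ Then $\Sigma$ is a uniformly rectifiable set of dimension $d$, which contains big pieces of Lipschitz graphs, and $\mu$ and $\mathcal{H}^d|_\Sigma$ are mutually absolutely continuous. Moreover $\mu\in A_\infty(\mathcal{H}^d|_\Sigma)$.
   Context: $B(x,r)$ is the open ball, $\mathbb{B}=B(0,1)\subset\mathbb{R}^n$. The support of a Radon measure $\mu$ (locally finite positive Borel measure) is $\Sigma=\{x:\mu(B(x,r))>0\ \forall r>0\}$; $\mu$ is doubling with constant $C_\delta$ if $\mu(B(x,2r))\le C_\delta\,\mu(B(x,r))$ for all $x\in\Sigma$, $r>0$. $\mathcal{H}^d$ is $d$-dimensional Hausdorff measure normalized so that $\mathcal{H}^d(\mathbb{R}^d\cap B(0,1))=1$; $\mathcal{H}^d|_\Sigma$ is its restriction to $\Sigma$. For measures $\mu,\nu$ on $\mathbb{R}^n$ whose restrictions to $\mathbb{B}$ are probability measures, $\mathbb{W}_1(\mu,\nu)=\sup_\psi\left|\int\psi\,d\mu-\int\psi\,d\nu\right|$, the supremum over all $1$-Lipschitz $\psi:\mathbb{R}^n\to\mathbb{R}$ supported on $\mathbb{B}$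 (vanishing outside $\mathbb{B}$). For $x\in\Sigma$, $r>0$, $\mu_{x,r}(A)=\mu(x+rA)/\mu(B(x,r))$ for Borel $A\subset\mathbb{R}^n$. $A'(d,n)$ is the set of $d$-dimensional affine planes of $\mathbb{R}^n$ meeting $B(0,1/2)$. For $V\in A'(d,n)$, $\nu_V=c_V\mathcal{H}^d|_V$ with $c_V=\mathcal{H}^d(V\cap\mathbb{B})^{-1}$. Then $\alpha_d(x,r)=\inf\{\mathbb{W}_1(\mu_{x,r},\nu_V):V\in A'(d,n)\}$ for $x\in\Sigma$, $r>0$. A set $E\subset\mathbb{R}^n$ is Ahlfors regular of dimension $d$ if there is a constant $C$ with $C^{-1}r^d\le\mathcal{H}^d(E\cap B(x,r))\le Cr^d$ for $x\in E$, $r>0$. An Ahlfors regular set $E$ of dimension $d$ is uniformly rectifiable (of dimension $d$) if there are constants $L\ge1$, $\eta>0$ such that for all $x\in E$, $r>0$ there is a Borel set $A\subset E\cap B(x,r)$ with $\mathcal{H}^d(A)\ge\eta r^d$ and an $L$-bi-Lipschitz map $f:A\to f(A)\subset\mathbb{R}^d$ (i.e. $L^{-1}|x-y|\le|f(x)-f(y)|\le L|x-y|$). $\Sigma$ contains big pieces of Lipschitz graphs if there are constants $\eta>0$ and $\gamma\ge0$ such that for all $x\in\Sigma$, $r>0$ there is a Borel set $A\subset\Sigma\cap B(x,r)$ with $\mathcal{H}^d(A)\ge\eta r^d$ and $A$ contained in a $\gamma$-Lipschitz graph of dimension $d$, i.e. a set $\{x+f(x):x\in V\}$ with $V$ a $d$-dimensional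 vector subspace of $\mathbb{R}^n$ and $f:V\to V^\perp$ $\gamma$-Lipschitz. $\mu\in A_\infty(\mathcal{H}^d|_\Sigma)$ means: both measures are locally finite, one of them is doubling, and there exist $\varepsilon,\delta\in(0,1)$ such that whenever $B$ is a ball centered on $\Sigma$ and $A\subset B$ is a Borel set with $\mu(A)\le\varepsilon\mu(B)$, one has $\mathcal{H}^d(A\cap\Sigma)\le\delta\,\mathcal{H}^d(B\cap\Sigma)$. *)

theory Defs
  imports "HOL-Analysis.Analysis"
begin

section \<open>Hausdorff measure\<close>

text \<open>
  Covers of diameter at most \<open>\<delta>\<close>, weighted by the \<open>d\<close>-th power of the diameter. The library's
  \<^term>\<open>diameter\<close> is only meaningful on bounded sets. For \<open>d = 0\<close> the convention \<open>0 ^ 0 = 1\<close> would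
  charge empty covering sets, so everything below is meant for \<open>d \<ge> 1\<close>.
\<close>

definition hausdorff_delta :: "nat \<Rightarrow> real \<Rightarrow> 'a::metric_space set \<Rightarrow> ennreal" where
  "hausdorff_delta d \<delta> E =
     (INF U\<in>{U :: nat \<Rightarrow> 'a set. E \<subseteq> (\<Union>i. U i) \<and> (\<forall>i. bounded (U i) \<and> diameter (U i) \<le> \<delta>)}.
        \<Sum>i. ennreal (diameter (U i)) ^ d)"

definition hausdorff_raw :: "nat \<Rightarrow> 'a::metric_space set \<Rightarrow> ennreal" where
  "hausdorff_raw d E = (SUP \<delta>\<in>{0<..}. hausdorff_delta d \<delta> E)"

text \<open>
  The outer measure, normalized so that the unit ball of a \<open>d\<close>-dimensional subspace has measure 1
  (for whichever subspace; see \<open>hausdorff_unit_ball\<close> below).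
\<close>

definition hausdorff :: "nat \<Rightarrow> 'a::euclidean_space set \<Rightarrow> ennreal" where
  "hausdorff d E =
     hausdorff_raw d E / hausdorff_raw d ((SOME W :: 'a set. subspace W \<and> dim W = d) \<inter> ball 0 1)"

definition hausdorff_measure :: "nat \<Rightarrow> 'a::euclidean_space measure" where
  "hausdorff_measure d = measure_of UNIV (sets borel) (hausdorff d)"

subsection \<open>It is a metric outer measure\<close>

lemma hausdorff_delta_le:
  assumes "E \<subseteq> (\<Union>i. U i)" "\<And>i. bounded (U i)" "\<And>i. diameter (U i) \<le> \<delta>"
  shows "hausdorff_delta d \<delta> E \<le> (\<Sum>i. ennreal (diameter (U i)) ^ d)"
  unfolding hausdorff_delta_def by (rule INF_lower) (use assms in auto)

lemma hausdorff_delta_mono: "A \<subseteq> B \<Longrightarrow> hausdorff_delta d \<delta> A \<le> hausdorff_delta d \<delta> B"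
  unfolding hausdorff_delta_def by (rule INF_superset_mono) auto

lemma hausdorff_delta_antimono: "\<delta> \<le> \<delta>' \<Longrightarrow> hausdorff_delta d \<delta>' A \<le> hausdorff_delta d \<delta> A"
  unfolding hausdorff_delta_def by (rule INF_superset_mono) (auto intro: order_trans)

lemma hausdorff_raw_mono: "A \<subseteq> B \<Longrightarrow> hausdorff_raw d A \<le> hausdorff_raw d B"
  unfolding hausdorff_raw_def by (intro SUP_mono) (auto intro: hausdorff_delta_mono)

lemma hausdorff_delta_le_raw: "\<delta> > 0 \<Longrightarrow> hausdorff_delta d \<delta> A \<le> hausdorff_raw d A"
  unfolding hausdorff_raw_def by (rule SUP_upper) auto

lemma hausdorff_raw_empty:
  assumes "1 \<le> d" shows "hausdorff_raw d {} = 0"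
proof -
  have "hausdorff_delta d \<delta> ({} :: 'a set) = 0" if "\<delta> > 0" for \<delta>
    using hausdorff_delta_le[of "{} :: 'a set" "\<lambda>_. {}" \<delta> d] that assms by (simp add: power_0_left)
  then show ?thesis unfolding hausdorff_raw_def by (auto intro!: antisym SUP_least)
qed

lemma hausdorff_delta_UN:
  "hausdorff_delta d \<delta> (\<Union>i::nat. A i) \<le> (\<Sum>i. hausdorff_delta d \<delta> (A i))"
proof (rule ennreal_le_epsilon)
  fix e :: real assume fin: "(\<Sum>i. hausdorff_delta d \<delta> (A i)) < top" and e: "0 < e"
  have fini: "hausdorff_delta d \<delta> (A i) < top" for i
    using fin ennreal_suminf_lessD[of "\<lambda>i. hausdorff_delta d \<delta> (A i)" top] by blast
  have "\<exists>U. A i \<subseteq> (\<Union>j. U j) \<and> (\<forall>j. bounded (U j) \<and> diameter (U j) \<le> \<delta>) \<and>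
          (\<Sum>j. ennreal (diameter (U j)) ^ d) \<le> hausdorff_delta d \<delta> (A i) + ennreal (e * (1/2) ^ Suc i)"
    (is "\<exists>U. ?P i U") for i
  proof -
    have "hausdorff_delta d \<delta> (A i) < hausdorff_delta d \<delta> (A i) + ennreal (e * (1/2) ^ Suc i)"
      using fini[of i] e by (cases "hausdorff_delta d \<delta> (A i)") (auto simp flip: ennreal_plus intro!: ennreal_lessI add_nonneg_pos)
    then show ?thesis
      unfolding hausdorff_delta_def[of d \<delta> "A i"] INF_less_iff by (auto intro: less_imp_le)
  qed
  then obtain U where U: "\<And>i. ?P i (U i)" by metis
  let ?V = "\<lambda>k. U (fst (prod_decode k)) (snd (prod_decode k))"
  have "(\<Union>i. A i) \<subseteq> (\<Union>k. ?V k)"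
  proof
    fix x assume "x \<in> (\<Union>i. A i)"
    then obtain i j where "x \<in> U i j" using U by blast
    then have "x \<in> ?V (prod_encode (i, j))" by simp
    then show "x \<in> (\<Union>k. ?V k)" by blast
  qed
  then have "hausdorff_delta d \<delta> (\<Union>i. A i) \<le> (\<Sum>k. ennreal (diameter (?V k)) ^ d)"
    using U by (intro hausdorff_delta_le) auto
  also have "\<dots> = (\<Sum>i. \<Sum>j. ennreal (diameter (U i j)) ^ d)"
    using suminf_ennreal_2dimen[of "\<lambda>i. \<Sum>j. ennreal (diameter (U i j)) ^ d"
        "\<lambda>(i, j). ennreal (diameter (U i j)) ^ d"]
    by (simp add: o_def split_beta)
  also have "\<dots> \<le> (\<Sum>i. hausdorff_delta d \<delta> (A i) + ennreal (e * (1/2) ^ Suc i))"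
    using U by (intro suminf_le) auto
  also have "\<dots> = (\<Sum>i. hausdorff_delta d \<delta> (A i)) + (\<Sum>i. ennreal (e * (1/2) ^ Suc i))"
    by (rule suminf_add[symmetric]) auto
  also have "(\<Sum>i. ennreal (e * (1/2) ^ Suc i)) = ennreal e"
    using e sums_mult[OF power_half_series, of e]
    by (intro suminf_ennreal_eq) auto
  finally show "hausdorff_delta d \<delta> (\<Union>i. A i) \<le> (\<Sum>i. hausdorff_delta d \<delta> (A i)) + ennreal e" .
qed

lemma hausdorff_raw_UN:
  "hausdorff_raw d (\<Union>i::nat. A i) \<le> (\<Sum>i. hausdorff_raw d (A i))"
  unfolding hausdorff_raw_def[of d "\<Union>i. A i"]
proof (rule SUP_least)
  fix \<delta> :: real assume "\<delta> \<in> {0<..}"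
  then show "hausdorff_delta d \<delta> (\<Union>i. A i) \<le> (\<Sum>i. hausdorff_raw d (A i))"
    by (intro order_trans[OF hausdorff_delta_UN] suminf_le) (auto intro: hausdorff_delta_le_raw)
qed

lemma hausdorff_raw_outer:
  assumes "1 \<le> d" shows "outer_measure_space UNIV (hausdorff_raw d)"
  unfolding outer_measure_space_def positive_def increasing_def countably_subadditive_def
  using assms by (auto simp: hausdorff_raw_empty hausdorff_raw_mono hausdorff_raw_UN)

lemma hausdorff_raw_Un:
  assumes "1 \<le> d"
  shows "hausdorff_raw d (A \<union> B) \<le> hausdorff_raw d A + hausdorff_raw d B"
proof -
  interpret sigma_algebra "UNIV :: 'a set" "UNIV :: 'a set set"
    using sigma_algebra_Pow[of "UNIV :: 'a set"] by simp
  have "subadditive UNIV (hausdorff_raw d :: 'a set \<Rightarrow> ennreal)"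
    using hausdorff_raw_outer[OF assms] countably_subadditive_subadditive
    unfolding outer_measure_space_def by blast
  then have "hausdorff_raw d (A \<union> (B - A)) \<le> hausdorff_raw d A + hausdorff_raw d (B - A)"
    by (intro subadditiveD) auto
  also have "\<dots> \<le> hausdorff_raw d A + hausdorff_raw d B"
    by (intro add_left_mono hausdorff_raw_mono) auto
  finally show ?thesis by simp
qed

lemma hausdorff_raw_separated:
  fixes A B :: "'a::metric_space set"
  assumes d: "1 \<le> d" and e: "0 < e" and sep: "\<And>x y. x \<in> A \<Longrightarrow> y \<in> B \<Longrightarrow> e \<le> dist x y"
  shows "hausdorff_raw d A + hausdorff_raw d B \<le> hausdorff_raw d (A \<union> B)"
proof -
  have *: "hausdorff_delta d \<delta> A + hausdorff_delta d \<delta> B \<le> hausdorff_delta d \<delta> (A \<union> B)"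
    if \<delta>: "0 < \<delta>" "\<delta> < e" for \<delta>
    unfolding hausdorff_delta_def[of d \<delta> "A \<union> B"]
  proof (rule INF_greatest, clarify)
    fix U :: "nat \<Rightarrow> 'a set"
    assume cov: "A \<union> B \<subseteq> (\<Union>i. U i)" and U: "\<forall>i. bounded (U i) \<and> diameter (U i) \<le> \<delta>"
    have le: "diameter (U i \<inter> X) \<le> diameter (U i)" for i X
      using U by (intro diameter_subset) auto
    have "hausdorff_delta d \<delta> A + hausdorff_delta d \<delta> B
        \<le> (\<Sum>i. ennreal (diameter (U i \<inter> A)) ^ d) + (\<Sum>i. ennreal (diameter (U i \<inter> B)) ^ d)"
      using cov U order_trans[OF le]
      by (intro add_mono hausdorff_delta_le) (auto intro: bounded_subset)
    also have "\<dots> = (\<Sum>i. ennreal (diameter (U i \<inter> A)) ^ d + ennreal (diameter (U i \<inter> B)) ^ d)"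
      by (rule suminf_add) auto
    also have "\<dots> \<le> (\<Sum>i. ennreal (diameter (U i)) ^ d)"
    proof (rule suminf_le)
      fix i
      have "U i \<inter> A = {} \<or> U i \<inter> B = {}"
      proof (rule ccontr)
        assume "\<not> ?thesis"
        then obtain x y where xy: "x \<in> U i" "x \<in> A" "y \<in> U i" "y \<in> B" by auto
        then have "e \<le> dist x y" "dist x y \<le> diameter (U i)"
          using sep U diameter_bounded_bound by blast+
        then show False using U \<delta> by (meson leD order_trans)
      qed
      then show "ennreal (diameter (U i \<inter> A)) ^ d + ennreal (diameter (U i \<inter> B)) ^ d
          \<le> ennreal (diameter (U i)) ^ d"
        using d le[of i] by (auto simp: power_0_left intro!: power_mono ennreal_leI)
    qed auto
    finally show "hausdorff_delta d \<delta> A + hausdorff_delta d \<delta> B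
        \<le> (\<Sum>i. ennreal (diameter (U i)) ^ d)" .
  qed
  have small: "hausdorff_raw d X = (SUP \<delta>\<in>{0<..<e}. hausdorff_delta d \<delta> X)" for X :: "'a set"
    unfolding hausdorff_raw_def
  proof (rule antisym)
    show "(SUP \<delta>\<in>{0<..}. hausdorff_delta d \<delta> X) \<le> (SUP \<delta>\<in>{0<..<e}. hausdorff_delta d \<delta> X)"
    proof (rule SUP_mono)
      fix \<delta> :: real assume "\<delta> \<in> {0<..}"
      then show "\<exists>\<delta>'\<in>{0<..<e}. hausdorff_delta d \<delta> X \<le> hausdorff_delta d \<delta>' X"
        using e by (intro bexI[of _ "min \<delta> (e/2)"] hausdorff_delta_antimono) auto
    qed
  qed (auto intro: SUP_subset_mono)
  have "hausdorff_raw d A + hausdorff_raw d B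
      = (SUP \<delta>\<in>{0<..<e}. hausdorff_delta d \<delta> A + hausdorff_delta d \<delta> B)"
    unfolding small
  proof (rule SUP_add_directed_ennreal[symmetric])
    fix i j assume ij: "i \<in> {0<..<e}" "j \<in> {0<..<e}"
    then show "\<exists>k\<in>{0<..<e}. hausdorff_delta d i A + hausdorff_delta d j B
        \<le> hausdorff_delta d k A + hausdorff_delta d k B"
      by (intro bexI[of _ "min i j"] add_mono hausdorff_delta_antimono) auto
  qed
  also have "\<dots> \<le> hausdorff_raw d (A \<union> B)"
    unfolding small using * by (intro SUP_mono) force
  finally show ?thesis .
qed

lemma hausdorff_raw_separated_UN:
  fixes D :: "nat \<Rightarrow> 'a::metric_space set"
  assumes d: "1 \<le> d"
    and sep: "\<And>i j. i < j \<Longrightarrow> \<exists>e>0. \<forall>x\<in>D i. \<forall>y\<in>D j. e \<le> dist x y"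
  shows "(\<Sum>i<n. hausdorff_raw d (D i)) \<le> hausdorff_raw d (\<Union>i<n. D i)"
proof (induction n)
  case (Suc n)
  obtain e where e: "\<And>i. i < n \<Longrightarrow> e i > 0 \<and> (\<forall>x\<in>D i. \<forall>y\<in>D n. e i \<le> dist x y)"
    using sep[of _ n] by metis
  define m where "m = Min (insert 1 (e ` {..<n}))"
  have m: "m > 0" "\<And>i. i < n \<Longrightarrow> m \<le> e i"
    unfolding m_def using e by (auto intro: Min_le)
  have "(\<Sum>i<Suc n. hausdorff_raw d (D i)) \<le> hausdorff_raw d (\<Union>i<n. D i) + hausdorff_raw d (D n)"
    using Suc by (simp add: add_right_mono)
  also have "\<dots> \<le> hausdorff_raw d ((\<Union>i<n. D i) \<union> D n)"
    using m e by (intro hausdorff_raw_separated[OF d m(1)]) (meson UN_E lessThan_iff order_trans)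
  also have "(\<Union>i<n. D i) \<union> D n = (\<Union>i<Suc n. D i)" by (auto simp: less_Suc_eq)
  finally show ?case .
qed simp

lemma hausdorff_raw_closed:
  fixes F :: "'a::metric_space set"
  assumes d: "1 \<le> d" and F: "closed F"
  shows "hausdorff_raw d (A \<inter> F) + hausdorff_raw d (A - F) \<le> hausdorff_raw d A"
proof (cases "hausdorff_raw d A = top \<or> F = {}")
  case True
  then show ?thesis using hausdorff_raw_empty[OF d, where 'a='a] by auto
next
  case False
  then have fin: "hausdorff_raw d A < top" and ne: "F \<noteq> {}" by (auto simp: less_top)
  let ?H = "hausdorff_raw d :: 'a set \<Rightarrow> ennreal"
  define S where "S n = {x \<in> A. inverse (real (Suc n)) \<le> infdist x F}" for n
  define D where "D n = S (Suc n) - S n" for n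
  have sep: "\<exists>e>0. \<forall>x\<in>S n. \<forall>y\<in>A - S m. e \<le> dist x y" if "n < m" for n m
  proof (intro exI conjI ballI)
    show "0 < inverse (real (Suc n)) - inverse (real (Suc m))"
      using that by simp
    fix x y assume "x \<in> S n" "y \<in> A - S m"
    then have "inverse (real (Suc n)) \<le> infdist x F" "infdist y F < inverse (real (Suc m))"
      by (auto simp: S_def)
    then show "inverse (real (Suc n)) - inverse (real (Suc m)) \<le> dist x y"
      using infdist_triangle[of x F y] by simp
  qed
  have S_mono: "S n \<subseteq> S m" if "n \<le> m" for n m
    using that by (auto simp: S_def intro: order_trans[rotated] le_imp_inverse_le)
  have D_sub: "D n \<subseteq> A" for n by (auto simp: D_def S_def)
  have Dsep: "\<exists>e>0. \<forall>x\<in>D i. \<forall>y\<in>D j. e \<le> dist x y" if "Suc i < j" for i j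
    using sep[OF that] by (metis Diff_iff D_def S_def mem_Collect_eq)
  have half: "(\<Sum>i. ?H (D (2 * i + k))) \<le> ?H A" for k
  proof (rule suminf_le_const)
    fix n
    have "(\<Sum>i<n. ?H (D (2 * i + k))) \<le> ?H (\<Union>i<n. D (2 * i + k))"
      by (intro hausdorff_raw_separated_UN[OF d] Dsep) auto
    also have "\<dots> \<le> ?H A" using D_sub by (intro hausdorff_raw_mono) auto
    finally show "(\<Sum>i<n. ?H (D (2 * i + k))) \<le> ?H A" .
  qed auto
  have "(\<Sum>i. ?H (D i)) \<le> ?H A + ?H A"
  proof (rule suminf_le_const)
    fix n
    have "(\<Sum>i<n. ?H (D i)) \<le> (\<Sum>i<2 * n. ?H (D i))"
      by (intro sum_mono2) auto
    also have "\<dots> = (\<Sum>i<n. ?H (D (2 * i + 0))) + (\<Sum>i<n. ?H (D (2 * i + 1)))"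
      by (induction n) (auto simp: algebra_simps)
    also have "\<dots> \<le> (\<Sum>i. ?H (D (2 * i + 0))) + (\<Sum>i. ?H (D (2 * i + 1)))"
      by (intro add_mono sum_le_suminf) auto
    also have "\<dots> \<le> ?H A + ?H A" by (intro add_mono half)
    finally show "(\<Sum>i<n. ?H (D i)) \<le> ?H A + ?H A" .
  qed auto
  then have sumfin: "(\<Sum>i. ?H (D i)) \<noteq> top"
    using fin by (metis ennreal_add_eq_top less_top top.extremum_uniqueI)
  have cover: "A - F \<subseteq> S n \<union> (\<Union>i. D (i + n))" for n
  proof
    fix x assume x: "x \<in> A - F"
    then have "0 < infdist x F"
      using F ne by (simp add: infdist_pos_not_in_closed)
    then obtain m where "inverse (real (Suc m)) < infdist x F"
      using reals_Archimedean by blast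
    then have ex: "x \<in> S m" using x by (simp add: S_def)
    define k where "k = (LEAST k. x \<in> S k)"
    have k: "x \<in> S k" "\<And>j. j < k \<Longrightarrow> x \<notin> S j"
      unfolding k_def using ex by (auto intro: LeastI dest: not_less_Least)
    show "x \<in> S n \<union> (\<Union>i. D (i + n))"
    proof (cases "k \<le> n")
      case True then show ?thesis using S_mono k by blast
    next
      case False
      then have "x \<in> D ((k - 1 - n) + n)" using k by (auto simp: D_def)
      then show ?thesis by blast
    qed
  qed
  have bound: "?H (A \<inter> F) + ?H (A - F) \<le> ?H A + (\<Sum>i. ?H (D (i + n)))" for n
  proof -
    have "?H (A - F) \<le> ?H (S n) + ?H (\<Union>i. D (i + n))"
      by (rule order_trans[OF hausdorff_raw_mono[OF cover] hausdorff_raw_Un[OF d]])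
    also have "\<dots> \<le> ?H (S n) + (\<Sum>i. ?H (D (i + n)))"
      by (intro add_left_mono hausdorff_raw_UN)
    finally have "?H (A \<inter> F) + ?H (A - F) \<le> (?H (A \<inter> F) + ?H (S n)) + (\<Sum>i. ?H (D (i + n)))"
      by (simp add: add.assoc add_left_mono)
    also have "?H (A \<inter> F) + ?H (S n) \<le> ?H ((A \<inter> F) \<union> S n)"
    proof (rule hausdorff_raw_separated[OF d, of "inverse (real (Suc n))"])
      fix x y assume "x \<in> A \<inter> F" "y \<in> S n"
      then show "inverse (real (Suc n)) \<le> dist x y"
        using infdist_le[of x F y] by (simp add: S_def dist_commute)
    qed simp
    also have "\<dots> \<le> ?H A" by (intro hausdorff_raw_mono) (auto simp: S_def)
    finally show ?thesis by (simp add: add_right_mono)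
  qed
  have "(\<lambda>n. ?H A + (\<Sum>i. ?H (D (i + n)))) \<longlonglongrightarrow> ?H A + 0"
  proof (intro tendsto_add tendsto_const)
    have fi: "?H (D i) \<noteq> top" for i
      using fin hausdorff_raw_mono[OF D_sub[of i], of d] by (auto simp: top_unique)
    define h where "h i = enn2real (?H (D i))" for i
    have h: "?H (D i) = ennreal (h i)" "0 \<le> h i" for i
      using fi by (auto simp: h_def less_top)
    have summ: "summable h"
      using sumfin h by (simp add: summable_suminf_not_top)
    have "(\<Sum>i. ?H (D (i + n))) = ennreal (\<Sum>i. h (i + n))" for n
      using summ h by (simp add: suminf_ennreal2 summable_iff_shift)
    moreover have "(\<lambda>n. ennreal (\<Sum>i. h (i + n))) \<longlonglongrightarrow> ennreal 0"
      using suminf_exist_split2[OF summ] by (intro tendsto_ennrealI) simp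
    ultimately show "(\<lambda>n. \<Sum>i. ?H (D (i + n))) \<longlonglongrightarrow> 0" by simp
  qed
  then show ?thesis
    using bound by (intro LIMSEQ_le_const) auto
qed

lemma hausdorff_raw_measure_space:
  assumes d: "1 \<le> d"
  shows "measure_space (UNIV :: 'a::euclidean_space set) (sets borel) (hausdorff_raw d)"
proof -
  interpret sigma_algebra "UNIV :: 'a set" "UNIV :: 'a set set"
    using sigma_algebra_Pow[of "UNIV :: 'a set"] by simp
  let ?L = "lambda_system UNIV UNIV (hausdorff_raw d :: 'a set \<Rightarrow> ennreal)"
  have ms: "measure_space UNIV ?L (hausdorff_raw d)"
    by (rule caratheodory_lemma[OF hausdorff_raw_outer[OF d]])
  have closed: "F \<in> ?L" if "closed F" for F
    unfolding lambda_system_eq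
  proof (clarsimp, rule antisym)
    fix x
    show "hausdorff_raw d (x \<inter> F) + hausdorff_raw d (x - F) \<le> hausdorff_raw d x"
      by (rule hausdorff_raw_closed[OF d that])
    have "hausdorff_raw d ((x \<inter> F) \<union> (x - F)) \<le> hausdorff_raw d (x \<inter> F) + hausdorff_raw d (x - F)"
      by (rule hausdorff_raw_Un[OF d])
    then show "hausdorff_raw d x \<le> hausdorff_raw d (x \<inter> F) + hausdorff_raw d (x - F)"
      by (simp add: Int_Diff_Un)
  qed
  have "sigma_algebra UNIV ?L" using ms by (simp add: measure_space_def)
  then have "sigma_sets UNIV (Collect closed) \<subseteq> ?L"
    using closed by (intro sigma_algebra.sigma_sets_subset) auto
  then have "sets borel \<subseteq> ?L" by (simp add: borel_eq_closed)
  then show ?thesis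
    using ms sets.sigma_algebra_axioms[of "borel :: 'a measure"]
    by (auto simp: measure_space_def positive_def countably_additive_def subset_iff)
qed

lemma sets_hausdorff_measure [simp, measurable_cong]: "sets (hausdorff_measure d) = sets borel"
  by (simp add: hausdorff_measure_def sets.sigma_sets_eq[of borel, simplified])

lemma space_hausdorff_measure [simp]: "space (hausdorff_measure d) = UNIV"
  by (simp add: hausdorff_measure_def)

lemma emeasure_hausdorff_measure:
  fixes A :: "'a::euclidean_space set"
  assumes d: "1 \<le> d" and A: "A \<in> sets borel"
  shows "emeasure (hausdorff_measure d) A = hausdorff d A"
  unfolding hausdorff_measure_def
proof (rule emeasure_measure_of_sigma)
  show "sigma_algebra UNIV (sets (borel :: 'a measure))"
    using sets.sigma_algebra_axioms[of "borel :: 'a measure"] by simp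
  note ms = hausdorff_raw_measure_space[OF d, where 'a='a, unfolded measure_space_def]
  show "positive (sets (borel :: 'a measure)) (hausdorff d)"
    using ms by (simp add: positive_def hausdorff_def)
  show "countably_additive (sets (borel :: 'a measure)) (hausdorff d)"
    using ms by (simp add: countably_additive_def hausdorff_def divide_ennreal_def mult.commute[of _ "inverse _"])
qed (rule A)

subsection \<open>The normalization\<close>

lemma hausdorff_delta_finite_cover:
  assumes d: "1 \<le> d" and I: "finite I" and E: "E \<subseteq> (\<Union>i\<in>I. U i)" and \<delta>: "0 \<le> \<delta>"
    and U: "\<And>i. i \<in> I \<Longrightarrow> bounded (U i)" "\<And>i. i \<in> I \<Longrightarrow> diameter (U i) \<le> \<delta>"
  shows "hausdorff_delta d \<delta> E \<le> (\<Sum>i\<in>I. ennreal (diameter (U i)) ^ d)"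
proof -
  obtain h where h: "bij_betw h {0..<card I} I"
    using ex_bij_betw_nat_finite[OF I] by blast
  define V where "V k = (if k < card I then U (h k) else {})" for k
  have hI: "h k \<in> I" if "k < card I" for k
    using h that by (auto simp: bij_betw_def)
  have "E \<subseteq> (\<Union>k. V k)"
  proof
    fix x assume "x \<in> E"
    then obtain i where "i \<in> I" "x \<in> U i" using E by auto
    moreover then obtain k where "k < card I" "h k = i"
      using h unfolding bij_betw_def by (metis atLeastLessThan_iff imageE)
    ultimately show "x \<in> (\<Union>k. V k)" by (auto simp: V_def)
  qed
  then have "hausdorff_delta d \<delta> E \<le> (\<Sum>k. ennreal (diameter (V k)) ^ d)"
    using U hI \<delta> by (intro hausdorff_delta_le) (auto simp: V_def)
  also have "\<dots> = (\<Sum>k\<in>{0..<card I}. ennreal (diameter (V k)) ^ d)"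
    using d by (intro suminf_finite) (auto simp: V_def power_0_left)
  also have "\<dots> = (\<Sum>k\<in>{0..<card I}. ennreal (diameter (U (h k))) ^ d)"
    by (intro sum.cong) (auto simp: V_def)
  also have "\<dots> = (\<Sum>i\<in>I. ennreal (diameter (U i)) ^ d)"
    by (rule sum.reindex_bij_betw[OF h])
  finally show ?thesis .
qed

lemma hausdorff_raw_image_le:
  fixes f :: "'a::euclidean_space \<Rightarrow> 'b::euclidean_space"
  assumes f: "\<And>x y. x \<in> X \<Longrightarrow> y \<in> X \<Longrightarrow> dist (f x) (f y) \<le> dist x y"
  shows "hausdorff_raw d (f ` X) \<le> hausdorff_raw d X"
  unfolding hausdorff_raw_def
proof (rule SUP_mono, rule bexI)
  fix \<delta> :: real assume "\<delta> \<in> {0<..}"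
  show "hausdorff_delta d \<delta> (f ` X) \<le> hausdorff_delta d \<delta> X"
    unfolding hausdorff_delta_def[of d \<delta> X]
  proof (rule INF_greatest, clarify)
    fix U :: "nat \<Rightarrow> 'a set"
    assume cov: "X \<subseteq> (\<Union>i. U i)" and U: "\<forall>i. bounded (U i) \<and> diameter (U i) \<le> \<delta>"
    have le: "dist x y \<le> diameter (U i)" if xy: "x \<in> f ` (U i \<inter> X)" "y \<in> f ` (U i \<inter> X)" for i x y
    proof -
      obtain x' y' where "x' \<in> U i \<inter> X" "y' \<in> U i \<inter> X" "x = f x'" "y = f y'"
        using xy by blast
      then show ?thesis using f[of x' y'] diameter_bounded_bound[of "U i" x' y'] U by force
    qed
    have dle: "diameter (f ` (U i \<inter> X)) \<le> diameter (U i)" for i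
    proof (rule diameter_le)
      show "f ` (U i \<inter> X) \<noteq> {} \<or> 0 \<le> diameter (U i)" using U diameter_ge_0 by blast
    qed (use le in \<open>auto simp: dist_norm\<close>)
    have bd: "bounded (f ` (U i \<inter> X))" for i
      using le[of _ i] unfolding bounded_two_points by blast
    have "f ` X \<subseteq> (\<Union>i. f ` (U i \<inter> X))" using cov by blast
    then have "hausdorff_delta d \<delta> (f ` X) \<le> (\<Sum>i. ennreal (diameter (f ` (U i \<inter> X))) ^ d)"
      using U order_trans[OF dle] bd by (intro hausdorff_delta_le) auto
    also have "\<dots> \<le> (\<Sum>i. ennreal (diameter (U i)) ^ d)"
      using dle by (intro suminf_le power_mono ennreal_leI) auto
    finally show "hausdorff_delta d \<delta> (f ` X) \<le> (\<Sum>i. ennreal (diameter (U i)) ^ d)" .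
  qed
qed

lemma hausdorff_raw_coord_ball_finite:
  fixes B :: "'a::euclidean_space set"
  assumes B: "B \<subseteq> Basis" "card B = d" and d: "1 \<le> d"
  shows "hausdorff_raw d (span B \<inter> ball 0 1) \<le> ennreal ((2 * real d) ^ d)"
  unfolding hausdorff_raw_def
proof (rule SUP_least)
  fix \<delta> :: real assume "\<delta> \<in> {0<..}"
  then have \<delta>: "\<delta> > 0" by simp
  have fB: "finite B" using B(1) finite_Basis finite_subset by blast
  obtain N :: nat where "2 * real d / \<delta> < real N" using reals_Archimedean2 by blast
  then have N: "0 < N" "2 * real d / real N \<le> \<delta>"
  proof -
    assume a: "2 * real d / \<delta> < real N"
    have "0 \<le> 2 * real d / \<delta>" using \<delta> by simp
    then have "0 < real N" using a by linarith
    then show "0 < N" "2 * real d / real N \<le> \<delta>" using a \<delta> by (auto simp: field_simps)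
  qed
  define C where "C g = {x \<in> span B. \<forall>b\<in>B. -1 + 2 * real (g b) / N \<le> x \<bullet> b \<and> x \<bullet> b \<le> -1 + 2 * (real (g b) + 1) / N}"
    for g :: "'a \<Rightarrow> nat"
  have dist: "norm (x - y) \<le> 2 * real d / N" if "x \<in> C g" "y \<in> C g" for x y g
  proof -
    have "norm (x - y) \<le> (\<Sum>b\<in>Basis. \<bar>(x - y) \<bullet> b\<bar>)" by (rule norm_le_l1)
    also have "\<dots> = (\<Sum>b\<in>B. \<bar>(x - y) \<bullet> b\<bar>)"
      using that B(1) by (intro sum.mono_neutral_right) (auto simp: C_def span_substd_basis inner_diff_left)
    also have "\<dots> \<le> (\<Sum>b\<in>B. 2 / N)"
    proof (rule sum_mono)
      fix b assume b: "b \<in> B"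
      have "-1 + 2 * real (g b) / N \<le> x \<bullet> b" "x \<bullet> b \<le> -1 + 2 * (real (g b) + 1) / N"
        "-1 + 2 * real (g b) / N \<le> y \<bullet> b" "y \<bullet> b \<le> -1 + 2 * (real (g b) + 1) / N"
        using that b by (auto simp: C_def)
      moreover have "2 * (real (g b) + 1) / N = 2 * real (g b) / N + 2 / N"
        by (simp add: add_divide_distrib distrib_left)
      ultimately show "\<bar>(x - y) \<bullet> b\<bar> \<le> 2 / N" by (simp add: inner_diff_left)
    qed
    also have "\<dots> = 2 * real d / N" using B by simp
    finally show ?thesis .
  qed
  let ?I = "PiE B (\<lambda>_. {..<N})"
  have diam: "diameter (C g) \<le> 2 * real d / N" for g
    using dist by (intro diameter_le) auto
  have "span B \<inter> ball 0 1 \<subseteq> (\<Union>g\<in>?I. C g)"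
  proof
    fix x assume x: "x \<in> span B \<inter> ball 0 1"
    define g where "g = restrict (\<lambda>b. nat \<lfloor>(x \<bullet> b + 1) * N / 2\<rfloor>) B"
    have g: "real (g b) \<le> (x \<bullet> b + 1) * N / 2" "(x \<bullet> b + 1) * N / 2 < real (g b) + 1" "g b < N"
      if "b \<in> B" for b
    proof -
      have "\<bar>x \<bullet> b\<bar> < 1"
        using x that B(1) Basis_le_norm[of b x] by force
      then have p: "0 \<le> (x \<bullet> b + 1) * N / 2" "(x \<bullet> b + 1) * N / 2 < N"
        using N(1) by (auto simp: divide_less_eq mult.commute intro!: mult_strict_right_mono)
      have "g b = nat \<lfloor>(x \<bullet> b + 1) * N / 2\<rfloor>" using that by (simp add: g_def)
      then show "real (g b) \<le> (x \<bullet> b + 1) * N / 2" "(x \<bullet> b + 1) * N / 2 < real (g b) + 1"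
        using p(1) by linarith+
      then show "g b < N" using p(2) by linarith
    qed
    have "x \<in> C g"
      unfolding C_def using x N g(1,2) by (auto simp: field_simps intro!: less_imp_le)
    moreover have "g \<in> ?I" using g(3) by (auto simp: g_def)
    ultimately show "x \<in> (\<Union>g\<in>?I. C g)" by blast
  qed
  moreover have "bounded (C g)" for g
    using dist[of _ g] unfolding bounded_two_points dist_norm by blast
  ultimately have "hausdorff_delta d \<delta> (span B \<inter> ball 0 1) \<le> (\<Sum>g\<in>?I. ennreal (diameter (C g)) ^ d)"
    using fB \<delta> N(2) order_trans[OF diam]
    by (intro hausdorff_delta_finite_cover[OF d]) (auto intro!: finite_PiE)
  also have "\<dots> \<le> (\<Sum>g\<in>?I. ennreal (2 * real d / N) ^ d)"
    by (intro sum_mono power_mono ennreal_leI diam) auto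
  also have "\<dots> = ennreal (real N ^ d * (2 * real d / N) ^ d)"
    using fB B(2) by (simp add: card_PiE ennreal_power ennreal_mult ennreal_of_nat_eq_real_of_nat)
  also have "real N ^ d * (2 * real d / N) ^ d = (2 * real d) ^ d"
    using N(1) by (simp add: power_divide)
  finally show "hausdorff_delta d \<delta> (span B \<inter> ball 0 1) \<le> ennreal ((2 * real d) ^ d)" .
qed

lemma hausdorff_raw_coord_ball_pos:
  fixes B :: "'a::euclidean_space set"
  assumes B: "B \<subseteq> Basis" "card B = d" and d: "1 \<le> d"
  shows "0 < hausdorff_raw d (span B \<inter> ball 0 1)"
proof -
  have fB: "finite B" using B(1) finite_Basis finite_subset by blast
  define c where "c = 1 / (2 * real d)"
  have c: "c > 0" using d by (simp add: c_def)
  define Q :: "'a set" where "Q = cbox 0 (\<Sum>b\<in>Basis. (if b \<in> B then c else 1) *\<^sub>R b)"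
  have prodB: "(\<Prod>b\<in>Basis. if b \<in> B then t else 1) = t ^ d" for t :: real
    using B fB by (simp add: prod.If_cases Int_absorb1)
  have Q: "emeasure lborel Q = ennreal (c ^ d)"
    unfolding Q_def using c by (subst emeasure_lborel_cbox) (auto simp: prodB)
  have main: "ennreal (c ^ d) \<le> ennreal (2 ^ d) * (\<Sum>i. ennreal (diameter (U i)) ^ d)"
    if cov: "span B \<inter> ball 0 1 \<subseteq> (\<Union>i. U i)" and bd: "\<And>i. bounded (U i)" for U :: "nat \<Rightarrow> 'a set"
  proof -
    define s where "s i = diameter (U i)" for i
    have s: "0 \<le> s i" for i using bd by (simp add: s_def diameter_ge_0)
    define p where "p i = (SOME x. x \<in> U i)" for i
    define F where "F i = cbox (\<Sum>b\<in>Basis. (if b \<in> B then p i \<bullet> b - s i else 0) *\<^sub>R b)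
                              (\<Sum>b\<in>Basis. (if b \<in> B then p i \<bullet> b + s i else 1) *\<^sub>R b)" for i
    have F: "emeasure lborel (F i) = ennreal ((2 * s i) ^ d)" for i
      unfolding F_def
    proof (subst emeasure_lborel_cbox)
      have "(\<Prod>b\<in>Basis. ((\<Sum>b\<in>Basis. (if b \<in> B then p i \<bullet> b + s i else 1) *\<^sub>R b) -
              (\<Sum>b\<in>Basis. (if b \<in> B then p i \<bullet> b - s i else 0) *\<^sub>R b)) \<bullet> b)
          = (\<Prod>b\<in>Basis. if b \<in> B then 2 * s i else 1)"
        by (intro prod.cong) (auto simp: inner_diff_left)
      then show "ennreal (\<Prod>b\<in>Basis. ((\<Sum>b\<in>Basis. (if b \<in> B then p i \<bullet> b + s i else 1) *\<^sub>R b) -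
              (\<Sum>b\<in>Basis. (if b \<in> B then p i \<bullet> b - s i else 0) *\<^sub>R b)) \<bullet> b) = ennreal ((2 * s i) ^ d)"
        by (simp add: prodB)
    qed (use s in auto)
    have "Q \<subseteq> (\<Union>i. F i)"
    proof
      fix x assume "x \<in> Q"
      then have x: "0 \<le> x \<bullet> b" "x \<bullet> b \<le> (if b \<in> B then c else 1)" if "b \<in> Basis" for b
        using that by (auto simp: Q_def cbox_def)
      define y where "y = (\<Sum>b\<in>B. (x \<bullet> b) *\<^sub>R b)"
      have "norm y \<le> (\<Sum>b\<in>B. norm ((x \<bullet> b) *\<^sub>R b))" unfolding y_def by (rule norm_sum)
      also have "\<dots> \<le> (\<Sum>b\<in>B. c)"
      proof (rule sum_mono)
        fix b assume b: "b \<in> B"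
        then have "b \<in> Basis" using B(1) by auto
        then show "norm ((x \<bullet> b) *\<^sub>R b) \<le> c" using x[of b] b by simp
      qed
      also have "\<dots> < 1" using B(2) d by (simp add: c_def)
      finally have "y \<in> ball 0 1" by simp
      moreover have "y \<in> span B"
        unfolding y_def by (intro span_sum span_scale span_base)
      ultimately have "y \<in> span B \<inter> ball 0 1" by blast
      then obtain i where yi: "y \<in> U i" using cov by blast
      then have pi: "p i \<in> U i" unfolding p_def by (rule someI)
      have "norm (y - p i) \<le> s i"
        using diameter_bounded_bound[OF bd yi pi] by (simp add: s_def dist_norm)
      have "\<bar>x \<bullet> b - p i \<bullet> b\<bar> \<le> s i" if "b \<in> B" for b
      proof -
        have "y \<bullet> b = x \<bullet> b"
        proof -
          have "y \<bullet> b = (\<Sum>b'\<in>B. if b' = b then x \<bullet> b else 0)"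
            unfolding y_def inner_sum_left
            using B(1) that by (intro sum.cong) (auto simp: inner_Basis subset_iff)
          then show ?thesis using fB that by simp
        qed
        then have "\<bar>x \<bullet> b - p i \<bullet> b\<bar> = \<bar>(y - p i) \<bullet> b\<bar>" by (simp add: inner_diff_left)
        also have "\<dots> \<le> norm (y - p i)" using B(1) that by (intro Basis_le_norm) auto
        finally show ?thesis using \<open>norm (y - p i) \<le> s i\<close> by simp
      qed
      then have xb: "p i \<bullet> b - s i \<le> x \<bullet> b" "x \<bullet> b \<le> p i \<bullet> b + s i" if "b \<in> B" for b
        using that by (force simp: abs_le_iff)+
      have "x \<in> F i"
        unfolding F_def mem_box
      proof (intro ballI)
        fix b :: 'a assume b: "b \<in> Basis"
        show "(\<Sum>b\<in>Basis. (if b \<in> B then p i \<bullet> b - s i else 0) *\<^sub>R b) \<bullet> b \<le> x \<bullet> b \<and>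
              x \<bullet> b \<le> (\<Sum>b\<in>Basis. (if b \<in> B then p i \<bullet> b + s i else 1) *\<^sub>R b) \<bullet> b"
          using x[OF b] xb[of b] b by (simp split: if_splits)
      qed
      then show "x \<in> (\<Union>i. F i)" by blast
    qed
    then have "ennreal (c ^ d) \<le> emeasure lborel (\<Union>i. F i)"
      unfolding Q[symmetric] by (intro emeasure_mono) (auto simp: F_def)
    also have "\<dots> \<le> (\<Sum>i. emeasure lborel (F i))"
      by (intro emeasure_subadditive_countably) (auto simp: F_def)
    also have "\<dots> = (\<Sum>i. ennreal (2 ^ d) * ennreal (s i) ^ d)"
      using s by (simp add: F power_mult_distrib ennreal_mult ennreal_power)
    finally show ?thesis by (simp add: s_def)
  qed
  have "ennreal (c ^ d) / ennreal (2 ^ d) \<le> hausdorff_delta d 1 (span B \<inter> ball 0 1)"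
    unfolding hausdorff_delta_def
  proof (rule INF_greatest, clarify)
    fix U :: "nat \<Rightarrow> 'a set"
    assume "span B \<inter> ball 0 1 \<subseteq> (\<Union>i. U i)" "\<forall>i. bounded (U i) \<and> diameter (U i) \<le> 1"
    then have "ennreal (c ^ d) \<le> ennreal (2 ^ d) * (\<Sum>i. ennreal (diameter (U i)) ^ d)"
      using main by blast
    then have "ennreal (c ^ d) / ennreal (2 ^ d) \<le> (ennreal (2 ^ d) * (\<Sum>i. ennreal (diameter (U i)) ^ d)) / ennreal (2 ^ d)"
      by (rule divide_right_mono_ennreal)
    also have "\<dots> = (\<Sum>i. ennreal (diameter (U i)) ^ d)"
      by (subst mult.commute, rule ennreal_mult_divide_eq) auto
    finally show "ennreal (c ^ d) / ennreal (2 ^ d) \<le> (\<Sum>i. ennreal (diameter (U i)) ^ d)" .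
  qed
  also have "\<dots> \<le> hausdorff_raw d (span B \<inter> ball 0 1)" by (rule hausdorff_delta_le_raw) simp
  finally have le: "ennreal (c ^ d) / ennreal (2 ^ d) \<le> hausdorff_raw d (span B \<inter> ball 0 1)" .
  have "0 < ennreal (c ^ d) / ennreal (2 ^ d)" using c by (simp add: divide_ennreal)
  then show ?thesis using le by (rule order_less_le_trans)
qed

lemma hausdorff_raw_ball_subspace_le:
  fixes V W :: "'a::euclidean_space set"
  assumes "subspace V" "subspace W" "dim V = dim W"
  shows "hausdorff_raw d (W \<inter> ball 0 1) \<le> hausdorff_raw d (V \<inter> ball 0 1)"
proof -
  obtain f :: "'a \<Rightarrow> 'a" where f: "linear f" "f ` V = W" "\<And>x. x \<in> V \<Longrightarrow> norm (f x) = norm x"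
    using isometries_subspaces[OF assms] by metis
  have "W \<inter> ball 0 1 = f ` (V \<inter> ball 0 1)" using f by fastforce
  moreover have "dist (f x) (f y) \<le> dist x y" if "x \<in> V \<inter> ball 0 1" "y \<in> V \<inter> ball 0 1" for x y
    using that f(3)[of "x - y"] assms(1) by (simp add: dist_norm linear_diff[OF f(1)] subspace_diff)
  ultimately show ?thesis using hausdorff_raw_image_le[of "V \<inter> ball 0 1" f d] by simp
qed

theorem hausdorff_unit_ball:
  fixes W :: "'a::euclidean_space set"
  assumes W: "subspace W" "dim W = d" and d: "1 \<le> d"
  shows "hausdorff d (W \<inter> ball 0 1) = 1"
proof -
  let ?S = "SOME W :: 'a set. subspace W \<and> dim W = d"
  have S: "subspace ?S \<and> dim ?S = d" using someI[of "\<lambda>W. subspace W \<and> dim W = d" W] W by blast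
  have "d \<le> card (Basis :: 'a set)" using W dim_subset_UNIV[of W] by simp
  then obtain B :: "'a set" where B: "B \<subseteq> Basis" "card B = d"
    by (meson obtain_subset_with_card_n)
  have "dim (span B) = d"
    using B by (simp add: dim_eq_card_independent independent_substdbasis)
  then have eq: "hausdorff_raw d (V \<inter> ball 0 1) = hausdorff_raw d (span B \<inter> ball 0 1)"
    if "subspace V" "dim V = d" for V :: "'a set"
    using that \<open>dim (span B) = d\<close>
    by (intro order_antisym[OF hausdorff_raw_ball_subspace_le hausdorff_raw_ball_subspace_le])
       (simp_all del: dim_span)
  have "0 < hausdorff_raw d (span B \<inter> ball 0 1)" "hausdorff_raw d (span B \<inter> ball 0 1) < top"
    using hausdorff_raw_coord_ball_pos[OF B d] hausdorff_raw_coord_ball_finite[OF B d]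
    by (auto simp: less_top[symmetric] top_unique)
  then show ?thesis
    unfolding hausdorff_def eq[OF W] using eq[of ?S] S by (simp add: ennreal_divide_self)
qed

section \<open>Radon measures on Euclidean space\<close>

definition radon_measure :: "'a::euclidean_space measure \<Rightarrow> bool" where
  "radon_measure \<mu> \<longleftrightarrow> sets \<mu> = sets borel \<and> (\<forall>x. \<exists>r>0. emeasure \<mu> (ball x r) < top)"

definition msupport :: "'a::euclidean_space measure \<Rightarrow> 'a set" where
  "msupport \<mu> = {x. \<forall>r>0. 0 < emeasure \<mu> (ball x r)}"

lemma closed_msupport:
  assumes "sets \<mu> = sets borel"
  shows "closed (msupport \<mu>)"
  unfolding closed_limpt islimpt_approachable
proof (intro allI impI)
  fix x assume lim: "\<forall>e>0. \<exists>y\<in>msupport \<mu>. y \<noteq> x \<and> dist y x < e"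
  have "0 < emeasure \<mu> (ball x r)" if r: "r > 0" for r
  proof -
    obtain y where y: "y \<in> msupport \<mu>" "dist y x < r / 2"
      using lim r by (metis half_gt_zero)
    have "ball y (r / 2) \<subseteq> ball x r"
    proof
      fix z assume "z \<in> ball y (r / 2)"
      then show "z \<in> ball x r"
        using y(2) dist_triangle[of x z y] by (simp add: dist_commute)
    qed
    then have "emeasure \<mu> (ball y (r / 2)) \<le> emeasure \<mu> (ball x r)"
      by (intro emeasure_mono) (simp_all add: assms)
    moreover have "0 < emeasure \<mu> (ball y (r / 2))"
      using y(1) r by (simp add: msupport_def)
    ultimately show ?thesis by (rule order_less_le_trans[rotated])
  qed
  then show "x \<in> msupport \<mu>" by (simp add: msupport_def)
qed

definition doubling_with :: "real \<Rightarrow> 'a::euclidean_space measure \<Rightarrow> bool" where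
  "doubling_with C \<mu> \<longleftrightarrow>
     (\<forall>x\<in>msupport \<mu>. \<forall>r>0. emeasure \<mu> (ball x (2 * r)) \<le> ennreal C * emeasure \<mu> (ball x r))"

definition doubling :: "'a::euclidean_space measure \<Rightarrow> bool" where
  "doubling \<mu> \<longleftrightarrow> (\<exists>C\<ge>1. doubling_with C \<mu>)"

text \<open>
  Restriction \<open>A \<mapsto> M (S \<inter> A)\<close> to a measurable set, kept as a measure on the whole space
  (unlike \<^term>\<open>restrict_space\<close>).
\<close>

definition restr :: "'a measure \<Rightarrow> 'a set \<Rightarrow> 'a measure" where
  "restr M S = density M (indicator S)"

lemma emeasure_restr:
  "S \<in> sets M \<Longrightarrow> A \<in> sets M \<Longrightarrow> emeasure (restr M S) A = emeasure M (S \<inter> A)"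
  by (simp add: restr_def emeasure_restricted)

section \<open>The \<open>\<alpha>\<close>-numbers\<close>

definition W1 :: "'a::euclidean_space measure \<Rightarrow> 'a measure \<Rightarrow> ennreal" where
  "W1 \<mu> \<nu> =
     (SUP \<psi>\<in>{\<psi> :: 'a \<Rightarrow> real. 1-lipschitz_on UNIV \<psi> \<and> (\<forall>x. x \<notin> ball 0 1 \<longrightarrow> \<psi> x = 0)}.
        ennreal \<bar>(\<integral>x. \<psi> x \<partial>\<mu>) - (\<integral>x. \<psi> x \<partial>\<nu>)\<bar>)"

definition rescaled :: "'a::euclidean_space measure \<Rightarrow> 'a \<Rightarrow> real \<Rightarrow> 'a measure" where
  "rescaled \<mu> x r =
     scale_measure (inverse (emeasure \<mu> (ball x r))) (distr \<mu> borel (\<lambda>y. (y - x) /\<^sub>R r))"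

lemma emeasure_rescaled:
  assumes "sets \<mu> = sets borel" "0 < r" "A \<in> sets borel"
  shows "emeasure (rescaled \<mu> x r) A = emeasure \<mu> ((\<lambda>a. x + r *\<^sub>R a) ` A) / emeasure \<mu> (ball x r)"
proof -
  have sp: "space \<mu> = UNIV" using sets_eq_imp_space_eq[OF assms(1)] by simp
  have m: "(\<lambda>y. (y - x) /\<^sub>R r) \<in> measurable \<mu> borel"
    unfolding measurable_cong_sets[OF assms(1) refl] by measurable
  have "(\<lambda>y. (y - x) /\<^sub>R r) -` A = (\<lambda>a. x + r *\<^sub>R a) ` A"
    using assms(2) by (force simp: image_iff)
  then show ?thesis
    using assms(3) by (simp add: rescaled_def emeasure_distr[OF m] sp divide_ennreal_def mult.commute)
qed

definition planes :: "nat \<Rightarrow> 'a::euclidean_space set set" where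
  "planes d = {V. affine V \<and> aff_dim V = int d \<and> V \<inter> ball 0 (1/2) \<noteq> {}}"

definition flat_measure :: "nat \<Rightarrow> 'a::euclidean_space set \<Rightarrow> 'a measure" where
  "flat_measure d V =
     scale_measure (inverse (emeasure (hausdorff_measure d) (V \<inter> ball 0 1))) (restr (hausdorff_measure d) V)"

text \<open>The value is only of interest for \<open>x\<close> in the support of \<open>\<mu>\<close>, which has full measure, and \<open>r > 0\<close>.\<close>

definition alpha :: "nat \<Rightarrow> 'a::euclidean_space measure \<Rightarrow> 'a \<Rightarrow> real \<Rightarrow> ennreal" where
  "alpha d \<mu> x r = (INF V\<in>planes d. W1 (rescaled \<mu> x r) (flat_measure d V))"

section \<open>Regularity of sets and \<open>A\<^sub>\<infinity>\<close>\<close>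

definition ahlfors_regular :: "nat \<Rightarrow> 'a::euclidean_space set \<Rightarrow> bool" where
  "ahlfors_regular d E \<longleftrightarrow>
     (\<exists>C>0. \<forall>x\<in>E. \<forall>r>0. ennreal (inverse C * r ^ d) \<le> hausdorff d (E \<inter> ball x r) \<and>
                          hausdorff d (E \<inter> ball x r) \<le> ennreal (C * r ^ d))"

text \<open>
  A point of \<open>\<real>\<^sup>d\<close> is given by its coordinates \<open>i < d\<close>, with Euclidean distance
  \<^term>\<open>L2_set (\<lambda>i. u i - v i) {..<d}\<close>.
\<close>

definition uniformly_rectifiable :: "nat \<Rightarrow> 'a::euclidean_space set \<Rightarrow> bool" where
  "uniformly_rectifiable d E \<longleftrightarrow> ahlfors_regular d E \<and>
     (\<exists>L\<ge>1. \<exists>\<eta>>0. \<forall>x\<in>E. \<forall>r>0. \<exists>A (f :: 'a \<Rightarrow> nat \<Rightarrow> real).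
        A \<in> sets borel \<and> A \<subseteq> E \<inter> ball x r \<and> ennreal (\<eta> * r ^ d) \<le> hausdorff d A \<and>
        (\<forall>y\<in>A. \<forall>z\<in>A. inverse L * dist y z \<le> L2_set (\<lambda>i. f y i - f z i) {..<d} \<and>
                      L2_set (\<lambda>i. f y i - f z i) {..<d} \<le> L * dist y z))"

definition lipschitz_graph :: "real \<Rightarrow> nat \<Rightarrow> 'a::euclidean_space set \<Rightarrow> bool" where
  "lipschitz_graph \<gamma> d G \<longleftrightarrow>
     (\<exists>V f. subspace V \<and> dim V = d \<and> f ` V \<subseteq> V\<^sup>\<bottom> \<and> \<gamma>-lipschitz_on V f \<and> G = {v + f v | v. v \<in> V})"

definition big_pieces_lipschitz_graphs :: "nat \<Rightarrow> 'a::euclidean_space set \<Rightarrow> bool" where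
  "big_pieces_lipschitz_graphs d E \<longleftrightarrow>
     (\<exists>\<eta>>0. \<exists>\<gamma>\<ge>0. \<forall>x\<in>E. \<forall>r>0. \<exists>A G.
        A \<in> sets borel \<and> A \<subseteq> E \<inter> ball x r \<and> ennreal (\<eta> * r ^ d) \<le> hausdorff d A \<and>
        lipschitz_graph \<gamma> d G \<and> A \<subseteq> G)"

text \<open>\<open>\<mu> \<in> A\<^sub>\<infinity>(\<nu>)\<close>, where the balls are centered on the support of \<open>\<mu>\<close>.\<close>

definition A_infinity :: "'a::euclidean_space measure \<Rightarrow> 'a measure \<Rightarrow> bool" where
  "A_infinity \<mu> \<nu> \<longleftrightarrow> radon_measure \<mu> \<and> radon_measure \<nu> \<and> (doubling \<mu> \<or> doubling \<nu>) \<and>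
     (\<exists>\<epsilon>\<in>{0<..<1}. \<exists>\<delta>\<in>{0<..<1}. \<forall>x\<in>msupport \<mu>. \<forall>r>0. \<forall>A\<in>sets borel. A \<subseteq> ball x r \<longrightarrow>
        emeasure \<mu> A \<le> ennreal \<epsilon> * emeasure \<mu> (ball x r) \<longrightarrow>
        emeasure \<nu> A \<le> ennreal \<delta> * emeasure \<nu> (ball x r))"

end

(*
  A measure that is W_1-close to a flat measure on B(x,t) is compared with all its flat
  approximations c H^d|_V by means of unnormalized test functions on B(x,t); the resulting distance,
  unlike the alpha-number itself, is monotone under inclusion of balls. Two approximations of mu on
  one ball have planes and densities that differ at most linearly in their errors: for the planes
  this uses the convexity of dist(.,V') and the reflection symmetry of H^d|_V
  about a point of V. Since the errors at the scales 2^-k R are summable with small sum outside a set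
  covered by stopping balls, the density mu(B(x,s))/s^d stays comparable to its initial value and the
  directions of the planes stay close to the initial one. Hence the good part of a ball lies on a
  Lipschitz graph on which mu and H^d are comparable. The Carleson condition makes the stopping
  balls carry a small proportion of both mu and r^d, and everything on them is recovered by iterating
  the decomposition.
*)
theory Submission
  imports Defs
begin

section \<open>Hausdorff measure under similarities\<close>

text \<open>The hypothesis sums first powers of \<alpha>, not squares. This is why densities can be
  followed from scale to scale: each step changes them by a factor 1 + O(error), and the product of
  these factors stays bounded when the errors have a small sum. The \<alpha>-numbers enter through
  all points near x rather than through x itself: the flatness of B(x,t) is at most a constant times
  \<alpha>(y,s) for every y in B(x,t) and every s in [2t,4t). A stopping centre thus forces the
  inner integral to be large at every point of its stopping ball, and disjoint stopping balls can be
  counted directly, without a maximal function and without measurability of \<alpha>. One density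
  and one direction can serve a whole ball only if all its points start from the same approximation;
  it is taken from a single pair (y,t) of comparable scale with small \<alpha>. Nothing says
  beforehand that H^d is locally finite on the support. Its upper bound is therefore proved for the
  content at a fixed mesh, where the iteration ends after finitely many generations, with a constant
  that does not depend on the mesh.\<close>

lemma integral_scale_measure:
  fixes g :: "'a \<Rightarrow> real"
  assumes "0 \<le> r" "g \<in> borel_measurable M"
  shows "(\<integral>x. g x \<partial>scale_measure (ennreal r) M) = r * (\<integral>x. g x \<partial>M)"
proof -
  have "scale_measure (ennreal r) M = density M (\<lambda>_. ennreal r)"
    by (rule measure_eqI) (auto simp: emeasure_density nn_integral_cmult_indicator)
  then show ?thesis
    using assms by (simp add: integral_density)
qed

lemma hausdorff_raw_lipschitz_image:
  fixes f :: "'a::euclidean_space \<Rightarrow> 'b::euclidean_space"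
  assumes K: "0 < K" and f: "\<And>x y. x \<in> X \<Longrightarrow> y \<in> X \<Longrightarrow> dist (f x) (f y) \<le> K * dist x y"
  shows "hausdorff_raw d (f ` X) \<le> ennreal (K ^ d) * hausdorff_raw d X"
  unfolding hausdorff_raw_def[of d "f ` X"]
proof (rule SUP_least)
  fix \<delta> :: real assume "\<delta> \<in> {0<..}"
  then have \<delta>: "0 < \<delta>" by simp
  have cK: "ennreal (K ^ d) \<noteq> 0" "ennreal (K ^ d) \<noteq> top" using K by auto
  \<comment> \<open>Division by \<open>K ^ d\<close> leaves the infimum over covers of
    \<open>X\<close> alone on the right, so each cover can be treated separately. The covering sets
    are cut down to \<open>X\<close>, the only place where \<open>f\<close> is controlled.\<close>
  have "hausdorff_delta d \<delta> (f ` X) / ennreal (K ^ d) \<le> hausdorff_delta d (\<delta> / K) X"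
    unfolding hausdorff_delta_def[of d "\<delta> / K" X]
  proof (rule INF_greatest, clarify)
    fix U :: "nat \<Rightarrow> 'a set"
    assume cov: "X \<subseteq> (\<Union>i. U i)" and U: "\<forall>i. bounded (U i) \<and> diameter (U i) \<le> \<delta> / K"
    have le: "dist x y \<le> K * diameter (U i)" if xy: "x \<in> f ` (U i \<inter> X)" "y \<in> f ` (U i \<inter> X)" for i x y
    proof -
      obtain x' y' where xy': "x' \<in> U i \<inter> X" "y' \<in> U i \<inter> X" "x = f x'" "y = f y'"
        using xy by blast
      then have "dist x y \<le> K * dist x' y'" using f by auto
      also have "\<dots> \<le> K * diameter (U i)"
        using xy' diameter_bounded_bound[of "U i" x' y'] U K by (intro mult_left_mono) auto
      finally show ?thesis .
    qed
    have dge: "0 \<le> diameter (U i)" for i using U diameter_ge_0 by blast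
    have dle: "diameter (f ` (U i \<inter> X)) \<le> K * diameter (U i)" for i
      by (rule diameter_le) (use le dge[of i] K in \<open>auto simp: dist_norm\<close>)
    have bd: "bounded (f ` (U i \<inter> X))" for i
      using le[of _ i] unfolding bounded_two_points by blast
    have small: "K * diameter (U i) \<le> \<delta>" for i using U K by (simp add: field_simps)
    have "f ` X \<subseteq> (\<Union>i. f ` (U i \<inter> X))" using cov by blast
    then have "hausdorff_delta d \<delta> (f ` X) \<le> (\<Sum>i. ennreal (diameter (f ` (U i \<inter> X))) ^ d)"
      using bd order_trans[OF dle small] by (intro hausdorff_delta_le) auto
    also have "\<dots> \<le> (\<Sum>i. ennreal (K ^ d) * ennreal (diameter (U i)) ^ d)"
    proof (rule suminf_le)
      fix i
      have "ennreal (diameter (f ` (U i \<inter> X))) ^ d \<le> ennreal (K * diameter (U i)) ^ d"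
        using dle by (intro power_mono ennreal_leI) auto
      also have "\<dots> = ennreal (K ^ d) * ennreal (diameter (U i)) ^ d"
        using K dge[of i] by (simp add: ennreal_power ennreal_mult power_mult_distrib)
      finally show "ennreal (diameter (f ` (U i \<inter> X))) ^ d \<le> ennreal (K ^ d) * ennreal (diameter (U i)) ^ d" .
    qed auto
    finally have "hausdorff_delta d \<delta> (f ` X) \<le> ennreal (K ^ d) * (\<Sum>i. ennreal (diameter (U i)) ^ d)"
      by simp
    then have "hausdorff_delta d \<delta> (f ` X) / ennreal (K ^ d)
        \<le> (ennreal (K ^ d) * (\<Sum>i. ennreal (diameter (U i)) ^ d)) / ennreal (K ^ d)"
      by (rule divide_right_mono_ennreal)
    also have "\<dots> = (\<Sum>i. ennreal (diameter (U i)) ^ d)"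
      using cK by (subst mult.commute, intro ennreal_mult_divide_eq) auto
    finally show "hausdorff_delta d \<delta> (f ` X) / ennreal (K ^ d) \<le> (\<Sum>i. ennreal (diameter (U i)) ^ d)" .
  qed
  also have "\<dots> \<le> hausdorff_raw d X" using \<delta> K by (intro hausdorff_delta_le_raw) simp
  finally have "hausdorff_delta d \<delta> (f ` X) / ennreal (K ^ d) \<le> hausdorff_raw d X" .
  then have "ennreal (K ^ d) * (hausdorff_delta d \<delta> (f ` X) / ennreal (K ^ d)) \<le> ennreal (K ^ d) * hausdorff_raw d X"
    by (rule mult_left_mono) simp
  then show "hausdorff_delta d \<delta> (f ` X) \<le> ennreal (K ^ d) * hausdorff_raw d X"
    using cK by (simp add: ennreal_times_divide mult.commute[of "ennreal (K ^ d)"] ennreal_mult_divide_eq)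
qed

text \<open>The Lipschitz bound is applied to \<open>f\<close> and to its inverse on the image of
  \<open>X\<close>; the normalizing factor cancels. Asking for a similarity on \<open>X\<close> only
  admits maps that are isometric just on one subspace.\<close>

lemma hausdorff_similarity_image:
  fixes f :: "'a::euclidean_space \<Rightarrow> 'a"
  assumes K: "0 < K" and f: "\<And>x y. x \<in> X \<Longrightarrow> y \<in> X \<Longrightarrow> dist (f x) (f y) = K * dist x y"
  shows "hausdorff d (f ` X) = ennreal (K ^ d) * hausdorff d X"
proof -
  have inj: "inj_on f X"
    using f K by (intro inj_onI) (metis dist_eq_0_iff mult_eq_0_iff less_irrefl)
  have cK: "ennreal (K ^ d) \<noteq> 0" "ennreal (K ^ d) \<noteq> top" using K by auto
  have 1: "hausdorff_raw d (f ` X) \<le> ennreal (K ^ d) * hausdorff_raw d X"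
    using f by (intro hausdorff_raw_lipschitz_image[OF K]) auto
  have "hausdorff_raw d (inv_into X f ` (f ` X)) \<le> ennreal (inverse K ^ d) * hausdorff_raw d (f ` X)"
    using f K inj by (intro hausdorff_raw_lipschitz_image) (auto simp: field_simps)
  then have "hausdorff_raw d X \<le> ennreal (inverse K ^ d) * hausdorff_raw d (f ` X)"
    using inj by (simp add: image_inv_into_cancel image_image)
  then have "ennreal (K ^ d) * hausdorff_raw d X
      \<le> ennreal (K ^ d) * (ennreal (inverse K ^ d) * hausdorff_raw d (f ` X))"
    by (rule mult_left_mono) simp
  also have "\<dots> = hausdorff_raw d (f ` X)"
    using K by (simp add: mult.assoc[symmetric] ennreal_mult[symmetric] power_mult_distrib[symmetric])
  finally have "hausdorff_raw d (f ` X) = ennreal (K ^ d) * hausdorff_raw d X"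
    using 1 by (rule antisym[rotated])
  then show ?thesis by (simp add: hausdorff_def ennreal_times_divide)
qed

lemma sets_restr [simp, measurable_cong]: "sets (restr M S) = sets M"
  by (simp add: restr_def)

lemma space_restr [simp]: "space (restr M S) = space M"
  by (simp add: restr_def)

lemma restr_hausdorff_similarity:
  fixes T :: "'a::euclidean_space \<Rightarrow> 'a"
  assumes d: "1 \<le> d" and W: "W \<in> sets borel" "T ` W \<in> sets borel" and T: "T \<in> borel_measurable borel"
    and K: "0 < K" and sim: "\<And>x y. x \<in> W \<Longrightarrow> y \<in> W \<Longrightarrow> dist (T x) (T y) = K * dist x y"
  shows "restr (hausdorff_measure d) (T ` W)
       = scale_measure (ennreal (K ^ d)) (distr (restr (hausdorff_measure d) W) borel T)"
proof (rule measure_eqI)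
  fix A :: "'a set" assume "A \<in> sets (restr (hausdorff_measure d) (T ` W))"
  then have A: "A \<in> sets borel" by simp
  have TA: "T -` A \<in> sets borel" using measurable_sets[OF T A] by simp
  have T': "T \<in> borel_measurable (restr (hausdorff_measure d) W)"
    using T by (simp cong: measurable_cong_sets)
  have eq: "T ` W \<inter> A = T ` (W \<inter> T -` A)" by auto
  have TW: "T ` (W \<inter> T -` A) \<in> sets borel"
    using W A unfolding eq[symmetric] by blast
  have "hausdorff d (T ` (W \<inter> T -` A)) = ennreal (K ^ d) * hausdorff d (W \<inter> T -` A)"
    using sim by (intro hausdorff_similarity_image[OF K]) auto
  then show "emeasure (restr (hausdorff_measure d) (T ` W)) A =
      emeasure (scale_measure (ennreal (K ^ d)) (distr (restr (hausdorff_measure d) W) borel T)) A"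
    using A TA TW W d
    by (simp add: emeasure_restr emeasure_distr[OF T'] emeasure_hausdorff_measure eq)
qed simp

lemma integral_restr_hausdorff_similarity:
  fixes T :: "'a::euclidean_space \<Rightarrow> 'a" and g :: "'a \<Rightarrow> real"
  assumes d: "1 \<le> d" and W: "W \<in> sets borel" "T ` W \<in> sets borel" and T: "T \<in> borel_measurable borel"
    and K: "0 < K" and sim: "\<And>x y. x \<in> W \<Longrightarrow> y \<in> W \<Longrightarrow> dist (T x) (T y) = K * dist x y"
    and g: "g \<in> borel_measurable borel"
  shows "(\<integral>x. g x \<partial>restr (hausdorff_measure d) (T ` W))
       = K ^ d * (\<integral>u. g (T u) \<partial>restr (hausdorff_measure d) W)"
proof -
  have T': "T \<in> borel_measurable (restr (hausdorff_measure d) W)"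
    using T by (simp cong: measurable_cong_sets)
  show ?thesis
    using K g T' restr_hausdorff_similarity[OF d W T K sim]
    by (simp add: integral_scale_measure integral_distr)
qed

text \<open>
  Planes are parametrized by isometric copies \<open>u \<mapsto> p + f u\<close> of one fixed subspace, so that all flat
  measures are images of a single reference measure.
\<close>

locale flat_model =
  fixes d :: nat and W :: "'a::euclidean_space set"
  assumes d1: "1 \<le> d" and W: "subspace W" and dimW: "dim W = d"
begin

definition lam :: "'a measure" where
  "lam = restr (hausdorff_measure d) W"

text \<open>Norms are preserved only on \<open>W\<close>, where \<open>lam\<close> is concentrated;
  linearity on the whole space gives measurability.\<close>

definition rigid :: "('a \<Rightarrow> 'a) \<Rightarrow> bool" where
  "rigid f \<longleftrightarrow> linear f \<and> (\<forall>u\<in>W. norm (f u) = norm u)"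

lemma sets_lam [simp, measurable_cong]: "sets lam = sets borel"
  by (simp add: lam_def)

lemma space_lam [simp]: "space lam = UNIV"
  by (simp add: lam_def)

lemma W_borel [measurable]: "W \<in> sets borel"
  using closed_subspace[OF W] by simp

lemma W_0 [simp]: "0 \<in> W"
  using W by (rule subspace_0)

lemma emeasure_lam: "A \<in> sets borel \<Longrightarrow> emeasure lam A = hausdorff d (W \<inter> A)"
  unfolding lam_def by (simp add: emeasure_restr emeasure_hausdorff_measure[OF d1])

lemma emeasure_lam_ball:
  assumes "0 < r"
  shows "emeasure lam (ball 0 r) = ennreal (r ^ d)"
proof -
  have "W \<inter> ball 0 r = (\<lambda>u. r *\<^sub>R u) ` (W \<inter> ball 0 1)"
  proof (intro equalityI subsetI)
    fix u assume "u \<in> W \<inter> ball 0 r"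
    then have "u /\<^sub>R r \<in> W \<inter> ball 0 1" "u = r *\<^sub>R (u /\<^sub>R r)"
      using assms W by (auto simp: subspace_scale field_simps)
    then show "u \<in> (\<lambda>u. r *\<^sub>R u) ` (W \<inter> ball 0 1)" by blast
  qed (use assms W in \<open>auto simp: subspace_scale\<close>)
  also have "hausdorff d \<dots> = ennreal (r ^ d) * hausdorff d (W \<inter> ball 0 1)"
    using assms by (intro hausdorff_similarity_image)
      (auto simp: dist_norm simp flip: scaleR_diff_right)
  finally show ?thesis by (simp add: emeasure_lam hausdorff_unit_ball[OF W dimW d1])
qed

lemma AE_lam: "AE u in lam. u \<in> W"
proof (rule AE_I)
  show "emeasure lam (- W) = 0"
    using emeasure_lam[of "- W"] emeasure_hausdorff_measure[OF d1, of "{} :: 'a set"] by simp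
qed auto

lemma linear_borel: "linear f \<Longrightarrow> f \<in> borel_measurable (borel :: 'a measure)" for f :: "'a \<Rightarrow> 'a"
  by (intro borel_measurable_continuous_onI linear_continuous_on) (simp add: linear_conv_bounded_linear)

lemma rigid_dist: "rigid f \<Longrightarrow> u \<in> W \<Longrightarrow> v \<in> W \<Longrightarrow> dist (f u) (f v) = dist u v"
  using W by (simp add: rigid_def dist_norm subspace_diff flip: linear_diff)

lemma rigid_image_subspace: "rigid f \<Longrightarrow> subspace (f ` W)"
  using W by (simp add: rigid_def linear_subspace_image)

lemma rigid_plane_closed: "rigid f \<Longrightarrow> closed ((\<lambda>u. p + f u) ` W)"
proof -
  assume "rigid f"
  then have "closed ((+) p ` (f ` W))"
    by (intro closed_translation closed_subspace rigid_image_subspace)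
  then show ?thesis by (simp add: image_image)
qed

lemma rigid_plane_borel: "rigid f \<Longrightarrow> (\<lambda>u. p + f u) ` W \<in> sets borel"
  by (rule borel_closed[OF rigid_plane_closed])

lemma integral_lam_translate:
  fixes g :: "'a \<Rightarrow> real"
  assumes w: "w \<in> W" and g: "g \<in> borel_measurable borel"
  shows "(\<integral>u. g (w + u) \<partial>lam) = (\<integral>u. g u \<partial>lam)"
proof -
  have eq: "(+) w ` W = W"
    using w W by (auto simp: subspace_add image_iff intro!: bexI[of _ "_ - w"] subspace_diff)
  show ?thesis
    using integral_restr_hausdorff_similarity[of d W "(+) w" 1 g] d1 g eq by (simp add: lam_def)
qed

lemma integral_lam_reflect:
  fixes g :: "'a \<Rightarrow> real"
  assumes g: "g \<in> borel_measurable borel"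
  shows "(\<integral>u. g (- u) \<partial>lam) = (\<integral>u. g u \<partial>lam)"
proof -
  have eq: "uminus ` W = W"
    using W by (auto simp: subspace_neg image_iff intro!: bexI[of _ "- _"])
  show ?thesis
    using integral_restr_hausdorff_similarity[of d W uminus 1 g] d1 g eq
    by (simp add: lam_def dist_norm norm_minus_commute)
qed

lemma integral_lam_scale:
  fixes g :: "'a \<Rightarrow> real"
  assumes t: "0 < t" and g: "g \<in> borel_measurable borel"
  shows "t ^ d * (\<integral>u. g (t *\<^sub>R u) \<partial>lam) = (\<integral>u. g u \<partial>lam)"
proof -
  have eq: "(\<lambda>u. t *\<^sub>R u) ` W = W"
  proof (intro equalityI subsetI)
    fix u assume "u \<in> W"
    then have "u /\<^sub>R t \<in> W" "u = t *\<^sub>R (u /\<^sub>R t)" using t W by (auto simp: subspace_scale)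
    then show "u \<in> (\<lambda>u. t *\<^sub>R u) ` W" by blast
  qed (use W in \<open>auto simp: subspace_scale\<close>)
  show ?thesis
    using integral_restr_hausdorff_similarity[of d W "\<lambda>u. t *\<^sub>R u" t g] d1 t g eq
    by (simp add: lam_def dist_norm flip: scaleR_diff_right)
qed

lemma plane_param:
  assumes V: "affine V" "aff_dim V = int d"
  obtains p f where "rigid f" "V = (\<lambda>u. p + f u) ` W"
    "\<And>g :: 'a \<Rightarrow> real. g \<in> borel_measurable borel \<Longrightarrow>
       (\<integral>x. g x \<partial>restr (hausdorff_measure d) V) = (\<integral>u. g (p + f u) \<partial>lam)"
proof -
  have "V \<noteq> {}" using V d1 by auto
  then obtain p where p: "p \<in> V" by auto
  define L where "L = (\<lambda>x. - p + x) ` V"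
  have L: "subspace L"
    unfolding L_def using affine_diffs_subspace[OF V(1) p] by simp
  have VL: "V = (+) p ` L" by (simp add: L_def image_image)
  have "dim L = d"
    using V(2) aff_dim_translation_eq[of p L] aff_dim_subspace[OF L] VL by simp
  then obtain f where f: "linear f" "f ` W = L" "\<And>x. x \<in> W \<Longrightarrow> norm (f x) = norm x"
    using isometries_subspaces[OF W L] dimW by metis
  then have rf: "rigid f" by (simp add: rigid_def)
  have Veq: "V = (\<lambda>u. p + f u) ` W" unfolding VL f(2)[symmetric] image_image ..
  show thesis
  proof (rule that[OF rf Veq])
    fix g :: "'a \<Rightarrow> real" assume g: "g \<in> borel_measurable borel"
    show "(\<integral>x. g x \<partial>restr (hausdorff_measure d) V) = (\<integral>u. g (p + f u) \<partial>lam)"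
      using integral_restr_hausdorff_similarity[of d W "\<lambda>u. p + f u" 1 g] d1 g Veq
        rigid_plane_borel[OF rf, of p] rigid_dist[OF rf] linear_borel[OF f(1)]
      by (simp add: lam_def)
  qed
qed

end

section \<open>Flat approximations of a doubling measure\<close>

definition test :: "'a::euclidean_space \<Rightarrow> real \<Rightarrow> ('a \<Rightarrow> real) \<Rightarrow> bool" where
  "test x t \<psi> \<longleftrightarrow> 1-lipschitz_on UNIV \<psi> \<and> (\<forall>y. y \<notin> ball x t \<longrightarrow> \<psi> y = 0)"

lemma testI:
  assumes "\<And>y z. \<bar>\<psi> y - \<psi> z\<bar> \<le> dist y z" "\<And>y. y \<notin> ball x t \<Longrightarrow> \<psi> y = 0"
  shows "test x t \<psi>"
  unfolding test_def using assms by (auto intro!: lipschitz_onI simp: dist_real_def)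

lemma test_lip: "test x t \<psi> \<Longrightarrow> \<bar>\<psi> y - \<psi> z\<bar> \<le> dist y z"
  unfolding test_def using lipschitz_onD[of 1 UNIV \<psi> y z] by (simp add: dist_real_def)

lemma test_outside: "test x t \<psi> \<Longrightarrow> y \<notin> ball x t \<Longrightarrow> \<psi> y = 0"
  by (simp add: test_def)

lemma test_mono: "test y s \<psi> \<Longrightarrow> ball y s \<subseteq> ball x t \<Longrightarrow> test x t \<psi>"
  unfolding test_def by blast

lemma test_borel: "test x t \<psi> \<Longrightarrow> \<psi> \<in> borel_measurable borel"
  unfolding test_def by (meson borel_measurable_continuous_onI lipschitz_on_continuous_on)

lemma test_bound:
  fixes x :: "'a::euclidean_space"
  assumes "test x t \<psi>"
  shows "\<bar>\<psi> y\<bar> \<le> 2 * \<bar>t\<bar>"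
proof (cases "y \<in> ball x t")
  case True
  then have t: "0 < t" by (metis mem_ball zero_le_dist le_less_trans)
  \<comment> \<open>A boundary point \<open>x + t *\<^sub>R e\<close> is a zero of
    \<open>\<psi>\<close> at distance less than \<open>2 * t\<close> from \<open>y\<close>.\<close>
  obtain e :: 'a where e: "norm e = 1" using vector_choose_size[of 1] by auto
  have "\<psi> (x + t *\<^sub>R e) = 0"
    using assms e t by (intro test_outside[OF assms]) (simp add: dist_norm)
  moreover have "dist y (x + t *\<^sub>R e) \<le> dist y x + dist x (x + t *\<^sub>R e)"
    by (rule dist_triangle)
  moreover have "dist x (x + t *\<^sub>R e) = t" using e t by (simp add: dist_norm)
  ultimately show ?thesis
    using test_lip[OF assms, of y "x + t *\<^sub>R e"] True t by (simp add: dist_commute)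
qed (use assms in \<open>simp add: test_outside\<close>)

text \<open>Lipschitz substitute for the indicator of a ball: it is at least \<open>s / 2\<close> on
  B(x,s/2) and at most \<open>s\<close> on B(x,s), so its integral is comparable to \<open>s\<close>
  times a mass.\<close>

definition bump :: "'a::euclidean_space \<Rightarrow> real \<Rightarrow> 'a \<Rightarrow> real" where
  "bump x s z = max 0 (s - dist x z)"

lemma test_bump: "test x s (bump x s)"
proof (rule testI)
  fix y z
  show "\<bar>bump x s y - bump x s z\<bar> \<le> dist y z"
    using dist_triangle[of x y z] dist_triangle[of x z y] dist_commute[of y z]
    unfolding bump_def by linarith
qed (simp add: bump_def)

lemma integral_ge_on:
  fixes g :: "'b \<Rightarrow> real"
  assumes "integrable M g" "A \<in> sets M" "emeasure M A < top"
    and "AE x in M. a * indicator A x \<le> g x"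
  shows "a * measure M A \<le> (\<integral>x. g x \<partial>M)"
proof -
  have "(\<integral>x. a * indicator A x \<partial>M) \<le> (\<integral>x. g x \<partial>M)"
    using assms by (intro integral_mono_AE) auto
  then show ?thesis using assms(2) by (simp add: sets.Int_space_eq2)
qed

lemma integral_le_on:
  fixes g :: "'b \<Rightarrow> real"
  assumes "integrable M g" "A \<in> sets M" "emeasure M A < top"
    and "AE x in M. g x \<le> a * indicator A x"
  shows "(\<integral>x. g x \<partial>M) \<le> a * measure M A"
proof -
  have "(\<integral>x. g x \<partial>M) \<le> (\<integral>x. a * indicator A x \<partial>M)"
    using assms by (intro integral_mono_AE) auto
  then show ?thesis using assms(2) by (simp add: sets.Int_space_eq2)
qed

context flat_model
begin

lemma measure_lam_ball: "0 < r \<Longrightarrow> measure lam (ball 0 r) = r ^ d"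
  by (simp add: measure_def emeasure_lam_ball)

lemma rigid_norm: "rigid f \<Longrightarrow> u \<in> W \<Longrightarrow> norm (f u) = norm u"
  by (simp add: rigid_def)

lemma rigid_borel: "rigid f \<Longrightarrow> f \<in> borel_measurable borel"
  by (simp add: rigid_def linear_borel)

lemma rigid_neg: "rigid f \<Longrightarrow> f (- u) = - f u"
  by (simp add: rigid_def linear_neg)

lemma rigid_add: "rigid f \<Longrightarrow> f (u + v) = f u + f v"
  by (simp add: rigid_def linear_add)

lemma rigid_diff: "rigid f \<Longrightarrow> f (u - v) = f u - f v"
  by (simp add: rigid_def linear_diff)

lemma rigid_scale: "rigid f \<Longrightarrow> f (a *\<^sub>R u) = a *\<^sub>R f u"
  by (simp add: rigid_def linear_cmul)

lemma integrable_lam: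
  assumes \<psi>: "test x t \<psi>" and f: "rigid f"
  shows "integrable lam (\<lambda>u. \<psi> (p + f u))"
proof (rule Bochner_Integration.integrable_bound)
  let ?R = "\<bar>t\<bar> + norm (x - p) + 1"
  show "integrable lam (\<lambda>u. (2 * \<bar>t\<bar>) * indicator (ball 0 ?R) u :: real)"
    by (intro integrable_mult_right integrable_real_indicator)
       (simp_all add: emeasure_lam_ball[of ?R] add_nonneg_pos)
  show "(\<lambda>u. \<psi> (p + f u)) \<in> borel_measurable lam"
    using test_borel[OF \<psi>] rigid_borel[OF f] by simp
  show "AE u in lam. norm (\<psi> (p + f u)) \<le> norm ((2 * \<bar>t\<bar>) * indicator (ball 0 ?R) u :: real)"
    using AE_lam
  proof eventually_elim
    case (elim u)
    show ?case
    proof (cases "p + f u \<in> ball x t")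
      case True
      have "norm u = norm (f u)" using rigid_norm[OF f elim] by simp
      also have "\<dots> \<le> norm (x - (p + f u)) + norm (x - p)"
        using norm_triangle_ineq4[of "x - p" "x - (p + f u)"] by (simp add: norm_minus_commute)
      also have "\<dots> < ?R" using True by (simp add: dist_norm)
      finally have "u \<in> ball 0 ?R" by simp
      then show ?thesis using test_bound[OF \<psi>] by (simp del: mem_ball)
    qed (use test_outside[OF \<psi>] in simp)
  qed
qed

lemma integral_lam_bump_ge:
  assumes f: "rigid f" and t: "0 < t" and q: "dist x q < t / 4"
  shows "t / 2 * (t / 4) ^ d \<le> (\<integral>u. bump x t (q + f u) \<partial>lam)"
proof -
  have "t / 2 * measure lam (ball 0 (t / 4)) \<le> (\<integral>u. bump x t (q + f u) \<partial>lam)"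
  proof (rule integral_ge_on[OF integrable_lam[OF test_bump f]])
    show "AE u in lam. t / 2 * indicator (ball 0 (t / 4)) u \<le> bump x t (q + f u)"
      using AE_lam
    proof eventually_elim
      case (elim u)
      have "dist x (q + f u) \<le> norm u + dist x q"
        using rigid_norm[OF f elim] norm_triangle_ineq4[of "x - q" "f u"]
        by (simp add: dist_norm diff_diff_add)
      then show ?case using q t by (auto simp: bump_def indicator_def)
    qed
  qed (use t in \<open>simp_all add: emeasure_lam_ball\<close>)
  then show ?thesis using t by (simp add: measure_lam_ball)
qed

end

section \<open>Doubling measures and their approximation by flat measures\<close>

locale doubling_measure = flat_model d W for d and W :: "'a::euclidean_space set" +
  fixes \<mu> :: "'a measure" and D :: real
  assumes radon: "radon_measure \<mu>" and doubling: "doubling_with D \<mu>" and D1: "1 \<le> D"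
begin

abbreviation "\<Sigma> \<equiv> msupport \<mu>"

abbreviation m :: "'a \<Rightarrow> real \<Rightarrow> real" where
  "m x t \<equiv> measure \<mu> (ball x t)"

lemma sets_mu [simp, measurable_cong]: "sets \<mu> = sets borel"
  using radon by (simp add: radon_measure_def)

lemma space_mu [simp]: "space \<mu> = UNIV"
  using sets_eq_imp_space_eq[OF sets_mu] by simp

lemma finite_ball: "emeasure \<mu> (ball x t) < top"
proof -
  obtain r where r: "\<And>x. r x > 0 \<and> emeasure \<mu> (ball x (r x)) < top"
    using radon unfolding radon_measure_def by metis
  have "compact (cball x t)" by simp
  moreover have "y \<in> ball y (r y)" for y using r[of y] by simp
  then have "cball x t \<subseteq> (\<Union>y\<in>UNIV. ball y (r y))" by blast
  ultimately obtain K where K: "finite K" "cball x t \<subseteq> (\<Union>y\<in>K. ball y (r y))"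
    using compactE_image[of "cball x t" UNIV "\<lambda>y. ball y (r y)"] by (metis open_ball)
  have "emeasure \<mu> (ball x t) \<le> emeasure \<mu> (\<Union>y\<in>K. ball y (r y))"
    using K ball_subset_cball by (intro emeasure_mono) (auto intro!: sets.finite_UN)
  also have "\<dots> \<le> (\<Sum>y\<in>K. emeasure \<mu> (ball y (r y)))"
    using K by (intro emeasure_subadditive_finite) auto
  also have "\<dots> < top" using K(1) by (induction K rule: finite_induct) (use r in auto)
  finally show ?thesis .
qed

lemma emeasure_ball: "emeasure \<mu> (ball x t) = ennreal (m x t)"
  using finite_ball[of x t] by (intro emeasure_eq_ennreal_measure) (simp add: less_top)

lemma m_pos: "x \<in> \<Sigma> \<Longrightarrow> 0 < t \<Longrightarrow> 0 < m x t"
proof -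
  assume "x \<in> \<Sigma>" "0 < t"
  then have "0 < ennreal (m x t)" unfolding emeasure_ball[symmetric] by (simp add: msupport_def)
  then show ?thesis by simp
qed

lemma m_mono: "ball x s \<subseteq> ball y t \<Longrightarrow> m x s \<le> m y t"
  using emeasure_mono[of "ball x s" "ball y t" \<mu>] by (simp add: emeasure_ball)

lemma m_double: "x \<in> \<Sigma> \<Longrightarrow> 0 < t \<Longrightarrow> m x (2 * t) \<le> D * m x t"
  using doubling D1 unfolding doubling_with_def emeasure_ball
  by (simp add: ennreal_mult[symmetric])

lemma m_pow: "x \<in> \<Sigma> \<Longrightarrow> 0 < t \<Longrightarrow> m x (2 ^ j * t) \<le> D ^ j * m x t"
proof (induction j)
  case (Suc j)
  have "m x (2 ^ Suc j * t) \<le> D * m x (2 ^ j * t)"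
    using m_double[of x "2 ^ j * t"] Suc.prems by (simp add: mult.assoc)
  also have "\<dots> \<le> D * (D ^ j * m x t)" using Suc D1 by (intro mult_left_mono) auto
  finally show ?case by simp
qed simp

text \<open>Every power of \<open>D\<close> below comes from here; \<open>j\<close> counts the
  doublings that take B(x,t) past B(y,s).\<close>

lemma m_comp:
  assumes "x \<in> \<Sigma>" "0 < t" "dist x y + s \<le> 2 ^ j * t"
  shows "m y s \<le> D ^ j * m x t"
proof -
  have "ball y s \<subseteq> ball x (2 ^ j * t)"
  proof
    fix z assume "z \<in> ball y s"
    then show "z \<in> ball x (2 ^ j * t)" using assms(3) dist_triangle[of x z y] by simp
  qed
  then have "m y s \<le> m x (2 ^ j * t)" by (rule m_mono)
  also have "\<dots> \<le> D ^ j * m x t" using assms by (intro m_pow)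
  finally show ?thesis .
qed

lemma integrable_mu: "test x t \<psi> \<Longrightarrow> integrable \<mu> \<psi>"
proof (rule Bochner_Integration.integrable_bound)
  assume \<psi>: "test x t \<psi>"
  show "integrable \<mu> (\<lambda>u. (2 * \<bar>t\<bar>) * indicator (ball x t) u :: real)"
    by (intro integrable_mult_right integrable_real_indicator) (simp_all add: finite_ball)
  show "\<psi> \<in> borel_measurable \<mu>" using test_borel[OF \<psi>] by simp
  show "AE u in \<mu>. norm (\<psi> u) \<le> norm ((2 * \<bar>t\<bar>) * indicator (ball x t) u :: real)"
    using test_bound[OF \<psi>] test_outside[OF \<psi>] by (auto simp: indicator_def)
qed

lemma integral_bump_ge: "0 < s \<Longrightarrow> s / 2 * m y (s / 2) \<le> (\<integral>z. bump y s z \<partial>\<mu>)"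
proof (rule integral_ge_on[OF integrable_mu[OF test_bump]])
  show "AE z in \<mu>. s / 2 * indicator (ball y (s / 2)) z \<le> bump y s z"
    by (intro AE_I2) (auto simp: bump_def indicator_def max_def)
qed (simp_all add: finite_ball)

lemma integral_bump_le: "0 < s \<Longrightarrow> (\<integral>z. bump y s z \<partial>\<mu>) \<le> s * m y s"
proof (rule integral_le_on[OF integrable_mu[OF test_bump]])
  assume "0 < s"
  then show "AE z in \<mu>. bump y s z \<le> s * indicator (ball y s) z"
    by (intro AE_I2) (auto simp: bump_def indicator_def max_def)
qed (simp_all add: finite_ball)

text \<open>The density \<open>c\<close> is not tied to the mass of the plane in the ball, and the
  plane may even miss the ball. This freedom lets an approximation pass unchanged to a smaller
  ball.\<close>

definition approx :: "real \<Rightarrow> 'a \<Rightarrow> ('a \<Rightarrow> 'a) \<Rightarrow> 'a \<Rightarrow> real \<Rightarrow> real \<Rightarrow> bool" where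
  "approx c p f x t e \<longleftrightarrow> 0 \<le> c \<and> rigid f \<and>
     (\<forall>\<psi>. test x t \<psi> \<longrightarrow> \<bar>(\<integral>y. \<psi> y \<partial>\<mu>) - c * (\<integral>u. \<psi> (p + f u) \<partial>lam)\<bar> \<le> e)"

text \<open>The unit \<open>t * m x t\<close> is the factor by which integrals of test functions
  change under the rescaling in \<open>alpha\<close>, so \<open>b\<close> is an error on the scale
  of \<alpha>.\<close>

abbreviation "rapprox b c p f x t \<equiv> approx c p f x t (b * t * m x t)"

lemma approxD: "approx c p f x t e \<Longrightarrow> test x t \<psi> \<Longrightarrow>
    \<bar>(\<integral>y. \<psi> y \<partial>\<mu>) - c * (\<integral>u. \<psi> (p + f u) \<partial>lam)\<bar> \<le> e"
  by (simp add: approx_def)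

lemma approx_rigid: "approx c p f x t e \<Longrightarrow> rigid f"
  by (simp add: approx_def)

lemma approx_nonneg: "approx c p f x t e \<Longrightarrow> 0 \<le> c"
  by (simp add: approx_def)

lemma approx_mono: "approx c p f x t e \<Longrightarrow> ball y s \<subseteq> ball x t \<Longrightarrow> e \<le> e' \<Longrightarrow> approx c p f y s e'"
  unfolding approx_def using test_mono by (meson order_trans)

lemma approx_shift:
  assumes "approx c p f x t e" "w \<in> W"
  shows "approx c (p + f w) f x t e"
  unfolding approx_def
proof (intro conjI allI impI)
  fix \<psi> assume \<psi>: "test x t \<psi>"
  note f = approx_rigid[OF assms(1)]
  have "(\<integral>u. \<psi> (p + f (w + u)) \<partial>lam) = (\<integral>u. \<psi> (p + f u) \<partial>lam)"
    using assms(2) test_borel[OF \<psi>] rigid_borel[OF f] by (intro integral_lam_translate) auto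
  then show "\<bar>(\<integral>y. \<psi> y \<partial>\<mu>) - c * (\<integral>u. \<psi> (p + f w + f u) \<partial>lam)\<bar> \<le> e"
    using approxD[OF assms(1) \<psi>] by (simp add: rigid_add[OF f] add.assoc)
qed (use assms in \<open>auto simp: approx_def\<close>)

text \<open>If the plane missed B(y,s), the bump there would have integral zero against the flat
  measure, while \<mu> gives it more than \<open>e\<close>.\<close>

lemma approx_near:
  assumes a: "approx c p f x t e" and s: "0 < s" "ball y s \<subseteq> ball x t"
    and e: "e < s / 2 * m y (s / 2)"
  shows "\<exists>u\<in>W. dist y (p + f u) < s"
proof (rule ccontr)
  assume n: "\<not> ?thesis"
  have "AE u in lam. bump y s (p + f u) = 0"
    using AE_lam by eventually_elim (use n in \<open>auto simp: bump_def not_less\<close>)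
  then have "(\<integral>u. bump y s (p + f u) \<partial>lam) = 0" by (rule integral_eq_zero_AE)
  then have "\<bar>\<integral>z. bump y s z \<partial>\<mu>\<bar> \<le> e"
    using approxD[OF a test_mono[OF test_bump s(2)]] by simp
  then show False using integral_bump_ge[OF s(1), of y] e by linarith
qed

text \<open>Translation invariance of \<open>lam\<close> allows the base point to be moved to the
  orthogonal projection of \<open>x\<close>. By Pythagoras, radial functions about \<open>x\<close>
  then see the plane only through its distance from \<open>x\<close>.\<close>

lemma approx_normal:
  assumes a: "approx c p f x t e"
  obtains w where "w \<in> W" "approx c (p + f w) f x t e"
    "\<And>u. u \<in> W \<Longrightarrow> (x - (p + f w)) \<bullet> f u = 0"
    "\<And>u. u \<in> W \<Longrightarrow> (dist x (p + f w + f u))\<^sup>2 = (dist x (p + f w))\<^sup>2 + (norm u)\<^sup>2"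
proof -
  note f = approx_rigid[OF a]
  have sp: "span (f ` W) = f ` W" using rigid_image_subspace[OF f] by (simp add: span_eq_iff)
  obtain y z where yz: "y \<in> f ` W" "\<And>w. w \<in> f ` W \<Longrightarrow> orthogonal z w" "x - p = y + z"
    using orthogonal_subspace_decomp_exists[of "f ` W" "x - p"] unfolding sp by metis
  then obtain w where w: "w \<in> W" "y = f w" by blast
  have z: "z = x - (p + f w)" using yz(3) w(2) by (simp add: algebra_simps)
  have orth: "(x - (p + f w)) \<bullet> f u = 0" if "u \<in> W" for u
    using yz(2) that unfolding z orthogonal_def by blast
  have "(dist x (p + f w + f u))\<^sup>2 = (dist x (p + f w))\<^sup>2 + (norm u)\<^sup>2" if "u \<in> W" for u
  proof -
    have "(norm ((x - (p + f w)) - f u))\<^sup>2 = (norm (x - (p + f w)))\<^sup>2 + (norm (f u))\<^sup>2"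
      using orth[OF that] by (simp add: power2_norm_eq_inner inner_diff_left inner_diff_right inner_commute)
    then show ?thesis using rigid_norm[OF f that] by (simp add: dist_norm diff_diff_add)
  qed
  then show thesis using that w(1) approx_shift[OF a w(1)] orth by blast
qed

text \<open>Upper density constant of \<open>approx_density\<close>; the computation there gives
  \<open>8 / 3 * D * 2 ^ d\<close>, rounded up.\<close>

definition \<kappa> :: real where "\<kappa> = 4 * D * 2 ^ d"

lemma \<kappa>_ge: "8 \<le> \<kappa>"
proof -
  have "(4::real) * 1 * 2 ^ 1 \<le> 4 * D * 2 ^ d"
    using D1 d1 by (intro mult_mono power_increasing) auto
  then show ?thesis by (simp add: \<kappa>_def)
qed

text \<open>Both bounds come from testing with the bump at \<open>x\<close>. A point of the plane
  close to \<open>x\<close> must be found first: it makes the plane cut B(x,t) in a substantial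
  piece, so that the flat integral is comparable to \<open>t * t ^ d\<close>.\<close>

lemma approx_density:
  assumes x: "x \<in> \<Sigma>" and t: "0 < t" and a: "rapprox b c p f x t"
    and b: "b * (8 * D ^ 3) < 1"
  shows "m x t \<le> \<kappa> * (c * t ^ d)" "c * t ^ d \<le> 4 ^ (d + 1) * m x t"
    "\<exists>u\<in>W. dist x (p + f u) < t / 4"
proof -
  note f = approx_rigid[OF a] and mp = m_pos[OF x t]
  have "m x t \<le> D ^ 3 * m x (t / 8)"
    using m_comp[of x "t / 8" x t 3] x t by simp
  then have "8 * m x t * b * D ^ 3 < D ^ 3 * m x (t / 8)"
    using mult_strict_left_mono[OF b mp] by (simp add: mult_ac)
  then have "8 * b * m x t < m x (t / 8)"
    using D1 by (simp add: mult_ac)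
  then have "b * t * m x t < t / 4 / 2 * m x (t / 4 / 2)"
    using t mult_strict_left_mono[of "8 * b * m x t" "m x (t / 8)" "t / 8"] by (simp add: mult_ac)
  then show near: "\<exists>u\<in>W. dist x (p + f u) < t / 4"
    using approx_near[OF a, of "t / 4" x] t subset_ball[of "t / 4" t x] by auto
  then obtain v where v: "v \<in> W" "dist x (p + f v) < t / 4" by blast
  define q where "q = p + f v"
  have q: "dist x q < t / 4" using v by (simp add: q_def)
  have aq: "rapprox b c q f x t" unfolding q_def by (rule approx_shift[OF a v(1)])
  note ap = approxD[OF aq test_bump] and int = integrable_lam[OF test_bump f, of x t q]
  have c0: "0 \<le> c" using a by (rule approx_nonneg)
  have b4: "b * (4 * D) \<le> 1 / 2"
  proof (cases "b \<le> 0")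
    case True
    then have "b * (4 * D) \<le> 0" using D1 by (intro mult_nonpos_nonneg) auto
    then show ?thesis by linarith
  next
    case False
    have "D ^ 1 \<le> D ^ 3" using D1 by (intro power_increasing) auto
    then have "b * (8 * D) \<le> b * (8 * D ^ 3)" using False by (intro mult_left_mono) auto
    then show ?thesis using b by linarith
  qed
  have bD: "b * t * m x t * (4 * D) \<le> t * m x t / 2"
    using mult_right_mono[OF b4, of "t * m x t"] t mp by (simp add: mult_ac)
  have D0: "0 < D" using D1 by simp
  have lo: "(\<integral>u. bump x t (q + f u) \<partial>lam) \<le> t * (2 * t) ^ d"
  proof -
    have "(\<integral>u. bump x t (q + f u) \<partial>lam) \<le> t * measure lam (ball 0 (2 * t))"
    proof (rule integral_le_on[OF int])
      show "AE u in lam. bump x t (q + f u) \<le> t * indicator (ball 0 (2 * t)) u"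
        using AE_lam
      proof eventually_elim
        case (elim u)
        have "norm u \<le> dist x (q + f u) + dist x q"
          using rigid_norm[OF f elim] norm_triangle_ineq4[of "x - q" "x - (q + f u)"]
          by (simp add: dist_norm norm_minus_commute)
        then show ?case using q t by (auto simp: bump_def indicator_def)
      qed
    qed (use t in \<open>simp_all add: emeasure_lam_ball\<close>)
    then show ?thesis using t by (simp add: measure_lam_ball)
  qed
  have hi: "t / 2 * (t / 4) ^ d \<le> (\<integral>u. bump x t (q + f u) \<partial>lam)"
    using q by (rule integral_lam_bump_ge[OF f t])
  have "m x t \<le> D * m x (t / 2)" using m_double[of x "t / 2"] x t by simp
  then have "t / 2 * m x t \<le> t / 2 * (D * m x (t / 2))" using t by (intro mult_left_mono) auto
  also have "\<dots> \<le> D * (\<integral>z. bump x t z \<partial>\<mu>)"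
    using mult_left_mono[OF integral_bump_ge[OF t, of x], of D] D0 by (simp add: mult_ac)
  also have "\<dots> \<le> D * (b * t * m x t + c * (\<integral>u. bump x t (q + f u) \<partial>lam))"
    using ap D0 by (intro mult_left_mono) auto
  also have "\<dots> \<le> D * (b * t * m x t + c * (t * (2 * t) ^ d))"
    using lo c0 D0 by (intro mult_left_mono add_left_mono) auto
  \<comment> \<open>Absorption of the error: it costs an eighth of \<open>t * m x t\<close> against
    the half on the left, and 3/8 remain.\<close>
  also have "\<dots> \<le> t * m x t / 8 + D * (c * (t * (2 * t) ^ d))"
    using bD by (simp add: algebra_simps)
  finally have "t * (3 / 8 * m x t) \<le> t * (D * c * (2 * t) ^ d)"
    by (simp add: algebra_simps)
  then have "3 / 8 * m x t \<le> D * c * (2 * t) ^ d" using t by simp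
  moreover have "0 \<le> D * c * (2 * t) ^ d" using D0 c0 t by simp
  ultimately show "m x t \<le> \<kappa> * (c * t ^ d)"
    by (simp add: \<kappa>_def power_mult_distrib mult_ac)
  have "b \<le> 1"
  proof (rule ccontr)
    assume "\<not> b \<le> 1"
    then have "1 * 4 \<le> b * (4 * D)" using D1 by (intro mult_mono) auto
    then show False using b4 by simp
  qed
  then have "b * t * m x t \<le> t * m x t"
    using mult_right_mono[of b 1 "t * m x t"] t mp by (simp add: mult_ac)
  then have "c * (\<integral>u. bump x t (q + f u) \<partial>lam) \<le> 2 * t * m x t"
    using ap integral_bump_le[OF t, of x] by simp
  then have "c * (t / 2 * (t / 4) ^ d) \<le> 2 * t * m x t"
    using mult_left_mono[OF hi c0] by linarith
  then have "t * (c * (t / 4) ^ d) \<le> t * (4 * m x t)" by (simp add: mult_ac)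
  then have "c * (t / 4) ^ d \<le> 4 * m x t" using t by simp
  then show "c * t ^ d \<le> 4 ^ (d + 1) * m x t" by (simp add: power_divide field_simps)
qed

section \<open>Two approximations on the same ball\<close>

lemma approx_planes_close:
  assumes a: "approx c p f x t e" and a': "approx c' p' f' x t e"
    and w: "w \<in> W" and \<rho>: "0 < \<rho>" and sub: "ball (p + f w) (2 * \<rho>) \<subseteq> ball x t"
  shows "c * (min (infdist (p + f w) ((\<lambda>u. p' + f' u) ` W)) \<rho> * \<rho> ^ d) \<le> 4 * e"
proof -
  define q where "q = p + f w"
  define V' where "V' = (\<lambda>u. p' + f' u) ` W"
  define D0 where "D0 = infdist q V'"
  note f = approx_rigid[OF a] and f' = approx_rigid[OF a']
  have aq: "approx c q f x t e" unfolding q_def by (rule approx_shift[OF a w])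
  have V': "closed V'" "V' \<noteq> {}"
    unfolding V'_def using rigid_plane_closed[OF f'] W_0 by blast+
  have mid: "(1/2) *\<^sub>R (v1 + v2) \<in> V'" if v: "v1 \<in> V'" "v2 \<in> V'" for v1 v2
  proof -
    obtain u1 u2 where u: "u1 \<in> W" "u2 \<in> W" "v1 = p' + f' u1" "v2 = p' + f' u2"
      using v by (auto simp: V'_def)
    have "(1/2) *\<^sub>R (v1 + v2) = (1/2) *\<^sub>R (p' + p') + f' ((1/2) *\<^sub>R (u1 + u2))"
      using u by (simp add: rigid_scale[OF f'] rigid_add[OF f'] algebra_simps)
    also have "(1/2) *\<^sub>R (p' + p') = p'" by (simp add: scaleR_add_left[symmetric] flip: scaleR_2)
    finally show ?thesis using u W by (auto simp: V'_def subspace_add subspace_scale)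
  qed
  have conv: "2 * D0 \<le> infdist (q + v) V' + infdist (q - v) V'" for v
  proof -
    obtain v1 v2 where v: "v1 \<in> V'" "v2 \<in> V'"
      "infdist (q + v) V' = dist (q + v) v1" "infdist (q - v) V' = dist (q - v) v2"
      using infdist_attains_inf[OF V'] by metis
    have "D0 \<le> dist q ((1/2) *\<^sub>R (v1 + v2))"
      unfolding D0_def by (rule infdist_le[OF mid[OF v(1,2)]])
    also have "q - (1/2) *\<^sub>R (v1 + v2) = (1/2) *\<^sub>R ((q + v - v1) + (q - v - v2))"
      by (simp add: algebra_simps flip: scaleR_add_left)
    then have "dist q ((1/2) *\<^sub>R (v1 + v2)) = (1/2) * norm ((q + v - v1) + (q - v - v2))"
      by (simp add: dist_norm)
    also have "\<dots> \<le> (1/2) * (dist (q + v) v1 + dist (q - v) v2)"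
      using norm_triangle_ineq[of "q + v - v1" "q - v - v2"] by (simp add: dist_norm)
    finally show ?thesis using v by simp
  qed
  \<comment> \<open>This function vanishes on the second plane, so the second approximation makes
    its \<mu>-integral at most \<open>e\<close>, and the first then makes its integral over the
    first plane at most \<open>2 * e\<close>. The tent truncates it to a test function and is at
    least \<open>\<rho>\<close> on the ball of radius \<open>\<rho>\<close>.\<close>
  define \<psi> where "\<psi> z = min (infdist z V') (max 0 (2 * \<rho> - dist q z))" for z
  have \<psi>: "test x t \<psi>"
  proof (rule test_mono[OF testI])
    fix y z
    show "\<bar>\<psi> y - \<psi> z\<bar> \<le> dist y z"
      using infdist_triangle_abs[of y V' z] dist_triangle[of q y z] dist_triangle[of q z y] dist_commute[of y z]
      unfolding \<psi>_def min_def max_def by (auto simp: abs_le_iff)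
    show "\<psi> y = 0" if "y \<notin> ball q (2 * \<rho>)"
      using that infdist_nonneg[of y V'] by (simp add: \<psi>_def)
  qed (use sub in \<open>simp add: q_def\<close>)
  have \<psi>0: "0 \<le> \<psi> z" for z using infdist_nonneg[of z V'] by (simp add: \<psi>_def)
  have "(\<integral>u. \<psi> (p' + f' u) \<partial>lam) = 0"
  proof (rule integral_eq_zero_AE)
    show "AE u in lam. \<psi> (p' + f' u) = 0"
      using AE_lam by eventually_elim (auto simp: \<psi>_def V'_def)
  qed
  then have "(\<integral>z. \<psi> z \<partial>\<mu>) \<le> e" using approxD[OF a' \<psi>] by simp
  then have up: "c * (\<integral>u. \<psi> (q + f u) \<partial>lam) \<le> 2 * e" using approxD[OF aq \<psi>] by simp
  note int = integrable_lam[OF \<psi> f, of q]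
  have refl: "(\<integral>u. \<psi> (q + f (- u)) \<partial>lam) = (\<integral>u. \<psi> (q + f u) \<partial>lam)"
    using test_borel[OF \<psi>] rigid_borel[OF f] by (intro integral_lam_reflect) simp
  have int2: "integrable lam (\<lambda>u. \<psi> (q + f (- u)))"
    using integrable_lam[OF \<psi>, of "\<lambda>u. - f u" q] f
    by (simp add: rigid_def linear_compose_neg linear_neg)
  \<comment> \<open>Opposite points are paired: one of them alone may lie on the second plane, but
    by \<open>conv\<close> their distances to it add up to at least \<open>2 * D0\<close>.
    Reflection then identifies the two integrals.\<close>
  have "min D0 \<rho> * measure lam (ball 0 \<rho>) \<le> (\<integral>u. \<psi> (q + f u) + \<psi> (q + f (- u)) \<partial>lam)"
  proof (rule integral_ge_on)
    show "AE u in lam. min D0 \<rho> * indicator (ball 0 \<rho>) u \<le> \<psi> (q + f u) + \<psi> (q + f (- u))"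
      using AE_lam
    proof eventually_elim
      case (elim u)
      have n: "norm (f u) = norm u" using rigid_norm[OF f elim] .
      show ?case
      proof (cases "norm u < \<rho>")
        case True
        have "\<rho> \<le> max 0 (2 * \<rho> - norm u)" using True by simp
        then have "\<psi> (q + f u) \<ge> min (infdist (q + f u) V') \<rho>"
          "\<psi> (q + f (- u)) \<ge> min (infdist (q - f u) V') \<rho>"
          using n by (auto simp: \<psi>_def dist_norm rigid_neg[OF f])
        then show ?thesis
          using True conv[of "f u"] infdist_nonneg[of "q + f u" V'] infdist_nonneg[of "q - f u" V'] \<rho>
          by (auto simp: min_def split: if_splits)
      qed (use \<psi>0 in \<open>simp add: add_nonneg_nonneg\<close>)
    qed
  qed (use \<rho> int int2 in \<open>auto simp: emeasure_lam_ball\<close>)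
  then have "min D0 \<rho> * \<rho> ^ d \<le> 2 * (\<integral>u. \<psi> (q + f u) \<partial>lam)"
    using \<rho> int int2 refl by (simp add: measure_lam_ball)
  then have "c * (min D0 \<rho> * \<rho> ^ d) \<le> c * (2 * (\<integral>u. \<psi> (q + f u) \<partial>lam))"
    using approx_nonneg[OF a] by (rule mult_left_mono)
  then show ?thesis using up unfolding D0_def V'_def q_def by simp
qed

text \<open>Large enough for the three uses: the displacement of planes in
  \<open>approx_point\<close>, their angle in \<open>approx_angle\<close>, and the change of density
  in \<open>approx_const\<close>, where the factor \<open>16 ^ d\<close> arises.\<close>

definition C0 :: real where "C0 = 64 * 16 ^ d * \<kappa>"

lemma C0_ge: "4 ^ (d + 1) * \<kappa> * 32 \<le> C0" "8192 \<le> C0" "0 < C0"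
proof -
  have "(4::real) ^ 1 \<le> 4 ^ d" using d1 by (intro power_increasing) auto
  then have "4 * 4 ^ d \<le> (4::real) ^ d * 4 ^ d" by (intro mult_right_mono) auto
  also have "\<dots> = 16 ^ d" by (simp flip: power_mult_distrib)
  finally have *: "4 * 4 ^ d \<le> (16::real) ^ d" .
  then have "(4 * 4 ^ d) * (32 * \<kappa>) \<le> 16 ^ d * (32 * \<kappa>)" using \<kappa>_ge by (intro mult_right_mono) auto
  moreover have "0 \<le> 16 ^ d * (32 * \<kappa>)" using \<kappa>_ge by simp
  ultimately show "4 ^ (d + 1) * \<kappa> * 32 \<le> C0" unfolding C0_def by simp
  have "(16::real) ^ 1 \<le> 16 ^ d" using d1 by (intro power_increasing) auto
  then have "64 * 16 * 8 \<le> 64 * 16 ^ d * \<kappa>" using \<kappa>_ge by (intro mult_mono) auto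
  then show "8192 \<le> C0" "0 < C0" unfolding C0_def by auto
qed

text \<open>All smallness requirements on the error \<open>b\<close> of a single scale are subsumed by this one.\<close>

definition small :: "real \<Rightarrow> bool" where
  "small b \<longleftrightarrow> 0 \<le> b \<and> C0 * D ^ 8 * b \<le> 1"

lemma small_nonneg: "small b \<Longrightarrow> 0 \<le> b"
  by (simp add: small_def)

lemma small_D: "small b \<Longrightarrow> 8192 * (D ^ 8 * b) \<le> 1"
proof -
  assume b: "small b"
  have "8192 * (D ^ 8 * b) \<le> C0 * (D ^ 8 * b)"
    using C0_ge(2) b D1 by (intro mult_right_mono) (auto simp: small_def)
  then show ?thesis using b by (simp add: small_def mult_ac)
qed

lemma small_C0: "small b \<Longrightarrow> C0 * b \<le> 1"
proof -
  assume b: "small b"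
  have "C0 * b * 1 \<le> C0 * b * D ^ 8"
    using C0_ge(3) b one_le_power[OF D1, of 8] by (intro mult_left_mono) (auto simp: small_def)
  then show ?thesis using b by (simp add: small_def mult_ac)
qed

lemma small_density: "small b \<Longrightarrow> b * (8 * D ^ 3) < 1"
proof -
  assume b: "small b"
  have "b * D ^ 3 \<le> b * D ^ 8"
    using D1 b by (intro mult_left_mono power_increasing) (auto simp: small_def)
  moreover have "8192 * (b * D ^ 8) \<le> 1" using small_D[OF b] by (simp add: mult_ac)
  ultimately show ?thesis by linarith
qed

lemma approx_pos:
  assumes "x \<in> \<Sigma>" "0 < t" "rapprox b c p f x t" "small b"
  shows "0 < c"
proof -
  have "0 < \<kappa> * (c * t ^ d)"
    using approx_density(1)[OF assms(1-3) small_density[OF assms(4)]] m_pos[OF assms(1,2)] by linarith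
  then show ?thesis using \<kappa>_ge assms(2) by (simp add: zero_less_mult_iff)
qed

lemma approx_point:
  assumes x: "x \<in> \<Sigma>" and t: "0 < t" and b: "small b"
    and a: "rapprox b c p f x t" and a': "rapprox b c' p' f' x t"
    and w: "w \<in> W" and q: "dist x (p + f w) \<le> t / 2"
  shows "\<exists>v\<in>W. dist (p + f w) (p' + f' v) \<le> 4 ^ (d + 1) * \<kappa> * b * t"
proof -
  let ?V = "(\<lambda>u. p' + f' u) ` W"
  let ?D = "infdist (p + f w) ?V"
  note f' = approx_rigid[OF a']
  have sub: "ball (p + f w) (2 * (t / 4)) \<subseteq> ball x t"
  proof
    fix z assume "z \<in> ball (p + f w) (2 * (t / 4))"
    then show "z \<in> ball x t" using q dist_triangle[of x z "p + f w"] by simp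
  qed
  have c: "0 < c" by (rule approx_pos[OF x t a b])
  have t4: "0 < t / 4" using t by simp
  have "c * (min ?D (t / 4) * (t / 4) ^ d) \<le> 4 * (b * t * m x t)"
    by (rule approx_planes_close[OF a a' w t4 sub])
  also have "\<dots> \<le> 4 * (b * t * (\<kappa> * (c * t ^ d)))"
    using approx_density(1)[OF x t a small_density[OF b]] t small_nonneg[OF b] by (intro mult_left_mono) auto
  finally have "(c * (t / 4) ^ d) * min ?D (t / 4) \<le> (c * (t / 4) ^ d) * (4 ^ (d + 1) * \<kappa> * b * t)"
    by (simp add: power_divide mult_ac)
  then have le: "min ?D (t / 4) \<le> 4 ^ (d + 1) * \<kappa> * b * t"
    using c t by (simp add: zero_less_mult_iff)
  have "4 ^ (d + 1) * \<kappa> * b * 32 \<le> C0 * b"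
    using mult_right_mono[OF C0_ge(1) small_nonneg[OF b]] by (simp add: mult_ac)
  \<comment> \<open>Smallness puts the bound below \<open>t / 4\<close>, so the minimum in
    \<open>le\<close> is not the cutoff but the distance itself.\<close>
  then have "4 ^ (d + 1) * \<kappa> * b \<le> 1/32" using small_C0[OF b] by linarith
  then have "4 ^ (d + 1) * \<kappa> * b * t \<le> 1/32 * t" using t by (intro mult_right_mono) auto
  then have "?D \<le> 4 ^ (d + 1) * \<kappa> * b * t" using le t by (simp add: min_def split: if_splits)
  moreover have "closed ?V" by (rule rigid_plane_closed[OF f'])
  then obtain v where "v \<in> ?V" "?D = dist (p + f w) v"
    using infdist_attains_inf[of ?V "p + f w"] W_0 by blast
  ultimately show ?thesis by auto
qed

text \<open>Two points of the first plane that differ by a multiple of \<open>f u\<close> of length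
  \<open>t / 4\<close> have partners on the second plane, and the difference of the partners gives
  \<open>v\<close>. Two displacements divided by \<open>t / 4\<close> produce the factor 8.\<close>

lemma approx_angle:
  assumes x: "x \<in> \<Sigma>" and t: "0 < t" and b: "small b"
    and a: "rapprox b c p f x t" and a': "rapprox b c' p' f' x t"
    and u: "u \<in> W"
  shows "\<exists>v\<in>W. dist (f u) (f' v) \<le> C0 * b * norm u"
proof (cases "u = 0")
  case True
  then show ?thesis
    using approx_rigid[OF a] approx_rigid[OF a'] W_0 by (intro bexI[of _ 0]) (auto simp: rigid_def linear_0)
next
  case False
  note f = approx_rigid[OF a] and f' = approx_rigid[OF a']
  define s where "s = (t / 4) / norm u"
  have s: "0 < s" "s * norm u = t / 4" using t False by (auto simp: s_def)
  obtain w where w: "w \<in> W" "dist x (p + f w) < t / 4"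
    using approx_density(3)[OF x t a small_density[OF b]] by blast
  have su: "s *\<^sub>R u \<in> W" "w + s *\<^sub>R u \<in> W" using u w W by (auto simp: subspace_scale subspace_add)
  have "norm (f (s *\<^sub>R u)) = t / 4" using rigid_norm[OF f su(1)] s by simp
  then have "dist x (p + f (w + s *\<^sub>R u)) \<le> t / 2"
    using w(2) dist_triangle[of x "p + f (w + s *\<^sub>R u)" "p + f w"]
    by (simp add: rigid_add[OF f] dist_norm)
  from approx_point[OF x t b a a' su(2) this] obtain v1 where
    v1: "v1 \<in> W" "dist (p + f (w + s *\<^sub>R u)) (p' + f' v1) \<le> 4 ^ (d + 1) * \<kappa> * b * t" by blast
  have "dist x (p + f w) \<le> t / 2" using w(2) t by simp
  from approx_point[OF x t b a a' w(1) this] obtain v0 where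
    v0: "v0 \<in> W" "dist (p + f w) (p' + f' v0) \<le> 4 ^ (d + 1) * \<kappa> * b * t" by blast
  let ?A = "p + f (w + s *\<^sub>R u) - (p' + f' v1)" and ?B = "p + f w - (p' + f' v0)"
  have "s *\<^sub>R f u - f' (v1 - v0) = ?A - ?B"
    by (simp add: rigid_add[OF f] rigid_scale[OF f] rigid_diff[OF f'])
  then have "norm (s *\<^sub>R f u - f' (v1 - v0)) \<le> norm ?A + norm ?B" by (metis norm_triangle_ineq4)
  also have "\<dots> \<le> 2 * (4 ^ (d + 1) * \<kappa> * b * t)" using v0 v1 by (simp add: dist_norm)
  finally have 1: "norm (s *\<^sub>R f u - f' (v1 - v0)) \<le> 2 * (4 ^ (d + 1) * \<kappa> * b * t)" .
  have "s *\<^sub>R f u - f' (v1 - v0) = s *\<^sub>R (f u - f' ((1 / s) *\<^sub>R (v1 - v0)))"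
    unfolding rigid_scale[OF f'] using s(1) by (simp add: scaleR_diff_right)
  then have "s * norm (f u - f' ((1 / s) *\<^sub>R (v1 - v0))) \<le> 2 * (4 ^ (d + 1) * \<kappa> * b * t)"
    using 1 s(1) by simp
  also have "2 * (4 ^ (d + 1) * \<kappa> * b * t) = s * (4 ^ (d + 1) * \<kappa> * 8 * (b * norm u))"
    using s(2) by (simp add: mult_ac)
  finally have "norm (f u - f' ((1 / s) *\<^sub>R (v1 - v0))) \<le> 4 ^ (d + 1) * \<kappa> * 8 * (b * norm u)"
    using s(1) by simp
  also have "\<dots> \<le> C0 * (b * norm u)"
    using C0_ge(1) small_nonneg[OF b] \<kappa>_ge by (intro mult_right_mono) (auto intro: order_trans[rotated])
  finally show ?thesis
    using v0 v1 W by (intro bexI[of _ "(1 / s) *\<^sub>R (v1 - v0)"])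
      (auto simp: dist_norm mult_ac subspace_scale subspace_diff)
qed

lemma approx_height:
  assumes x: "x \<in> \<Sigma>" and t: "0 < t" and b: "small b"
    and a: "rapprox b c p f x t" and a': "rapprox b c' p' f' x t"
    and p: "dist x p \<le> t / 2"
    and p': "\<And>u. u \<in> W \<Longrightarrow> (dist x (p' + f' u))\<^sup>2 = (dist x p')\<^sup>2 + (norm u)\<^sup>2"
  shows "dist x p' \<le> dist x p + 4 ^ (d + 1) * \<kappa> * b * t"
proof -
  have f0: "f 0 = 0" using approx_rigid[OF a] by (simp add: rigid_def linear_0)
  obtain v where v: "v \<in> W" "dist p (p' + f' v) \<le> 4 ^ (d + 1) * \<kappa> * b * t"
    using approx_point[OF x t b a a' W_0] p f0 by auto
  have "dist x p' \<le> dist x (p' + f' v)"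
    by (rule power2_le_imp_le) (simp_all add: p'[OF v(1)])
  also have "\<dots> \<le> dist x p + dist p (p' + f' v)" by (rule dist_triangle)
  finally show ?thesis using v(2) by simp
qed

text \<open>In normal form the flat integrals \<open>I\<close> and \<open>I'\<close> of the bump at
  \<open>x\<close> depend only on the heights \<open>h\<close> and \<open>h'\<close> of the planes,
  which differ by at most \<open>\<delta>\<close>. Since \<open>c * I\<close> and
  \<open>c' * I'\<close> both approximate the same \<mu>-integral, \<open>c\<close> and
  \<open>c'\<close> are close.\<close>

lemma approx_const:
  assumes x: "x \<in> \<Sigma>" and t: "0 < t" and b: "small b"
    and a: "rapprox b c p f x t" and a': "rapprox b c' p' f' x t"
  shows "c \<le> (1 + C0 * b) * c'"
proof -
  define \<delta> where "\<delta> = 4 ^ (d + 1) * \<kappa> * b * t"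
  note f = approx_rigid[OF a] and f' = approx_rigid[OF a']
  obtain w where w: "w \<in> W" and q: "rapprox b c (p + f w) f x t"
    and py: "\<And>u. u \<in> W \<Longrightarrow> (dist x (p + f w + f u))\<^sup>2 = (dist x (p + f w))\<^sup>2 + (norm u)\<^sup>2"
    using approx_normal[OF a] by metis
  obtain w' where w': "w' \<in> W" and q': "rapprox b c' (p' + f' w') f' x t"
    and py': "\<And>u. u \<in> W \<Longrightarrow> (dist x (p' + f' w' + f' u))\<^sup>2 = (dist x (p' + f' w'))\<^sup>2 + (norm u)\<^sup>2"
    using approx_normal[OF a'] by metis
  define h where "h = dist x (p + f w)"
  define h' where "h' = dist x (p' + f' w')"
  have near: "dist x Q < t / 4"
    if Q: "rapprox b C Q g x t"
      "\<And>u. u \<in> W \<Longrightarrow> (dist x (Q + g u))\<^sup>2 = (dist x Q)\<^sup>2 + (norm u)\<^sup>2" for C Q g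
  proof -
    obtain u where u: "u \<in> W" "dist x (Q + g u) < t / 4"
      using approx_density(3)[OF x t Q(1) small_density[OF b]] by blast
    have "dist x Q \<le> dist x (Q + g u)"
      by (rule power2_le_imp_le) (simp_all add: Q(2)[OF u(1)])
    then show ?thesis using u by simp
  qed
  have h: "h < t / 4" "h' < t / 4"
    unfolding h_def h'_def using py py' by (blast intro: near[OF q] near[OF q'])+
  have "dist x (p + f w) \<le> t / 2" "dist x (p' + f' w') \<le> t / 2"
    using h t by (auto simp: h_def h'_def)
  then have "h' \<le> h + \<delta>" "h \<le> h' + \<delta>"
    unfolding h_def h'_def \<delta>_def using py py'
    by (blast intro: approx_height[OF x t b q q'] approx_height[OF x t b q' q])+
  then have hh: "\<bar>h - h'\<bar> \<le> \<delta>" by simp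
  define I where "I = (\<integral>u. bump x t (p + f w + f u) \<partial>lam)"
  define I' where "I' = (\<integral>u. bump x t (p' + f' w' + f' u) \<partial>lam)"
  have int: "integrable lam (\<lambda>u. bump x t (p + f w + f u))" "integrable lam (\<lambda>u. bump x t (p' + f' w' + f' u))"
    using integrable_lam[OF test_bump f] integrable_lam[OF test_bump f'] by blast+
  have "\<bar>c * I - c' * I'\<bar> \<le> 2 * (b * t * m x t)"
    using approxD[OF q test_bump] approxD[OF q' test_bump] unfolding I_def I'_def by linarith
  then have cI: "c * I \<le> c' * I' + 2 * (b * t * m x t)" by simp
  have I: "t / 2 * (t / 4) ^ d \<le> I"
    unfolding I_def using h(1) by (intro integral_lam_bump_ge[OF f t]) (simp add: h_def)
  have II: "I' - I \<le> \<delta> * t ^ d"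
  proof -
    have "(\<integral>u. bump x t (p' + f' w' + f' u) - bump x t (p + f w + f u) \<partial>lam) \<le> \<delta> * measure lam (ball 0 t)"
    proof (rule integral_le_on)
      show "AE u in lam. bump x t (p' + f' w' + f' u) - bump x t (p + f w + f u) \<le> \<delta> * indicator (ball 0 t) u"
        using AE_lam
      proof eventually_elim
        case (elim u)
        let ?r = "dist x (p + f w + f u)" and ?r' = "dist x (p' + f' w' + f' u)"
        have r: "?r\<^sup>2 = h\<^sup>2 + (norm u)\<^sup>2" "?r'\<^sup>2 = h'\<^sup>2 + (norm u)\<^sup>2"
          using py[OF elim] py'[OF elim] by (auto simp: h_def h'_def)
        have hn: "0 \<le> h" "0 \<le> h'" by (auto simp: h_def h'_def)
        have nr: "norm u \<le> ?r'" by (rule power2_le_imp_le) (simp_all add: r(2))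
        have sq: "?r = sqrt (h\<^sup>2 + (norm u)\<^sup>2)" "?r' = sqrt (h'\<^sup>2 + (norm u)\<^sup>2)"
          by (simp_all flip: r)
        \<comment> \<open>For fixed \<open>u\<close> the distance is 1-Lipschitz in the height: this
          is the reverse triangle inequality for the complex numbers with real parts
          \<open>h\<close> and \<open>h'\<close> and common imaginary part
          \<open>norm u\<close>.\<close>
        have "?r = norm (complex_of_real h + complex_of_real (norm u) * \<i>)"
          "?r' = norm (complex_of_real h' + complex_of_real (norm u) * \<i>)"
          unfolding sq by (simp_all add: cmod_def)
        then have "?r - ?r' \<le> norm (complex_of_real h - complex_of_real h')"
          using norm_triangle_ineq2[of "complex_of_real h + complex_of_real (norm u) * \<i>"
              "complex_of_real h' + complex_of_real (norm u) * \<i>"] by simp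
        then have rr: "?r - ?r' \<le> \<delta>" using hh by (simp flip: of_real_diff)
        have "0 \<le> \<delta>" using hh by simp
        then show ?case
          using rr nr by (auto simp: bump_def indicator_def max_def)
      qed
    qed (use t int in \<open>simp_all add: emeasure_lam_ball\<close>)
    then show ?thesis using t int by (simp add: measure_lam_ball I_def I'_def)
  qed
  have c': "0 \<le> c'" using a' by (rule approx_nonneg)
  have "c * I \<le> c' * I + (c' * (I' - I) + 2 * (b * t * m x t))" using cI by (simp add: algebra_simps)
  \<comment> \<open>The error is measured in units of \<open>c'\<close> through the density bound of
    the second approximation; this makes the final comparison multiplicative.\<close>
  also have "\<dots> \<le> c' * I + (c' * (\<delta> * t ^ d) + 2 * (b * t * (\<kappa> * (c' * t ^ d))))"
    using II c' approx_density(1)[OF x t a' small_density[OF b]] t small_nonneg[OF b]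
    by (intro add_left_mono add_mono mult_left_mono) auto
  also have "\<dots> = c' * I + c' * b * ((4 ^ (d + 1) + 2) * \<kappa> * 2 * 4 ^ d) * (t / 2 * (t / 4) ^ d)"
    unfolding \<delta>_def by (simp add: power_divide algebra_simps)
  also have "\<dots> \<le> c' * I + c' * b * C0 * I"
  proof -
    have "(4 ^ (d + 1) + 2) * \<kappa> * 2 * 4 ^ d \<le> C0"
    proof -
      have "(4::real) ^ (d + 1) + 2 \<le> 8 * 4 ^ d"
        using one_le_power[of "4::real" d] unfolding power_add power_one_right by linarith
      then have "(4 ^ (d + 1) + 2) * (\<kappa> * 2 * 4 ^ d) \<le> 8 * 4 ^ d * (\<kappa> * 2 * 4 ^ d)"
        using \<kappa>_ge by (intro mult_right_mono) auto
      also have "8 * X * (\<kappa> * 2 * X) = 16 * \<kappa> * (X * X)" for X by simp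
      also have "(4::real) ^ d * 4 ^ d = 16 ^ d" by (simp flip: power_mult_distrib)
      also have "16 * \<kappa> * 16 ^ d \<le> C0" using \<kappa>_ge by (simp add: C0_def)
      finally show ?thesis by (simp only: mult.assoc)
    qed
    then have "c' * b * ((4 ^ (d + 1) + 2) * \<kappa> * 2 * 4 ^ d) \<le> c' * b * C0"
      using c' small_nonneg[OF b] by (intro mult_left_mono) simp_all
    then have "c' * b * ((4 ^ (d + 1) + 2) * \<kappa> * 2 * 4 ^ d) * (t / 2 * (t / 4) ^ d) \<le> c' * b * C0 * I"
    proof (rule mult_mono[OF _ I])
      show "0 \<le> c' * b * C0" using c' small_nonneg[OF b] C0_ge(3) by simp
      show "0 \<le> t / 2 * (t / 4) ^ d" using t by simp
    qed
    then show ?thesis by (rule add_left_mono)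
  qed
  also have "\<dots> = ((1 + C0 * b) * c') * I" by algebra
  finally have "c * I \<le> ((1 + C0 * b) * c') * I" .
  moreover have "0 < I"
  proof -
    have "0 < t / 2 * (t / 4) ^ d" using t by simp
    then show ?thesis using I by linarith
  qed
  ultimately show ?thesis by simp
qed

text \<open>Both points lie within \<open>t / 64\<close> of the plane, while their distance is at
  least \<open>t / 4\<close>.\<close>

lemma approx_secant:
  assumes x: "x \<in> \<Sigma>" and y: "y \<in> \<Sigma>" and t: "0 < t" and b: "small b"
    and a: "rapprox b c p f x t" and xy: "t / 4 \<le> dist x y" "dist x y < t / 2"
  shows "\<exists>u\<in>W. norm ((y - x) - f u) \<le> dist x y / 8"
proof -
  note f = approx_rigid[OF a]
  define s where "s = t / 64"
  have *: "\<exists>u\<in>W. dist z (p + f u) < s" if z: "z \<in> \<Sigma>" "dist x z < t / 2" for z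
  proof (rule approx_near[OF a])
    show "0 < s" using t by (simp add: s_def)
    show "ball z s \<subseteq> ball x t"
    proof
      fix v assume "v \<in> ball z s"
      then show "v \<in> ball x t" using z(2) t dist_triangle[of x v z] by (simp add: s_def)
    qed
    \<comment> \<open>Here \<open>s / 2\<close> is \<open>t / 128\<close>, and eight doublings of it
      reach \<open>2 * t\<close>, beyond the required \<open>t / 2 + t\<close>. This is the origin
      of \<open>D ^ 8\<close> in \<open>small\<close>.\<close>
    have "m x t \<le> D ^ 8 * m z (s / 2)"
      using z t by (intro m_comp) (auto simp: s_def dist_commute)
    then have "b * m x t \<le> b * (D ^ 8 * m z (s / 2))"
      using small_nonneg[OF b] by (intro mult_left_mono) auto
    also have "\<dots> = (D ^ 8 * b) * m z (s / 2)" by simp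
    also have "\<dots> \<le> 1/8192 * m z (s / 2)" using small_D[OF b] by (intro mult_right_mono) auto
    finally have "b * m x t \<le> 1/8192 * m z (s / 2)" .
    moreover have "0 < m z (s / 2)" using z(1) t by (intro m_pos) (auto simp: s_def)
    ultimately have "b * m x t < 1/128 * m z (s / 2)" by linarith
    then show "b * t * m x t < s / 2 * m z (s / 2)"
      using t mult_strict_left_mono[of "b * m x t" "1/128 * m z (s / 2)" t] by (simp add: s_def mult_ac)
  qed
  obtain u v where u: "u \<in> W" "dist x (p + f u) < s" and v: "v \<in> W" "dist y (p + f v) < s"
    using *[OF x] *[OF y] xy t by auto
  have "(y - x) - f (v - u) = (y - (p + f v)) - (x - (p + f u))"
    by (simp add: rigid_diff[OF f])
  then have "norm ((y - x) - f (v - u)) \<le> norm (y - (p + f v)) + norm (x - (p + f u))"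
    by (metis norm_triangle_ineq4)
  also have "\<dots> \<le> 2 * s" using u v by (simp add: dist_norm)
  also have "\<dots> \<le> dist x y / 8" using xy by (simp add: s_def)
  finally show ?thesis using u v W by (intro bexI[of _ "v - u"]) (auto simp: subspace_diff)
qed

section \<open>Chains of approximations\<close>

lemma exp_eighth: "exp (1/8) \<le> (8/7 :: real)"
proof -
  have "7/8 \<le> exp (- (1/8) :: real)" using exp_ge_add_one_self[of "- (1/8) :: real"] by simp
  then have "inverse (exp (- (1/8) :: real)) \<le> inverse (7/8)" by (rule le_imp_inverse_le) simp
  then show ?thesis by (simp add: exp_minus)
qed

context
  fixes x R n and c :: "nat \<Rightarrow> real" and p f b
  assumes x: "x \<in> \<Sigma>" and R: "0 < R"
    and A: "\<And>k. k \<le> n \<Longrightarrow> rapprox (b k) (c k) (p k) (f k) x (R / 2 ^ k)"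
    and B: "\<And>k. k < n \<Longrightarrow> rapprox (b k) (c (Suc k)) (p (Suc k)) (f (Suc k)) x (R / 2 ^ k)"
    and b0: "\<And>k. 0 \<le> b k"
    and S: "C0 * D ^ 8 * (\<Sum>k\<le>n. b k) \<le> 1/8"
begin

lemma chain_small: "k \<le> n \<Longrightarrow> small (b k)"
proof -
  assume k: "k \<le> n"
  have "b k \<le> (\<Sum>k\<le>n. b k)" using k b0 by (intro member_le_sum) auto
  then have "C0 * D ^ 8 * b k \<le> C0 * D ^ 8 * (\<Sum>k\<le>n. b k)"
    using C0_ge(3) D1 by (intro mult_left_mono) auto
  then show ?thesis using S b0 by (simp add: small_def)
qed

lemma chain_exp: "k \<le> n \<Longrightarrow> exp (C0 * (\<Sum>j<k. b j)) \<le> 8/7"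
proof -
  assume k: "k \<le> n"
  have "(\<Sum>j<k. b j) \<le> (\<Sum>j\<le>n. b j)" using k b0 by (intro sum_mono2) auto
  then have "C0 * (\<Sum>j<k. b j) \<le> C0 * (\<Sum>j\<le>n. b j) * 1"
    using C0_ge(3) by (simp add: mult_left_mono)
  also have "\<dots> \<le> C0 * (\<Sum>j\<le>n. b j) * D ^ 8"
    using C0_ge(3) b0 D1 by (intro mult_left_mono) (auto intro!: sum_nonneg mult_nonneg_nonneg)
  also have "\<dots> \<le> 1/8" using S by (simp add: mult_ac)
  finally have "exp (C0 * (\<Sum>j<k. b j)) \<le> exp (1/8)" by simp
  then show ?thesis using exp_eighth by linarith
qed

text \<open>Assumptions \<open>A\<close> and \<open>B\<close> make the approximations number
  \<open>k\<close> and \<open>Suc k\<close> live on the same ball of radius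
  \<open>R / 2 ^ k\<close>, so \<open>approx_const\<close> compares their densities in both
  directions. The factors \<open>1 + C0 * b k\<close> are multiplied through the
  exponential.\<close>

lemma chain_c_le: "k \<le> n \<Longrightarrow> c k \<le> exp (C0 * (\<Sum>j<k. b j)) * c 0 \<and> c 0 \<le> exp (C0 * (\<Sum>j<k. b j)) * c k"
proof (induction k)
  case (Suc k)
  then have k: "k < n" "k \<le> n" by auto
  have t: "0 < R / 2 ^ k" using R by simp
  note step = approx_const[OF x t chain_small[OF k(2)] A[OF k(2)] B[OF k(1)]]
    approx_const[OF x t chain_small[OF k(2)] B[OF k(1)] A[OF k(2)]]
  have nn: "0 \<le> c k" "0 \<le> c (Suc k)" using approx_nonneg[OF A[OF k(2)]] approx_nonneg[OF B[OF k(1)]] .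
  have e: "1 + C0 * b k \<le> exp (C0 * b k)" by (rule exp_ge_add_one_self)
  have 1: "c (Suc k) \<le> exp (C0 * b k) * c k" "c k \<le> exp (C0 * b k) * c (Suc k)"
    using step mult_right_mono[OF e nn(1)] mult_right_mono[OF e nn(2)] by linarith+
  have ih: "c k \<le> exp (C0 * (\<Sum>j<k. b j)) * c 0" "c 0 \<le> exp (C0 * (\<Sum>j<k. b j)) * c k"
    using Suc by auto
  have "c (Suc k) \<le> exp (C0 * b k) * (exp (C0 * (\<Sum>j<k. b j)) * c 0)"
    using 1(1) mult_left_mono[OF ih(1), of "exp (C0 * b k)"] by (simp only: order_trans exp_ge_zero)
  moreover have "c 0 \<le> exp (C0 * (\<Sum>j<k. b j)) * (exp (C0 * b k) * c (Suc k))"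
    using ih(2) mult_left_mono[OF 1(2), of "exp (C0 * (\<Sum>j<k. b j))"] by (simp only: order_trans exp_ge_zero)
  ultimately show ?case by (simp add: distrib_left exp_add mult_ac)
qed simp

lemma chain_c: "k \<le> n \<Longrightarrow> c k \<le> 2 * c 0" "k \<le> n \<Longrightarrow> c 0 \<le> 2 * c k"
proof -
  assume k: "k \<le> n"
  have "exp (C0 * (\<Sum>j<k. b j)) \<le> 2" using chain_exp[OF k] by simp
  moreover have "0 \<le> c k" "0 \<le> c 0" using approx_nonneg[OF A[OF k]] approx_nonneg[OF A[of 0]] by auto
  ultimately have "exp (C0 * (\<Sum>j<k. b j)) * c 0 \<le> 2 * c 0" "exp (C0 * (\<Sum>j<k. b j)) * c k \<le> 2 * c k"
    by (intro mult_right_mono; simp)+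
  then show "c k \<le> 2 * c 0" "c 0 \<le> 2 * c k" using chain_c_le[OF k] by linarith+
qed

text \<open>Only the ranges of the maps \<open>f k\<close> can be compared, as the parametrizations
  are arbitrary; hence \<open>v\<close> depends on \<open>u\<close> and \<open>k\<close>. The form
  \<open>exp (...) - 1\<close> is stable under composition: a tilt \<open>q\<close> followed by a
  tilt \<open>E - 1\<close> gives at most \<open>E * (1 + q) - 1\<close>.\<close>

lemma chain_angle_exp:
  "k \<le> n \<Longrightarrow> u \<in> W \<Longrightarrow> \<exists>v\<in>W. dist (f k u) (f 0 v) \<le> (exp (C0 * (\<Sum>j<k. b j)) - 1) * norm u"
proof (induction k arbitrary: u)
  case 0
  then show ?case by (intro bexI[of _ u]) auto
next
  case (Suc k)
  then have k: "k < n" "k \<le> n" by auto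
  have t: "0 < R / 2 ^ k" using R by simp
  obtain v where v: "v \<in> W" "dist (f (Suc k) u) (f k v) \<le> C0 * b k * norm u"
    using approx_angle[OF x t chain_small[OF k(2)] B[OF k(1)] A[OF k(2)] Suc.prems(2)] by blast
  obtain w where w: "w \<in> W" "dist (f k v) (f 0 w) \<le> (exp (C0 * (\<Sum>j<k. b j)) - 1) * norm v"
    using Suc.IH[OF k(2) v(1)] by blast
  define E where "E = exp (C0 * (\<Sum>j<k. b j))"
  define q where "q = C0 * b k"
  have q: "0 \<le> q" "1 + q \<le> exp q" using C0_ge(3) b0 by (auto simp: q_def)
  have E: "1 \<le> E" unfolding E_def using C0_ge(3) b0 by (auto intro!: mult_nonneg_nonneg sum_nonneg)
  have "norm v = norm (f k v)" using rigid_norm[OF approx_rigid[OF A[OF k(2)]] v(1)] by simp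
  also have "\<dots> \<le> norm (f (Suc k) u) + dist (f (Suc k) u) (f k v)"
    unfolding dist_norm by norm
  also have "\<dots> \<le> (1 + q) * norm u"
    using v(2) rigid_norm[OF approx_rigid[OF B[OF k(1)]] Suc.prems(2)] by (simp add: q_def algebra_simps)
  finally have nv: "(E - 1) * norm v \<le> (E - 1) * ((1 + q) * norm u)"
    using E by (intro mult_left_mono) auto
  have "dist (f (Suc k) u) (f 0 w) \<le> dist (f (Suc k) u) (f k v) + dist (f k v) (f 0 w)"
    by (rule dist_triangle)
  also have "\<dots> \<le> q * norm u + (E - 1) * ((1 + q) * norm u)"
    using v(2) w(2) nv unfolding q_def E_def by linarith
  also have "\<dots> = (E * (1 + q) - 1) * norm u" by algebra
  also have "\<dots> \<le> (E * exp q - 1) * norm u"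
    using q E by (intro mult_right_mono diff_right_mono mult_left_mono) auto
  finally show ?case using w(1) unfolding E_def q_def
    by (intro bexI[of _ w]) (simp_all add: distrib_left exp_add)
qed

lemma chain_density:
  assumes k: "k \<le> n"
  shows "m x (R / 2 ^ k) \<le> 2 * \<kappa> * (c 0 * (R / 2 ^ k) ^ d)"
    "c 0 * (R / 2 ^ k) ^ d \<le> 2 * 4 ^ (d + 1) * m x (R / 2 ^ k)"
proof -
  define t where "t = R / 2 ^ k"
  have t: "0 < t" using R by (simp add: t_def)
  note den = approx_density(1,2)[OF x t A[OF k, folded t_def] small_density[OF chain_small[OF k]]]
  have td: "0 \<le> t ^ d" using t by simp
  have "\<kappa> * (c k * t ^ d) \<le> \<kappa> * ((2 * c 0) * t ^ d)"
    using chain_c(1)[OF k] \<kappa>_ge by (intro mult_left_mono mult_right_mono td) auto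
  then show "m x (R / 2 ^ k) \<le> 2 * \<kappa> * (c 0 * (R / 2 ^ k) ^ d)"
    using den(1) unfolding t_def by (simp add: mult_ac)
  have "c 0 * t ^ d \<le> (2 * c k) * t ^ d" by (rule mult_right_mono[OF chain_c(2)[OF k] td])
  then show "c 0 * (R / 2 ^ k) ^ d \<le> 2 * 4 ^ (d + 1) * m x (R / 2 ^ k)"
    using den(2) unfolding t_def by linarith
qed

text \<open>The secant deviates from the plane of its own scale by at most 1/8 of its length, and
  that plane from the initial one by at most 1/7; together this is at most 1/8 + 9/8 * 1/7 = 2/7 of
  the length.\<close>

lemma chain_cone:
  assumes k: "k \<le> n" and y: "y \<in> \<Sigma>" and xy: "R / 2 ^ k / 4 \<le> dist x y" "dist x y < R / 2 ^ k / 2"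
  shows "\<exists>v\<in>W. norm ((y - x) - f 0 v) \<le> dist x y / 2"
proof -
  have t: "0 < R / 2 ^ k" using R by simp
  note a = A[OF k]
  obtain u where u: "u \<in> W" "norm ((y - x) - f k u) \<le> dist x y / 8"
    using approx_secant[OF x y t chain_small[OF k] a xy] by blast
  obtain v where v: "v \<in> W" "dist (f k u) (f 0 v) \<le> (exp (C0 * (\<Sum>j<k. b j)) - 1) * norm u"
    using chain_angle_exp[OF k u(1)] by blast
  have "(exp (C0 * (\<Sum>j<k. b j)) - 1) * norm u \<le> (1/7) * norm u"
    using chain_exp[OF k] by (intro mult_right_mono) auto
  moreover have "norm u \<le> norm (y - x) + norm ((y - x) - f k u)"
    using rigid_norm[OF approx_rigid[OF a] u(1)] norm_triangle_ineq4[of "y - x" "(y - x) - f k u"] by simp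
  moreover have "norm (y - x) = dist x y" by (simp add: dist_norm norm_minus_commute)
  moreover have "norm ((y - x) - f 0 v) \<le> norm ((y - x) - f k u) + dist (f k u) (f 0 v)"
    unfolding dist_norm by norm
  ultimately have "norm ((y - x) - f 0 v) \<le> dist x y / 2" using u(2) v(2) zero_le_dist[of x y] by linarith
  then show ?thesis using v(1) by blast
qed

end

section \<open>Flatness of the measure in a ball, and the chains it controls\<close>

definition flatness :: "'a \<Rightarrow> real \<Rightarrow> real" where
  "flatness x t = Inf {e. \<exists>c p f. approx c p f x t e} / (t * m x t)"

lemma approx_error_nonneg: "approx c p f x t e \<Longrightarrow> 0 \<le> e"
proof -
  assume a: "approx c p f x t e"
  have "test x t (\<lambda>_. 0)" by (rule testI) simp_all
  from approxD[OF a this] show ?thesis by simp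
qed

text \<open>Keeps the real infimum in \<open>flatness\<close> from being taken over the empty set:
  the zero measure always approximates, with an error from the sup bound on test functions.\<close>

lemma approx_exists: "\<exists>c p f e. approx c p f x t e"
proof -
  have "approx 0 0 id x t (2 * \<bar>t\<bar> * m x t)"
    unfolding approx_def
  proof (intro conjI allI impI)
    show "rigid id" by (simp add: rigid_def linear_id)
    fix \<psi> assume \<psi>: "test x t \<psi>"
    have bd: "\<psi> y \<le> 2 * \<bar>t\<bar> * indicator (ball x t) y" "- \<psi> y \<le> 2 * \<bar>t\<bar> * indicator (ball x t) y" for y
      using test_bound[OF \<psi>, of y] test_outside[OF \<psi>, of y] by (auto simp: indicator_def)
    have "(\<integral>y. \<psi> y \<partial>\<mu>) \<le> 2 * \<bar>t\<bar> * m x t" "(\<integral>y. - \<psi> y \<partial>\<mu>) \<le> 2 * \<bar>t\<bar> * m x t"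
      using bd integrable_mu[OF \<psi>] by (intro integral_le_on AE_I2; simp add: finite_ball)+
    then show "\<bar>(\<integral>y. \<psi> y \<partial>\<mu>) - 0 * (\<integral>u. \<psi> (0 + id u) \<partial>lam)\<bar> \<le> 2 * \<bar>t\<bar> * m x t" by simp
  qed simp
  then show ?thesis by blast
qed

lemma flatness_nonneg: "0 < t \<Longrightarrow> 0 \<le> flatness x t"
proof -
  assume t: "0 < t"
  have "0 \<le> Inf {e. \<exists>c p f. approx c p f x t e}"
    using approx_exists[of x t] approx_error_nonneg by (intro cInf_greatest) blast+
  then show ?thesis using t by (simp add: flatness_def)
qed

lemma flatness_le:
  assumes "x \<in> \<Sigma>" "0 < t" "approx c p f x t e"
  shows "flatness x t * (t * m x t) \<le> e"
proof -
  have "Inf {e. \<exists>c p f. approx c p f x t e} \<le> e"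
    using assms(3) approx_error_nonneg by (intro cInf_lower bdd_belowI[of _ 0]) auto
  then show ?thesis using m_pos[OF assms(1,2)] assms(2) by (simp add: flatness_def)
qed

lemma flatness_approx:
  assumes "x \<in> \<Sigma>" "0 < t" "flatness x t < a"
  shows "\<exists>c p f. rapprox a c p f x t"
proof -
  have "Inf {e. \<exists>c p f. approx c p f x t e} < a * t * m x t"
    using assms m_pos[OF assms(1,2)] by (simp add: flatness_def divide_less_eq mult_ac)
  then obtain e c p f where "approx c p f x t e" "e < a * t * m x t"
    using cInf_lessD[of "{e. \<exists>c p f. approx c p f x t e}"] approx_exists[of x t] by blast
  then show ?thesis using approx_mono[of c p f x t e x t] by (meson less_imp_le order_refl)
qed

context
  fixes x R n cs ps fs bs \<epsilon>
  assumes x: "x \<in> \<Sigma>" and R: "0 < R"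
    and start: "rapprox bs cs ps fs x R" and bs: "0 \<le> bs" and \<epsilon>: "0 < \<epsilon>"
    and sum: "(\<Sum>k<n. flatness x (R / 2 ^ k)) \<le> \<epsilon>"
    and S: "C0 * D ^ 8 * (bs + 6 * D * \<epsilon>) \<le> 1/8"
begin

text \<open>The chain begins with the prescribed approximation instead of a best one, so that
  \<open>cs\<close> and \<open>fs\<close> can be shared by all points of a ball.\<close>

lemma chain_of_flatness:
  obtains c p f b where "c 0 = cs" "f 0 = fs"
    "\<And>k. k \<le> n \<Longrightarrow> rapprox (b k) (c k) (p k) (f k) x (R / 2 ^ k)"
    "\<And>k. k < n \<Longrightarrow> rapprox (b k) (c (Suc k)) (p (Suc k)) (f (Suc k)) x (R / 2 ^ k)"
    "\<And>k. 0 \<le> b k" "C0 * D ^ 8 * (\<Sum>k\<le>n. b k) \<le> 1/8"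
proof -
  \<comment> \<open>The infimum in \<open>flatness\<close> need not be attained; the geometric slack
    adds at most \<open>\<epsilon>\<close> over all scales.\<close>
  define a where "a k = flatness x (R / 2 ^ k) + \<epsilon> * (1/2) ^ Suc k" for k
  have t: "0 < R / 2 ^ k" for k :: nat using R by simp
  have a0: "0 \<le> a k" for k using flatness_nonneg[OF t] \<epsilon> by (simp add: a_def)
  have "\<exists>C P G. rapprox (a k) C P G x (R / 2 ^ k)" for k
    using \<epsilon> by (intro flatness_approx[OF x t]) (simp add: a_def)
  then obtain C P G where CPG: "\<And>k. rapprox (a k) (C k) (P k) (G k) x (R / 2 ^ k)"
    by metis
  define c where "c k = (case k of 0 \<Rightarrow> cs | Suc j \<Rightarrow> C j)" for k
  define p where "p k = (case k of 0 \<Rightarrow> ps | Suc j \<Rightarrow> P j)" for k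
  define f where "f k = (case k of 0 \<Rightarrow> fs | Suc j \<Rightarrow> G j)" for k
  \<comment> \<open>The entry number \<open>Suc j\<close> is a nearly best approximation at scale
    \<open>j\<close>. Used at the next smaller scale, its relative error grows by 2 for the radius
    and by \<open>D\<close> for the mass, which is \<open>b1\<close>; its error at scale
    \<open>j\<close> itself is \<open>b2\<close>. The last scale has no successor, hence the zero in
    \<open>b2\<close>.\<close>
  define b1 where "b1 k = (case k of 0 \<Rightarrow> bs | Suc j \<Rightarrow> 2 * D * a j)" for k
  define b2 where "b2 k = (if k < n then a k else 0)" for k
  define b where "b k = b1 k + b2 k" for k
  have b12: "0 \<le> b1 k" "0 \<le> b2 k" for k
    using bs D1 a0 by (auto simp: b1_def b2_def split: nat.split)
  have le: "b1 k \<le> b k" "b2 k \<le> b k" for k using b12[of k] by (auto simp: b_def)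
  have scale: "u * (R / 2 ^ k) * m x (R / 2 ^ k) \<le> v * (R / 2 ^ k) * m x (R / 2 ^ k)" if "u \<le> v" for u v k
    using that t[of k] by (intro mult_right_mono) auto
  show thesis
  proof (rule that[of c f p b])
    show "c 0 = cs" "f 0 = fs" by (auto simp: c_def f_def)
    show "0 \<le> b k" for k using b12[of k] by (simp add: b_def)
    show "rapprox (b k) (c k) (p k) (f k) x (R / 2 ^ k)" for k
    proof (cases k)
      case 0
      have "bs \<le> b 0" using le(1)[of 0] by (simp add: b1_def)
      from approx_mono[OF start order_refl] scale[OF this, of 0]
      show ?thesis using 0 by (simp add: c_def p_def f_def)
    next
      case (Suc j)
      have "m x (R / 2 ^ j) \<le> D * m x (R / 2 ^ k)"
        using m_double[OF x t[of k]] Suc by simp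
      then have "a j * (R / 2 ^ j) * m x (R / 2 ^ j) \<le> a j * (R / 2 ^ j) * (D * m x (R / 2 ^ k))"
        by (rule mult_left_mono[OF _ mult_nonneg_nonneg[OF a0 less_imp_le[OF t]]])
      also have "\<dots> = b1 k * (R / 2 ^ k) * m x (R / 2 ^ k)" using Suc by (simp add: b1_def)
      also have "\<dots> \<le> b k * (R / 2 ^ k) * m x (R / 2 ^ k)" by (rule scale[OF le(1)])
      finally have e: "a j * (R / 2 ^ j) * m x (R / 2 ^ j) \<le> b k * (R / 2 ^ k) * m x (R / 2 ^ k)" .
      have "ball x (R / 2 ^ k) \<subseteq> ball x (R / 2 ^ j)"
        using Suc R by (intro subset_ball) (simp add: field_simps)
      then show ?thesis
        using approx_mono[OF CPG[of j] _ e] Suc by (simp add: c_def p_def f_def)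
    qed
    show "rapprox (b k) (c (Suc k)) (p (Suc k)) (f (Suc k)) x (R / 2 ^ k)"
      if k: "k < n" for k
    proof -
      have "a k \<le> b k" using le(2)[of k] k by (simp add: b2_def)
      then show ?thesis
        using approx_mono[OF CPG[of k] order_refl scale] by (simp add: c_def p_def f_def)
    qed
    have "(\<Sum>k<n. (1/2::real) ^ Suc k) \<le> 1"
      using sum_le_suminf[OF sums_summable[OF power_half_series], of "{..<n}"]
        sums_unique[OF power_half_series] by simp
    then have "\<epsilon> * (\<Sum>k<n. (1/2) ^ Suc k) \<le> \<epsilon> * 1" using \<epsilon> by (intro mult_left_mono) auto
    then have sa: "(\<Sum>k<n. a k) \<le> 2 * \<epsilon>"
      using sum by (simp add: a_def sum.distrib sum_distrib_left)
    have "(\<Sum>k\<le>n. b k) = (\<Sum>k\<le>n. b1 k) + (\<Sum>k\<le>n. b2 k)" by (simp add: b_def sum.distrib)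
    also have "(\<Sum>k\<le>n. b1 k) = bs + 2 * D * (\<Sum>k<n. a k)"
      unfolding lessThan_Suc_atMost[symmetric] sum.lessThan_Suc_shift by (simp add: b1_def sum_distrib_left)
    also have "(\<Sum>k\<le>n. b2 k) = (\<Sum>k<n. a k)"
      unfolding lessThan_Suc_atMost[symmetric] by (simp add: b2_def)
    also have "bs + 2 * D * (\<Sum>k<n. a k) + (\<Sum>k<n. a k) \<le> bs + 6 * D * \<epsilon>"
    proof -
      have "1 * (\<Sum>k<n. a k) \<le> D * (\<Sum>k<n. a k)" using D1 a0 by (intro mult_right_mono sum_nonneg) auto
      moreover have "3 * D * (\<Sum>k<n. a k) \<le> 3 * D * (2 * \<epsilon>)" using sa D1 by (intro mult_left_mono) auto
      ultimately show ?thesis by linarith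
    qed
    finally have "C0 * D ^ 8 * (\<Sum>k\<le>n. b k) \<le> C0 * D ^ 8 * (bs + 6 * D * \<epsilon>)"
      using C0_ge(3) D1 by (intro mult_left_mono) auto
    then show "C0 * D ^ 8 * (\<Sum>k\<le>n. b k) \<le> 1/8" using S by simp
  qed
qed

lemma flatness_density_cone:
  shows flatness_density:
      "k \<le> n \<Longrightarrow> m x (R / 2 ^ k) \<le> 2 * \<kappa> * (cs * (R / 2 ^ k) ^ d)"
      "k \<le> n \<Longrightarrow> cs * (R / 2 ^ k) ^ d \<le> 2 * 4 ^ (d + 1) * m x (R / 2 ^ k)"
    and flatness_cone: "k \<le> n \<Longrightarrow> y \<in> \<Sigma> \<Longrightarrow> R / 2 ^ k / 4 \<le> dist x y \<Longrightarrow> dist x y < R / 2 ^ k / 2 \<Longrightarrow>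
      \<exists>v\<in>W. norm ((y - x) - fs v) \<le> dist x y / 2"
proof -
  obtain c p f b where ch: "c 0 = cs" "f 0 = fs"
    "\<And>k. k \<le> n \<Longrightarrow> rapprox (b k) (c k) (p k) (f k) x (R / 2 ^ k)"
    "\<And>k. k < n \<Longrightarrow> rapprox (b k) (c (Suc k)) (p (Suc k)) (f (Suc k)) x (R / 2 ^ k)"
    "\<And>k. 0 \<le> b k" "C0 * D ^ 8 * (\<Sum>k\<le>n. b k) \<le> 1/8"
    by (rule chain_of_flatness) blast
  show "k \<le> n \<Longrightarrow> m x (R / 2 ^ k) \<le> 2 * \<kappa> * (cs * (R / 2 ^ k) ^ d)"
    "k \<le> n \<Longrightarrow> cs * (R / 2 ^ k) ^ d \<le> 2 * 4 ^ (d + 1) * m x (R / 2 ^ k)"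
    using chain_density[of x R n c p f b k, OF x R ch(3-6)] unfolding ch(1) by blast+
  show "k \<le> n \<Longrightarrow> y \<in> \<Sigma> \<Longrightarrow> R / 2 ^ k / 4 \<le> dist x y \<Longrightarrow> dist x y < R / 2 ^ k / 2 \<Longrightarrow>
      \<exists>v\<in>W. norm ((y - x) - fs v) \<le> dist x y / 2"
    using chain_cone[of x R n c p f b k y, OF x R ch(3-6)] unfolding ch(2) .
qed

end

section \<open>From \<open>\<alpha>\<close>-numbers to approximations\<close>

text \<open>A plane meeting B(0,1/2) contains a flat ball of radius 1/2 inside the unit ball. Hence
  the normalizing factor in \<open>flat_measure\<close> is finite.\<close>

lemma plane_ball_pos:
  fixes V :: "'a set"
  assumes "V \<in> planes d"
  shows "0 < emeasure (hausdorff_measure d) (V \<inter> ball 0 1)"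
proof -
  have V: "affine V" "aff_dim V = int d" "V \<inter> ball 0 (1/2) \<noteq> {}" using assms by (auto simp: planes_def)
  obtain p f where pf: "rigid f" "V = (\<lambda>u. p + f u) ` W"
    by (rule plane_param[OF V(1,2)])
  obtain v where v: "v \<in> W" "p + f v \<in> ball 0 (1/2)" using V(3) pf(2) by auto
  have Vb: "V \<inter> ball 0 1 \<in> sets borel" using rigid_plane_borel[OF pf(1)] pf(2) by auto
  have "ennreal ((1/2) ^ d) = hausdorff d (W \<inter> ball 0 (1/2))"
    using emeasure_lam_ball[of "1/2"] emeasure_lam[of "ball 0 (1/2)"] by simp
  also have "\<dots> = hausdorff d ((\<lambda>u. p + f v + f u) ` (W \<inter> ball 0 (1/2)))"
    using hausdorff_similarity_image[of 1 "W \<inter> ball 0 (1/2)" "\<lambda>u. p + f v + f u" d] rigid_dist[OF pf(1)] by simp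
  also have "\<dots> \<le> hausdorff d (V \<inter> ball 0 1)"
  proof -
    have "(\<lambda>u. p + f v + f u) ` (W \<inter> ball 0 (1/2)) \<subseteq> V \<inter> ball 0 1"
    proof clarify
      fix u assume u: "u \<in> W" "u \<in> ball 0 (1/2)"
      have "norm (p + f v + f u) < 1"
        using norm_triangle_ineq[of "p + f v" "f u"] v(2) u rigid_norm[OF pf(1) u(1)] by simp
      moreover have "p + f v + f u = p + f (v + u)" by (simp add: rigid_add[OF pf(1)] add.assoc)
      moreover have "p + f (v + u) \<in> V" using u(1) v(1) W pf(2) by (simp add: subspace_add)
      ultimately show "p + f v + f u \<in> V \<inter> ball 0 1" by (metis IntI mem_ball_0)
    qed
    then show ?thesis
      unfolding hausdorff_def by (intro divide_right_mono_ennreal hausdorff_raw_mono)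
  qed
  also have "\<dots> = emeasure (hausdorff_measure d) (V \<inter> ball 0 1)"
    using Vb by (simp add: emeasure_hausdorff_measure[OF d1])
  finally show ?thesis by (rule order_less_le_trans[rotated]) simp
qed

lemma integral_rescaled:
  assumes t: "0 < t" and y: "0 < m y t" and g: "g \<in> borel_measurable borel"
  shows "(\<integral>z. g z \<partial>rescaled \<mu> y t) = (\<integral>z. g ((z - y) /\<^sub>R t) \<partial>\<mu>) / m y t"
proof -
  have "inverse (emeasure \<mu> (ball y t)) = ennreal (inverse (m y t))"
    using y by (simp add: emeasure_ball inverse_ennreal)
  moreover have T: "(\<lambda>z. (z - y) /\<^sub>R t) \<in> borel_measurable \<mu>" by measurable
  moreover have "(\<integral>z. g z \<partial>distr \<mu> borel (\<lambda>z. (z - y) /\<^sub>R t)) = (\<integral>z. g ((z - y) /\<^sub>R t) \<partial>\<mu>)"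
    by (rule integral_distr[OF T g])
  moreover have "(\<integral>z. g z \<partial>scale_measure (ennreal (inverse (m y t))) (distr \<mu> borel (\<lambda>z. (z - y) /\<^sub>R t)))
      = inverse (m y t) * (\<integral>z. g z \<partial>distr \<mu> borel (\<lambda>z. (z - y) /\<^sub>R t))"
    using y g by (intro integral_scale_measure) auto
  ultimately show ?thesis
    unfolding rescaled_def by (simp only: divide_inverse mult.commute)
qed

text \<open>Only positive mass of the ball is required of \<open>y\<close>, not membership in the
  support, because \<alpha> has to be bounded below at every point of an open set.\<close>

lemma alpha_approx:
  assumes t: "0 < t" and y: "0 < m y t" and al: "alpha d \<mu> y t < ennreal a"
  shows "\<exists>c p f. rapprox a c p f y t"
proof -
  obtain V where V: "V \<in> planes d" and W1: "W1 (rescaled \<mu> y t) (flat_measure d V) < ennreal a"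
    using al unfolding alpha_def INF_less_iff by blast
  obtain p f where pf: "rigid f" "V = (\<lambda>u. p + f u) ` W"
    and int: "\<And>g :: 'a \<Rightarrow> real. g \<in> borel_measurable borel \<Longrightarrow>
       (\<integral>x. g x \<partial>restr (hausdorff_measure d) V) = (\<integral>u. g (p + f u) \<partial>lam)"
    by (rule plane_param[of V]) (use V in \<open>auto simp: planes_def\<close>)
  have "inverse (emeasure (hausdorff_measure d) (V \<inter> ball 0 1)) < top"
    using plane_ball_pos[OF V] by (simp add: less_top[symmetric])
  then obtain k where k: "0 \<le> k" "inverse (emeasure (hausdorff_measure d) (V \<inter> ball 0 1)) = ennreal k"
    using less_top_ennreal by blast
  have a0: "0 < a" using W1 by (metis ennreal_neg less_le_not_le not_le not_less_zero)
  show ?thesis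
  proof (intro exI)
    \<comment> \<open>Undoing the dilation moves the base point to \<open>y + t *\<^sub>R p\<close>;
      the density picks up \<open>m y t\<close> from the normalization of the rescaled measure and
      \<open>t ^ d\<close> from the scaling of \<open>lam\<close>.\<close>
    show "rapprox a (k * m y t / t ^ d) (y + t *\<^sub>R p) f y t"
      unfolding approx_def
    proof (intro conjI allI impI)
      fix g assume g: "test y t g"
      define \<psi> where "\<psi> z = g (y + t *\<^sub>R z) / t" for z
      have "test 0 1 \<psi>"
      proof (rule testI)
        fix u v
        have "\<bar>g (y + t *\<^sub>R u) - g (y + t *\<^sub>R v)\<bar> \<le> t * dist u v"
          using test_lip[OF g, of "y + t *\<^sub>R u" "y + t *\<^sub>R v"] t
          by (simp add: dist_norm flip: scaleR_diff_right)
        then show "\<bar>\<psi> u - \<psi> v\<bar> \<le> dist u v"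
          using t by (simp add: \<psi>_def field_simps flip: diff_divide_distrib)
      next
        fix u :: 'a assume "u \<notin> ball 0 1"
        then have "y + t *\<^sub>R u \<notin> ball y t" using t by (simp add: dist_norm)
        then show "\<psi> u = 0" by (simp add: \<psi>_def test_outside[OF g])
      qed
      then have "ennreal \<bar>(\<integral>x. \<psi> x \<partial>rescaled \<mu> y t) - (\<integral>x. \<psi> x \<partial>flat_measure d V)\<bar>
          \<le> W1 (rescaled \<mu> y t) (flat_measure d V)"
        unfolding W1_def by (intro SUP_upper) (auto simp: test_def)
      also have "\<dots> < ennreal a" by (rule W1)
      finally have le: "\<bar>(\<integral>x. \<psi> x \<partial>rescaled \<mu> y t) - (\<integral>x. \<psi> x \<partial>flat_measure d V)\<bar> \<le> a"
        using a0 by (simp add: ennreal_less_iff)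
      have gm: "g \<in> borel_measurable borel" by (rule test_borel[OF g])
      have \<psi>m: "\<psi> \<in> borel_measurable borel" unfolding \<psi>_def using gm by measurable
      have 1: "(\<integral>x. \<psi> x \<partial>rescaled \<mu> y t) = (\<integral>z. g z \<partial>\<mu>) / (t * m y t)"
        unfolding integral_rescaled[OF t y \<psi>m] using t by (simp add: \<psi>_def)
      have "(\<integral>x. \<psi> x \<partial>flat_measure d V) = k * (\<integral>u. \<psi> (p + f u) \<partial>lam)"
        unfolding flat_measure_def k(2) using k(1) \<psi>m by (simp add: integral_scale_measure int)
      also have "(\<integral>u. \<psi> (p + f u) \<partial>lam) = (\<integral>u. g (y + t *\<^sub>R p + f (t *\<^sub>R u)) \<partial>lam) / t"
        by (simp add: \<psi>_def scaleR_add_right rigid_scale[OF pf(1)] add.assoc)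
      also have "(\<integral>u. g (y + t *\<^sub>R p + f (t *\<^sub>R u)) \<partial>lam) = (\<integral>u. g (y + t *\<^sub>R p + f u) \<partial>lam) / t ^ d"
        using integral_lam_scale[OF t, of "\<lambda>u. g (y + t *\<^sub>R p + f u)"] gm rigid_borel[OF pf(1)] t
        by (simp add: field_simps)
      finally have 2: "(\<integral>x. \<psi> x \<partial>flat_measure d V) = k * ((\<integral>u. g (y + t *\<^sub>R p + f u) \<partial>lam) / t ^ d / t)" .
      have pos: "0 < t * m y t" using t y by simp
      have "(\<integral>z. g z \<partial>\<mu>) - k * m y t / t ^ d * (\<integral>u. g (y + t *\<^sub>R p + f u) \<partial>lam)
          = (t * m y t) * ((\<integral>x. \<psi> x \<partial>rescaled \<mu> y t) - (\<integral>x. \<psi> x \<partial>flat_measure d V))"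
        unfolding 1 2 using t y by (simp add: right_diff_distrib)
      also have "\<bar>\<dots>\<bar> \<le> (t * m y t) * a"
        unfolding abs_mult[of "t * m y t"] abs_of_pos[OF pos] using le pos by (intro mult_left_mono) auto
      finally show "\<bar>(\<integral>z. g z \<partial>\<mu>) - k * m y t / t ^ d * (\<integral>u. g (y + t *\<^sub>R p + f u) \<partial>lam)\<bar> \<le> a * t * m y t"
        by (simp add: mult_ac)
    qed (use k t y pf in auto)
  qed
qed

end

section \<open>The Carleson condition\<close>

lemma dyadic_scale:
  fixes s R :: real
  assumes "0 < s" "s < R"
  obtains k where "R / 2 ^ Suc k \<le> s" "s < R / 2 ^ k"
proof -
  obtain n where n: "R / s < 2 ^ n" using real_arch_pow[of 2 "R / s"] by auto
  define j where "j = (LEAST j. R / 2 ^ j \<le> s)"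
  have ex: "R / 2 ^ n \<le> s" using n assms by (simp add: field_simps)
  have j: "R / 2 ^ j \<le> s" unfolding j_def by (rule LeastI[of _ n]) (rule ex)
  then have "j \<noteq> 0" using assms by (intro notI) simp
  then obtain k where k: "j = Suc k" using not0_implies_Suc by blast
  have "\<not> R / 2 ^ k \<le> s" using not_less_Least[of k "\<lambda>j. R / 2 ^ j \<le> s"] k unfolding j_def by simp
  then show thesis using that j k by auto
qed

context doubling_measure
begin

text \<open>An approximation on B(y,s) restricts to B(x,t). Of the loss, 4 is the bound on the ratio
  of the radii, and \<open>D ^ 3\<close> compares the masses, since B(y,s) lies in B(x,8t). Validity
  for every such \<open>y\<close> and \<open>s\<close> replaces any averaging argument.\<close>

lemma flatness_le_alpha:
  assumes x: "x \<in> \<Sigma>" and t: "0 < t" and xy: "dist x y < t" and s: "2 * t \<le> s" "s < 4 * t"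
  shows "ennreal (flatness x t / (4 * D ^ 3)) \<le> alpha d \<mu> y s"
proof (rule ccontr)
  define \<beta> where "\<beta> = flatness x t"
  assume "\<not> ?thesis"
  then have lt: "alpha d \<mu> y s < ennreal (\<beta> / (4 * D ^ 3))" by (simp add: \<beta>_def not_le)
  have D0: "0 < D ^ 3" using D1 by simp
  have \<beta>: "0 < \<beta>"
  proof (rule ccontr)
    assume "\<not> 0 < \<beta>"
    then have "\<beta> / (4 * D ^ 3) \<le> 0" using D0 by (simp add: divide_le_0_iff)
    then show False using lt by (simp add: ennreal_neg)
  qed
  have sub: "ball x t \<subseteq> ball y s"
  proof
    fix z assume "z \<in> ball x t"
    then show "z \<in> ball y s" using xy s dist_triangle[of y z x] by (simp add: dist_commute)
  qed
  have mp: "0 < m x t" by (rule m_pos[OF x t])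
  have my: "0 < m y s" using m_mono[OF sub] mp by linarith
  obtain c p f where "approx c p f y s (\<beta> / (4 * D ^ 3) * s * m y s)"
    using alpha_approx[OF _ my lt] s t by auto
  then have "approx c p f x t (\<beta> / (4 * D ^ 3) * s * m y s)"
    using sub by (rule approx_mono) simp
  then have "\<beta> * (t * m x t) \<le> \<beta> / (4 * D ^ 3) * s * m y s"
    using flatness_le[OF x t] by (simp add: \<beta>_def)
  also have "\<dots> \<le> \<beta> / (4 * D ^ 3) * s * (D ^ 3 * m x t)"
    using m_comp[OF x t, of y s 3] xy s t \<beta> D0 by (intro mult_left_mono) auto
  also have "\<dots> = \<beta> * (s / 4 * m x t)" using D0 by simp
  also have "\<dots> < \<beta> * (t * m x t)"
    using s \<beta> mp by (intro mult_strict_left_mono mult_strict_right_mono) auto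
  finally show False by simp
qed

text \<open>The scales use the disjoint windows [2T,4T) with T = \<open>R / 2 ^ k\<close>, each of
  length 2T with integrand at least \<open>q k\<close>. A point \<open>y\<close> within the smallest
  radius \<open>R / 2 ^ K\<close> of \<open>x\<close> is close enough for all of them at
  once.\<close>

lemma alpha_integral_ge:
  assumes x: "x \<in> \<Sigma>" and R: "0 < R" and y: "dist x y < R / 2 ^ K"
  shows "ennreal ((\<Sum>k\<le>K. flatness x (R / 2 ^ k)) / (8 * D ^ 3))
    \<le> (\<integral>\<^sup>+t\<in>{0<..<4 * R}. alpha d \<mu> y t / ennreal t \<partial>lborel)"
proof -
  define T where "T k = R / 2 ^ k" for k :: nat
  define q where "q k = flatness x (T k) / (4 * D ^ 3) / (4 * T k)" for k
  define I where "I k = {2 * T k..<4 * T k}" for k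
  have T: "0 < T k" for k using R by (simp add: T_def)
  have D0: "0 < D ^ 3" using D1 by simp
  have q: "0 \<le> q k" for k using flatness_nonneg[OF T] T[of k] D0 by (simp add: q_def)
  have qT: "q k * (2 * T k) = flatness x (T k) / (8 * D ^ 3)" for k
    using T[of k] by (simp add: q_def)
  have Tmono: "2 * T k \<le> T j" if jk: "j < k" for j k
  proof -
    obtain i where i: "k = Suc (j + i)" using less_imp_Suc_add[OF jk] by auto
    have "T j * 1 \<le> T j * 2 ^ i" using T[of j] by (intro mult_left_mono) auto
    then show ?thesis unfolding i T_def by (simp add: power_add field_simps)
  qed
  have disj: "j = k" if "t \<in> I j" "t \<in> I k" for t j k
    using that Tmono[of j k] Tmono[of k j] by (cases j k rule: linorder_cases) (auto simp: I_def)
  have "ennreal ((\<Sum>k\<le>K. flatness x (R / 2 ^ k)) / (8 * D ^ 3)) = ennreal (\<Sum>k\<le>K. q k * (2 * T k))"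
    by (simp add: qT sum_divide_distrib flip: T_def)
  also have "\<dots> = (\<Sum>k\<le>K. ennreal (q k * (2 * T k)))"
    using q T less_imp_le by (intro sum_ennreal[symmetric] mult_nonneg_nonneg) auto
  also have "\<dots> = (\<Sum>k\<le>K. ennreal (q k) * emeasure lborel (I k))"
  proof (rule sum.cong)
    fix k
    have "emeasure lborel (I k) = ennreal (2 * T k)"
      unfolding I_def using T[of k] by (subst emeasure_lborel_Ico) auto
    then show "ennreal (q k * (2 * T k)) = ennreal (q k) * emeasure lborel (I k)"
      using q[of k] T[of k] by (simp add: ennreal_mult)
  qed simp
  also have "\<dots> = (\<integral>\<^sup>+t. (\<Sum>k\<le>K. ennreal (q k) * indicator (I k) t) \<partial>lborel)"
    by (subst nn_integral_sum) (auto simp: I_def nn_integral_cmult_indicator)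
  also have "\<dots> \<le> (\<integral>\<^sup>+t\<in>{0<..<4 * R}. alpha d \<mu> y t / ennreal t \<partial>lborel)"
  proof (rule nn_integral_mono)
    fix t :: real
    show "(\<Sum>k\<le>K. ennreal (q k) * indicator (I k) t) \<le> alpha d \<mu> y t / ennreal t * indicator {0<..<4 * R} t"
    proof (cases "\<exists>k\<le>K. t \<in> I k")
      case True
      then obtain k where k: "k \<le> K" "t \<in> I k" by blast
      have "(\<Sum>k\<le>K. ennreal (q k) * indicator (I k) t) = (\<Sum>j\<in>{k}. ennreal (q j) * indicator (I j) t)"
        using k disj by (intro sum.mono_neutral_right) (auto simp: indicator_def)
      then have eq: "(\<Sum>k\<le>K. ennreal (q k) * indicator (I k) t) = ennreal (q k)" using k by simp
      have t: "0 < t" "2 * T k \<le> t" "t < 4 * T k" using k(2) T[of k] by (auto simp: I_def)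
      have "T K \<le> T k" using Tmono[of k K] k(1) T[of K] by (cases "k = K") auto
      then have d: "dist x y < T k" using y by (simp add: T_def)
      have TR: "T k \<le> R" using R by (simp add: T_def divide_le_eq)
      have "ennreal (q k) \<le> ennreal (flatness x (T k) / (4 * D ^ 3) / t)"
        unfolding q_def using t T[of k] flatness_nonneg[OF T[of k]] D0 by (intro ennreal_leI divide_left_mono) auto
      also have "\<dots> = ennreal (flatness x (T k) / (4 * D ^ 3)) / ennreal t"
        using t flatness_nonneg[OF T[of k], of x] D0 by (intro divide_ennreal[symmetric]) auto
      also have "\<dots> \<le> alpha d \<mu> y t / ennreal t"
        by (intro divide_right_mono_ennreal flatness_le_alpha[OF x T d t(2,3)])
      finally show ?thesis using eq t TR by simp
    next
      case False
      then have "(\<Sum>k\<le>K. ennreal (q k) * indicator (I k) t) = 0" by (intro sum.neutral) (auto simp: indicator_def)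
      then show ?thesis by simp
    qed
  qed
  finally show ?thesis .
qed

definition carleson :: "real \<Rightarrow> bool" where
  "carleson C \<longleftrightarrow> (\<forall>x\<in>\<Sigma>. \<forall>r>0.
     (\<integral>\<^sup>+y\<in>ball x (2 * r). (\<integral>\<^sup>+t\<in>{0<..<2 * r}. alpha d \<mu> y t / ennreal t \<partial>lborel) \<partial>\<mu>)
       \<le> ennreal C * emeasure \<mu> (ball x r))"

text \<open>Only the values of the inner integral on an open set enter, so its measurability is irrelevant.\<close>

lemma carleson_lower:
  assumes C: "carleson C" "0 \<le> C" and x: "x \<in> \<Sigma>" and r: "0 < r" and q: "0 \<le> q"
    and U: "open U" "U \<subseteq> ball x (16 * r)"
    and ge: "\<And>y. y \<in> U \<Longrightarrow> ennreal q \<le> (\<integral>\<^sup>+t\<in>{0<..<16 * r}. alpha d \<mu> y t / ennreal t \<partial>lborel)"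
  shows "ennreal q * emeasure \<mu> U \<le> ennreal (C * D ^ 3 * m x r)"
proof -
  have "ennreal q * emeasure \<mu> U = (\<integral>\<^sup>+y. ennreal q * indicator U y \<partial>\<mu>)"
    using U by (simp add: nn_integral_cmult_indicator)
  also have "\<dots> \<le> (\<integral>\<^sup>+y\<in>ball x (2 * (8 * r)). (\<integral>\<^sup>+t\<in>{0<..<2 * (8 * r)}. alpha d \<mu> y t / ennreal t \<partial>lborel) \<partial>\<mu>)"
  proof (rule nn_integral_mono)
    fix y
    show "ennreal q * indicator U y \<le> (\<integral>\<^sup>+t\<in>{0<..<2 * (8 * r)}. alpha d \<mu> y t / ennreal t \<partial>lborel)
        * indicator (ball x (2 * (8 * r))) y"
      using ge[of y] U(2) by (cases "y \<in> U") auto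
  qed
  also have "\<dots> \<le> ennreal C * emeasure \<mu> (ball x (8 * r))"
    using C(1) x r unfolding carleson_def by (meson mult_pos_pos zero_less_numeral)
  also have "\<dots> = ennreal (C * m x (8 * r))"
    using C(2) by (simp add: emeasure_ball ennreal_mult)
  also have "\<dots> \<le> ennreal (C * (D ^ 3 * m x r))"
    using m_comp[OF x r, of x "8 * r" 3] C(2) by (intro ennreal_leI mult_left_mono) auto
  finally show ?thesis by (simp add: mult_ac)
qed

text \<open>Flatness budget of a good point. Together with the starting error \<open>bs\<close> it
  is tuned so that each contributes 1/16 to the total 1/8 allowed for a chain.\<close>

definition \<epsilon>0 :: real where "\<epsilon>0 = 1 / (96 * C0 * D ^ 9)"
definition bs :: real where "bs = 1 / (16 * C0 * D ^ 8)"
text \<open>\<open>C2 * D ^ 3\<close> is a sixteenth of the threshold \<open>a\<close> in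
  \<open>carleson_start\<close>, where anything below 7/16 of it gives the contradiction.\<close>

definition C2 :: real where "C2 = bs / (64 * D ^ 7)"

lemma consts_pos: "0 < \<epsilon>0" "0 < bs" "0 < C2"
proof -
  have D: "0 < D" using D1 by simp
  note pos = mult_pos_pos divide_pos_pos zero_less_power[OF D] C0_ge(3) zero_less_one zero_less_numeral
  show "0 < \<epsilon>0" unfolding \<epsilon>0_def by (intro pos)
  show bs: "0 < bs" unfolding bs_def by (intro pos)
  show "0 < C2" unfolding C2_def by (intro pos bs)
qed

lemma consts_sum: "C0 * D ^ 8 * (bs + 6 * D * \<epsilon>0) \<le> 1/8"
proof -
  have D: "D ^ 9 = D ^ 8 * D" by (simp add: power_Suc2[symmetric])
  have "C0 * D ^ 8 * bs = 1/16" "C0 * D ^ 8 * (6 * D * \<epsilon>0) = 1/16"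
    using C0_ge(3) D1 unfolding bs_def \<epsilon>0_def D by (simp_all add: field_simps)
  then show ?thesis by (simp only: distrib_left)
qed

text \<open>If \<alpha>(y,t) were at least \<open>a\<close> for all y in B(x0,r) and t in [9r,16r),
  the inner integral would be at least \<open>7 / 16 * a\<close> on all of B(x0,r), contradicting
  the Carleson condition. From 9r on, B(y,t) contains B(x,4r) for every x in B(x0,r), so one pair
  (y,t) serves them all.\<close>

lemma carleson_start:
  assumes C: "carleson C" "0 \<le> C" "C \<le> C2" and x0: "x0 \<in> \<Sigma>" and r: "0 < r"
  obtains c p f where "\<And>x. x \<in> \<Sigma> \<Longrightarrow> dist x0 x < r \<Longrightarrow> rapprox bs c p f x (4 * r)"
proof -
  \<comment> \<open>Passing from B(y,t) to B(x,4r) costs at most 4 for the radii and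
    \<open>D ^ 4\<close> for the masses.\<close>
  define a where "a = bs / (4 * D ^ 4)"
  have a: "0 < a" using consts_pos D1 by (simp add: a_def)
  have "\<exists>y t. dist x0 y < r \<and> 9 * r \<le> t \<and> t < 16 * r \<and> alpha d \<mu> y t < ennreal a"
  proof (rule ccontr)
    assume n: "\<not> ?thesis"
    have "ennreal (7 / 16 * a) \<le> (\<integral>\<^sup>+t\<in>{0<..<16 * r}. alpha d \<mu> y t / ennreal t \<partial>lborel)"
      if y: "y \<in> ball x0 r" for y
    proof -
      have "ennreal (7 / 16 * a) = ennreal (a / (16 * r)) * emeasure lborel {9 * r..<16 * r}"
        using r a by (simp add: ennreal_mult[symmetric])
      also have "\<dots> = (\<integral>\<^sup>+t. ennreal (a / (16 * r)) * indicator {9 * r..<16 * r} t \<partial>lborel)"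
        by (simp add: nn_integral_cmult_indicator)
      also have "\<dots> \<le> (\<integral>\<^sup>+t\<in>{0<..<16 * r}. alpha d \<mu> y t / ennreal t \<partial>lborel)"
      proof (rule nn_integral_mono)
        fix t :: real
        show "ennreal (a / (16 * r)) * indicator {9 * r..<16 * r} t
            \<le> alpha d \<mu> y t / ennreal t * indicator {0<..<16 * r} t"
        proof (cases "t \<in> {9 * r..<16 * r}")
          case True
          then have t: "0 < t" "9 * r \<le> t" "t < 16 * r" using r by auto
          have "ennreal (a / (16 * r)) \<le> ennreal (a / t)"
            using t r a by (intro ennreal_leI divide_left_mono) auto
          also have "\<dots> = ennreal a / ennreal t" using t a by (simp add: divide_ennreal)
          also have "ennreal a \<le> alpha d \<mu> y t" using n y t(2,3) by (meson mem_ball not_le)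
          then have "ennreal a / ennreal t \<le> alpha d \<mu> y t / ennreal t" by (rule divide_right_mono_ennreal)
          finally show ?thesis using t(1,3) indicator_simps(1)[OF True] by (simp add: indicator_def)
        qed simp
      qed
      finally show ?thesis .
    qed
    then have "ennreal (7 / 16 * a) * emeasure \<mu> (ball x0 r) \<le> ennreal (C * D ^ 3 * m x0 r)"
      using a r by (intro carleson_lower[OF C(1,2) x0 r]) (auto intro!: subset_ball)
    then have "7 / 16 * a * m x0 r \<le> C * D ^ 3 * m x0 r"
      using a C(2) D1 by (simp add: emeasure_ball ennreal_mult[symmetric])
    then have "7 / 16 * a \<le> C * D ^ 3" using m_pos[OF x0 r] by simp
    also have "\<dots> \<le> C2 * D ^ 3" using C(3) D1 by (intro mult_right_mono) auto
    also have "\<dots> = a / 16" using D1 by (simp add: C2_def a_def field_simps eval_nat_numeral)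
    finally show False using a by simp
  qed
  then obtain y t where yt: "dist x0 y < r" "9 * r \<le> t" "t < 16 * r" "alpha d \<mu> y t < ennreal a" by blast
  have t: "0 < t" using yt r by simp
  have sub: "ball x (4 * r) \<subseteq> ball y t" if "dist x0 x < r" for x
  proof
    fix z assume "z \<in> ball x (4 * r)"
    then show "z \<in> ball y t"
      using that yt dist_triangle[of y z x] dist_triangle[of y x x0] by (simp add: dist_commute)
  qed
  have "0 < m x0 (4 * r)" using m_pos[OF x0] r by simp
  then have my: "0 < m y t" using m_mono[OF sub[of x0]] r by simp
  obtain c p f where ap: "rapprox a c p f y t"
    using alpha_approx[OF t my yt(4)] by blast
  show thesis
  proof (rule that)
    fix x assume x: "x \<in> \<Sigma>" "dist x0 x < r"
    have "dist x y \<le> 2 * r" using x(2) yt(1) dist_triangle[of x y x0] by (simp add: dist_commute)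
    then have "m y t \<le> D ^ 4 * m x (4 * r)" using m_comp[OF x(1), of "4 * r" y t 4] r yt by simp
    then have "a * t * m y t \<le> a * t * (D ^ 4 * m x (4 * r))" using a t by (intro mult_left_mono) auto
    also have "\<dots> \<le> a * (16 * r) * (D ^ 4 * m x (4 * r))"
      using yt a D1 by (intro mult_right_mono mult_left_mono) auto
    also have "\<dots> = bs * (4 * r) * m x (4 * r)" using D1 by (simp add: a_def)
    finally show "rapprox bs c p f x (4 * r)"
      by (rule approx_mono[OF ap sub[OF x(2)]])
  qed
qed

end

section \<open>Good and bad parts of a ball\<close>

text \<open>The countable subfamily is laid out along all natural numbers so that series can be
  used. Indices without a ball receive the empty ball of radius 0 about \<open>x0\<close>.\<close>

lemma Vitali_covering_sequence:
  fixes s :: "'a::euclidean_space \<Rightarrow> real"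
  assumes s: "\<And>x. x \<in> K \<Longrightarrow> 0 < s x \<and> s x \<le> B"
  obtains X S where "\<And>n::nat. X n \<in> K \<and> S n = s (X n) \<or> X n = x0 \<and> S n = 0"
    "disjoint_family (\<lambda>n. ball (X n) (S n))"
    "(\<Union>x\<in>K. ball x (s x)) \<subseteq> (\<Union>n. ball (X n) (5 * S n))"
proof -
  let ?U = "\<Union>x\<in>K. ball x (s x)"
  obtain C where C: "countable C" "C \<subseteq> K"
    "pairwise (\<lambda>i j. disjnt (ball i (s i)) (ball j (s j))) C" "?U \<subseteq> (\<Union>i\<in>C. ball i (5 * s i))"
    by (rule Vitali_covering_lemma_balls[where S = ?U and K = K and a = "\<lambda>x. x" and r = s and B = B])
       (use s in auto)
  define I where "I = to_nat_on C ` C"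
  define h where "h = inv_into C (to_nat_on C)"
  have bij: "bij_betw h I C"
    unfolding h_def I_def using C(1) by (intro bij_betw_inv_into inj_on_imp_bij_betw inj_on_to_nat_on)
  have hI: "h n \<in> C" if "n \<in> I" for n using bij that by (auto simp: bij_betw_def)
  define X where "X n = (if n \<in> I then h n else x0)" for n
  define S where "S n = (if n \<in> I then s (h n) else 0)" for n
  show thesis
  proof (rule that[of X S])
    show "X n \<in> K \<and> S n = s (X n) \<or> X n = x0 \<and> S n = 0" for n
      using hI C(2) by (auto simp: X_def S_def)
    show "disjoint_family (\<lambda>n. ball (X n) (S n))"
      unfolding disjoint_family_on_def
    proof (intro ballI impI)
      fix i j :: nat assume ij: "i \<noteq> j"
      show "ball (X i) (S i) \<inter> ball (X j) (S j) = {}"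
      proof (cases "i \<in> I \<and> j \<in> I")
        case True
        then have "h i \<noteq> h j" using bij ij by (auto simp: bij_betw_def dest: inj_onD)
        then show ?thesis
          using C(3) hI True by (auto simp: pairwise_def disjnt_def X_def S_def)
      qed (auto simp: S_def)
    qed
    show "?U \<subseteq> (\<Union>n. ball (X n) (5 * S n))"
    proof
      fix y assume "y \<in> ?U"
      then obtain i where i: "i \<in> C" "y \<in> ball i (5 * s i)" using C(4) by blast
      obtain n where "n \<in> I" "h n = i" using i(1) bij by (auto simp: bij_betw_def)
      then have "y \<in> ball (X n) (5 * S n)" using i(2) by (simp add: X_def S_def)
      then show "y \<in> (\<Union>n. ball (X n) (5 * S n))" by blast
    qed
  qed
qed

context doubling_measure
begin

text \<open>A common bound for all density comparisons: \<open>4 ^ d\<close> pays for replacing a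
  radius by the next dyadic one or \<open>r\<close> by \<open>4 * r\<close>, and
  \<open>D\<^sup>2\<close> for the mass of B(x0,4r).\<close>

definition A1 :: real where "A1 = 2 * 4 ^ (d + 1) * 4 ^ d * \<kappa> * D\<^sup>2"
text \<open>In \<open>8 * D ^ 9 / \<epsilon>0\<close> three factors \<open>D ^ 3\<close> meet: from
  the flatness bound, from the Carleson condition and from the fivefold Vitali balls. The remaining
  factors convert the masses of stopping balls into powers of their radii.\<close>

definition A2 :: real where "A2 = 5 ^ d * 2 * 4 ^ (d + 1) * 8 * D ^ 9 / \<epsilon>0 * A1"

lemma A1_ge:
  "2 * \<kappa> * 4 ^ d \<le> A1" "2 * 4 ^ (d + 1) * 4 ^ d \<le> A1" "2 * 4 ^ (d + 1) * D\<^sup>2 \<le> A1" "1 \<le> A1"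
proof -
  have 1: "(1::real) \<le> 4 ^ d" "(1::real) \<le> 4 ^ (d + 1)" "1 \<le> D\<^sup>2" "1 \<le> \<kappa>"
    by (rule one_le_power, simp)+ (use \<kappa>_ge one_le_power[OF D1, of 2] in auto)
  then have \<kappa>0: "0 \<le> \<kappa>" by simp
  have "2 * 4 ^ d * \<kappa> * 1 * 1 \<le> 2 * 4 ^ d * \<kappa> * 4 ^ (d + 1) * D\<^sup>2"
    using 1 \<kappa>0 by (intro mult_mono mult_nonneg_nonneg) simp_all
  then show "2 * \<kappa> * 4 ^ d \<le> A1" by (simp add: A1_def mult_ac)
  have "2 * 4 ^ (d + 1) * 4 ^ d * 1 * 1 \<le> 2 * 4 ^ (d + 1) * 4 ^ d * \<kappa> * D\<^sup>2"
    using 1 \<kappa>0 by (intro mult_mono mult_nonneg_nonneg) simp_all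
  then show 2: "2 * 4 ^ (d + 1) * 4 ^ d \<le> A1" by (simp add: A1_def)
  have "2 * 4 ^ (d + 1) * 1 * 1 * D\<^sup>2 \<le> 2 * 4 ^ (d + 1) * 4 ^ d * \<kappa> * D\<^sup>2"
    using 1 \<kappa>0 by (intro mult_mono mult_nonneg_nonneg) simp_all
  then show "2 * 4 ^ (d + 1) * D\<^sup>2 \<le> A1" by (simp only: mult_1_right A1_def)
  have "1 * 1 \<le> (4::real) ^ (d + 1) * 4 ^ d" by (rule mult_mono[OF 1(2,1)]) simp_all
  then show "1 \<le> A1" using 2 by linarith
qed

lemma A2_ge: "8 * D ^ 9 / \<epsilon>0 \<le> A2" "5 ^ d * 2 * 4 ^ (d + 1) * (8 * D ^ 6 / \<epsilon>0) * A1 \<le> A2" "0 < A2"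
proof -
  define E where "E = 8 * D ^ 9 / \<epsilon>0"
  have E: "0 < E" using consts_pos(1) D1 by (simp add: E_def)
  have A2: "A2 = (5 ^ d * 2 * 4 ^ (d + 1)) * A1 * E" by (simp add: A2_def E_def)
  have one: "(1::real) \<le> 5 ^ d" "(1::real) \<le> 4 ^ (d + 1)" by (rule one_le_power, simp)+
  have "1 * 1 * 1 \<le> (5::real) ^ d * 2 * 4 ^ (d + 1)" using one by (intro mult_mono) auto
  then have "1 * 1 \<le> (5 ^ d * 2 * 4 ^ (d + 1)) * A1"
    using A1_ge(4) by (intro mult_mono) auto
  then have "1 * E \<le> A2" unfolding A2 using E by (intro mult_right_mono) auto
  then show "8 * D ^ 9 / \<epsilon>0 \<le> A2" by (simp add: E_def)
  then show "0 < A2" using E by (simp add: E_def)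
  have "D ^ 6 \<le> D ^ 9" using D1 by (intro power_increasing) auto
  then have "8 * D ^ 6 / \<epsilon>0 \<le> E" unfolding E_def using consts_pos(1) by (intro divide_right_mono) auto
  then have "(5 ^ d * 2 * 4 ^ (d + 1)) * A1 * (8 * D ^ 6 / \<epsilon>0) \<le> A2"
    unfolding A2 using A1_ge(4) by (intro mult_left_mono) auto
  then show "5 ^ d * 2 * 4 ^ (d + 1) * (8 * D ^ 6 / \<epsilon>0) * A1 \<le> A2" by (simp only: mult_ac)
qed

text \<open>
  The bad set is a union of open stopping balls, so the good set \<open>G\<close> is Borel without any
  measurability of the \<open>\<alpha>\<close>-numbers. The covering by bad balls is padded with empty balls.
\<close>

lemma good_bad_decomposition:
  assumes C: "carleson C" "0 \<le> C" "C \<le> C2" and x0: "x0 \<in> \<Sigma>" and r: "0 < r"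
  obtains G c f X \<rho> where
    "G \<in> sets borel" "G \<subseteq> \<Sigma> \<inter> ball x0 r" "rigid f" "0 < c"
    "\<And>x s. x \<in> G \<Longrightarrow> 0 < s \<Longrightarrow> s \<le> r \<Longrightarrow> m x s \<le> A1 * (c * s ^ d)"
    "\<And>x s. x \<in> G \<Longrightarrow> 0 < s \<Longrightarrow> s \<le> r \<Longrightarrow> c * s ^ d \<le> A1 * m x s"
    "m x0 r \<le> A1 * (c * r ^ d)" "c * r ^ d \<le> A1 * m x0 r"
    "\<And>x y. x \<in> G \<Longrightarrow> y \<in> G \<Longrightarrow> \<exists>v\<in>W. norm ((y - x) - f v) \<le> dist x y / 2"
    "\<Sigma> \<inter> ball x0 r \<subseteq> G \<union> (\<Union>n::nat. ball (X n) (\<rho> n))" "\<And>n. X n \<in> \<Sigma>" "\<And>n. 0 \<le> \<rho> n"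
    "(\<Sum>n. ennreal (\<rho> n ^ d)) \<le> ennreal (A2 * C * r ^ d)"
    "(\<Sum>n. emeasure \<mu> (ball (X n) (\<rho> n))) \<le> ennreal (A2 * C * m x0 r)"
proof -
  \<comment> \<open>Two points of B(x0,r) are less than \<open>2 * r = R / 2\<close> apart, which is
    where the annuli of the cone estimate begin.\<close>
  define R where "R = 4 * r"
  have R: "0 < R" using r by (simp add: R_def)
  have t: "0 < R / 2 ^ k" for k :: nat using R by simp
  define bad where "bad x K \<longleftrightarrow> (\<Sum>k\<le>K. flatness x (R / 2 ^ k)) > \<epsilon>0" for x and K :: nat
  define Bad where "Bad = {x \<in> \<Sigma>. dist x0 x < r \<and> (\<exists>K. bad x K)}"
  \<comment> \<open>At the first bad scale the flatness sum up to \<open>N x\<close> exceeds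
    \<open>\<epsilon>0\<close>, which the Carleson condition will count. The sum over
    \<open>k < N x\<close> does not (it is empty for \<open>N x = 0\<close>), so the density
    estimates still hold at the stopping radius.\<close>
  define N where "N x = (LEAST K. bad x K)" for x
  define s where "s x = R / 2 ^ N x" for x
  define U where "U = (\<Union>x\<in>Bad. ball x (s x))"
  define G where "G = \<Sigma> \<inter> ball x0 r - U"
  have G_borel: "G \<in> sets borel"
    unfolding G_def U_def
    by (intro sets.Diff sets.Int borel_closed[OF closed_msupport[OF sets_mu]] borel_open open_UN ballI open_ball)
  obtain c p f where start: "\<And>x. x \<in> \<Sigma> \<Longrightarrow> dist x0 x < r \<Longrightarrow> rapprox bs c p f x R"
    unfolding R_def by (rule carleson_start[OF C x0 r]) blast
  have start0: "rapprox bs c p f x0 R" using start[OF x0] r by simp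
  have f: "rigid f" by (rule approx_rigid[OF start0])
  note dens = flatness_density[OF _ R start less_imp_le[OF consts_pos(2)] consts_pos(1) _ consts_sum]
  note cone = flatness_cone[OF _ R start less_imp_le[OF consts_pos(2)] consts_pos(1) _ consts_sum]
  have notbad: "(\<Sum>k<n. flatness x (R / 2 ^ k)) \<le> \<epsilon>0" if "\<And>j. j < n \<Longrightarrow> \<not> bad x j" for x n
    using that[of "n - 1"] consts_pos(1) by (cases n) (auto simp: bad_def not_less lessThan_Suc_atMost)
  have G_good: "x \<in> \<Sigma>" "dist x0 x < r" "\<And>n. (\<Sum>k<n. flatness x (R / 2 ^ k)) \<le> \<epsilon>0" if x: "x \<in> G" for x
  proof -
    show x': "x \<in> \<Sigma>" "dist x0 x < r" using x by (auto simp: G_def)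
    have "x \<notin> Bad"
    proof
      assume "x \<in> Bad"
      then have "x \<in> U" unfolding U_def s_def using t by force
      then show False using x by (simp add: G_def)
    qed
    then show "(\<Sum>k<n. flatness x (R / 2 ^ k)) \<le> \<epsilon>0" for n
      using x' by (intro notbad) (auto simp: Bad_def)
  qed
  have Bad: "x \<in> \<Sigma>" "dist x0 x < r" "(\<Sum>k<N x. flatness x (R / 2 ^ k)) \<le> \<epsilon>0" "bad x (N x)"
    if x: "x \<in> Bad" for x
  proof -
    show "x \<in> \<Sigma>" "dist x0 x < r" using x by (auto simp: Bad_def)
    show "bad x (N x)" using x unfolding N_def Bad_def by (auto intro: LeastI_ex)
    show "(\<Sum>k<N x. flatness x (R / 2 ^ k)) \<le> \<epsilon>0"
      unfolding N_def by (intro notbad) (rule not_less_Least)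
  qed
  have s: "0 < s x" "s x \<le> R" for x using R by (auto simp: s_def divide_le_eq)
  have z: "(\<Sum>k<0::nat. flatness x0 (R / 2 ^ k)) \<le> \<epsilon>0" using consts_pos(1) by simp
  have den0: "m x0 R \<le> 2 * \<kappa> * (c * R ^ d)" "c * R ^ d \<le> 2 * 4 ^ (d + 1) * m x0 R"
    using dens[OF x0 x0 _ z order_refl] r by simp_all
  have c: "0 < c"
  proof -
    have "0 < 2 * \<kappa> * (c * R ^ d)" using den0(1) m_pos[OF x0 R] by linarith
    then show ?thesis using \<kappa>_ge R by (simp add: zero_less_mult_iff)
  qed
  have up0: "m x0 r \<le> A1 * (c * r ^ d)"
  proof -
    have "m x0 r \<le> m x0 R" using r by (intro m_mono subset_ball) (simp add: R_def)
    also have "\<dots> \<le> (2 * \<kappa> * 4 ^ d) * (c * r ^ d)"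
      using den0(1) by (simp add: R_def power_mult_distrib mult_ac)
    also have "\<dots> \<le> A1 * (c * r ^ d)" using A1_ge(1) c r by (intro mult_right_mono) auto
    finally show ?thesis .
  qed
  have lo0: "c * r ^ d \<le> A1 * m x0 r"
  proof -
    have "c * r ^ d \<le> c * R ^ d" using c r by (intro mult_left_mono power_mono) (auto simp: R_def)
    also have "\<dots> \<le> 2 * 4 ^ (d + 1) * m x0 R" by (rule den0(2))
    also have "\<dots> \<le> 2 * 4 ^ (d + 1) * (D\<^sup>2 * m x0 r)"
      using m_comp[OF x0 r, of x0 R 2] by (intro mult_left_mono) (auto simp: R_def)
    also have "\<dots> = (2 * 4 ^ (d + 1) * D\<^sup>2) * m x0 r" by (simp only: mult_ac)
    also have "\<dots> \<le> A1 * m x0 r" using A1_ge(3) by (rule mult_right_mono) simp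
    finally show ?thesis .
  qed
  have d42: "(2::real) ^ d \<le> 4 ^ d" by (intro power_mono) auto
  have upG: "m x u \<le> A1 * (c * u ^ d)" and loG: "c * u ^ d \<le> A1 * m x u"
    if x: "x \<in> G" and u: "0 < u" "u \<le> r" for x u
  proof -
    note g = G_good[OF x]
    obtain k where k: "R / 2 ^ Suc k \<le> u" "u < R / 2 ^ k"
      by (rule dyadic_scale[of u R]) (use u r in \<open>auto simp: R_def\<close>)
    have "m x u \<le> m x (R / 2 ^ k)" using k by (intro m_mono subset_ball) auto
    also have "\<dots> \<le> 2 * \<kappa> * (c * (R / 2 ^ k) ^ d)"
      by (rule dens(1)[OF g(1) g(1,2) g(3) order_refl])
    also have "\<dots> \<le> 2 * \<kappa> * (c * (2 * u) ^ d)"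
      using k(1) R c \<kappa>_ge by (intro mult_left_mono power_mono) (auto simp: field_simps)
    also have "\<dots> = (2 * \<kappa> * 2 ^ d) * (c * u ^ d)" by (simp add: power_mult_distrib mult_ac)
    also have "\<dots> \<le> (2 * \<kappa> * 4 ^ d) * (c * u ^ d)"
      using d42 \<kappa>_ge c u by (intro mult_right_mono mult_left_mono) auto
    also have "\<dots> \<le> A1 * (c * u ^ d)" using A1_ge(1) c u by (intro mult_right_mono) auto
    finally show "m x u \<le> A1 * (c * u ^ d)" .
    have "c * u ^ d \<le> c * (2 * (R / 2 ^ Suc k)) ^ d"
      using k(2) c u by (intro mult_left_mono power_mono) auto
    also have "\<dots> = 2 ^ d * (c * (R / 2 ^ Suc k) ^ d)" by (simp only: power_mult_distrib mult_ac)
    also have "\<dots> \<le> 2 ^ d * (2 * 4 ^ (d + 1) * m x (R / 2 ^ Suc k))"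
      by (intro mult_left_mono dens(2)[OF g(1) g(1,2) g(3) order_refl]) simp
    also have "\<dots> \<le> 2 ^ d * (2 * 4 ^ (d + 1) * m x u)"
      using k(1) by (intro mult_left_mono m_mono subset_ball) auto
    also have "\<dots> \<le> 4 ^ d * (2 * 4 ^ (d + 1) * m x u)"
      using d42 by (intro mult_right_mono) auto
    also have "\<dots> = (2 * 4 ^ (d + 1) * 4 ^ d) * m x u" by (simp only: mult_ac)
    also have "\<dots> \<le> A1 * m x u" using A1_ge(2) by (rule mult_right_mono) simp
    finally show "c * u ^ d \<le> A1 * m x u" .
  qed
  have coneG: "\<exists>v\<in>W. norm ((y - x) - f v) \<le> dist x y / 2" if x: "x \<in> G" and y: "y \<in> G" for x y
  proof (cases "x = y")
    case True
    then show ?thesis using f W_0 by (intro bexI[of _ 0]) (auto simp: rigid_def linear_0)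
  next
    case False
    note g = G_good[OF x] and g' = G_good[OF y]
    have "dist x y < 2 * r" using g(2) g'(2) dist_triangle[of x y x0] by (simp add: dist_commute)
    then obtain k where k: "(R / 2) / 2 ^ Suc k \<le> dist x y" "dist x y < (R / 2) / 2 ^ k"
      using dyadic_scale[of "dist x y" "R / 2"] False by (auto simp: R_def)
    have "R / 2 ^ k / 4 \<le> dist x y" "dist x y < R / 2 ^ k / 2" using k by (simp_all add: field_simps)
    then show ?thesis by (rule cone[OF g(1) g(1,2) g(3) order_refl g'(1)])
  qed
  obtain X S where XS: "\<And>n. X n \<in> Bad \<and> S n = s (X n) \<or> X n = x0 \<and> S n = 0"
    and disj: "disjoint_family (\<lambda>n. ball (X n) (S n))"
    and UXS: "U \<subseteq> (\<Union>n::nat. ball (X n) (5 * S n))"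
    unfolding U_def by (rule Vitali_covering_sequence[of Bad s R x0]) (use s in auto)
  have X: "X n \<in> \<Sigma>" for n using XS[of n] Bad(1) x0 by auto
  have S: "0 \<le> S n" for n using XS[of n] s(1)[of "X n"] by auto
  define V where "V = (\<Union>n. ball (X n) (S n))"
  have V: "open V" by (auto simp: V_def)
  have inV: "\<exists>x\<in>Bad. dist x y < s x" if "y \<in> V" for y
  proof -
    obtain n where n: "dist (X n) y < S n" using \<open>y \<in> V\<close> by (auto simp: V_def)
    then have "S n \<noteq> 0" using zero_le_dist[of "X n" y] by linarith
    then show ?thesis using n XS[of n] by auto
  qed
  \<comment> \<open>The lower bound from \<open>alpha_integral_ge\<close> once the flatness sum
    exceeds \<open>\<epsilon>0\<close>. It is valid throughout the stopping ball, whose radius is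
    that of the smallest scale in the sum.\<close>
  define q where "q = \<epsilon>0 / (8 * D ^ 3)"
  have q: "0 < q" using consts_pos(1) D1 by (simp add: q_def)
  have VR: "V \<subseteq> ball x0 (16 * r)"
  proof
    fix y assume "y \<in> V"
    then obtain x where x: "x \<in> Bad" "dist x y < s x" using inV by blast
    then show "y \<in> ball x0 (16 * r)"
      using Bad(2)[OF x(1)] s(2)[of x] dist_triangle[of x0 y x] r by (simp add: R_def)
  qed
  have "ennreal q * emeasure \<mu> V \<le> ennreal (C * D ^ 3 * m x0 r)"
  proof (rule carleson_lower[OF C(1,2) x0 r less_imp_le[OF q] V VR])
    fix y assume "y \<in> V"
    then obtain x where x: "x \<in> Bad" "dist x y < s x" using inV by blast
    have "ennreal q \<le> ennreal ((\<Sum>k\<le>N x. flatness x (R / 2 ^ k)) / (8 * D ^ 3))"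
      unfolding q_def using Bad(4)[OF x(1)] D1 by (intro ennreal_leI divide_right_mono) (auto simp: bad_def)
    also have "\<dots> \<le> (\<integral>\<^sup>+t\<in>{0<..<4 * R}. alpha d \<mu> y t / ennreal t \<partial>lborel)"
      using x by (intro alpha_integral_ge[OF Bad(1) R]) (auto simp: s_def)
    finally show "ennreal q \<le> (\<integral>\<^sup>+t\<in>{0<..<16 * r}. alpha d \<mu> y t / ennreal t \<partial>lborel)"
      by (simp add: R_def)
  qed
  moreover have "emeasure \<mu> V < top"
    using emeasure_mono[OF VR, of \<mu>] finite_ball[of x0 "16 * r"] by (simp add: order_le_less_trans)
  then obtain v where v: "0 \<le> v" "emeasure \<mu> V = ennreal v" using less_top_ennreal by blast
  ultimately have "q * v \<le> C * D ^ 3 * m x0 r"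
    using q C(2) D1 by (simp add: ennreal_mult[symmetric])
  then have v_le: "v \<le> 8 * D ^ 6 / \<epsilon>0 * C * m x0 r"
    using consts_pos(1) D1 by (simp add: q_def field_simps eval_nat_numeral)
  have sumV: "(\<Sum>n. emeasure \<mu> (ball (X n) (S n))) = ennreal v"
    unfolding v(2)[symmetric] V_def by (rule suminf_emeasure) (use disj in auto)
  have sum1: "(\<Sum>n. ennreal ((5 * S n) ^ d)) \<le> ennreal (A2 * C * r ^ d)"
  proof -
    define B where "B = 5 ^ d * 2 * 4 ^ (d + 1) / c"
    have B: "0 < B" using c by (simp add: B_def)
    have "ennreal ((5 * S n) ^ d) \<le> ennreal B * emeasure \<mu> (ball (X n) (S n))" for n
    proof (cases "S n = 0")
      case False
      then have x: "X n \<in> Bad" and Sn: "S n = s (X n)" using XS[of n] by auto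
      \<comment> \<open>The density at the stopping scale turns powers of radii into masses, and the
        masses of the disjoint balls add up to \<open>v\<close>.\<close>
      have "c * S n ^ d \<le> 2 * 4 ^ (d + 1) * m (X n) (S n)"
        unfolding Sn s_def by (rule dens(2)[OF Bad(1)[OF x] Bad(1,2)[OF x] Bad(3)[OF x] order_refl])
      then have "5 ^ d * (c * S n ^ d) \<le> 5 ^ d * (2 * 4 ^ (d + 1) * m (X n) (S n))"
        by (rule mult_left_mono) simp
      then have "(5 * S n) ^ d \<le> B * m (X n) (S n)"
        using c by (simp add: B_def field_simps power_mult_distrib)
      then show ?thesis
        using B by (simp add: emeasure_ball ennreal_mult[symmetric] ennreal_leI)
    qed (use d1 in \<open>simp add: power_0_left\<close>)
    then have "(\<Sum>n. ennreal ((5 * S n) ^ d)) \<le> (\<Sum>n. ennreal B * emeasure \<mu> (ball (X n) (S n)))"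
      by (intro suminf_le) auto
    also have "\<dots> = ennreal (B * v)" using sumV B v(1) by (simp add: ennreal_mult)
    also have "\<dots> \<le> ennreal (A2 * C * r ^ d)"
    proof (rule ennreal_leI)
      have e: "0 \<le> 8 * D ^ 6 / \<epsilon>0 * C" using consts_pos(1) D1 C(2) by simp
      have "B * v \<le> B * (8 * D ^ 6 / \<epsilon>0 * C * (A1 * (c * r ^ d)))"
        using v_le mult_left_mono[OF up0 e] B by (intro mult_left_mono) auto
      also have "\<dots> = (5 ^ d * 2 * 4 ^ (d + 1) * (8 * D ^ 6 / \<epsilon>0) * A1) * (C * r ^ d)"
        using c by (simp add: B_def)
      also have "\<dots> \<le> A2 * (C * r ^ d)" using A2_ge(2) C(2) r by (intro mult_right_mono) auto
      finally show "B * v \<le> A2 * C * r ^ d" by (simp add: mult_ac)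
    qed
    finally show ?thesis .
  qed
  have sum2: "(\<Sum>n. emeasure \<mu> (ball (X n) (5 * S n))) \<le> ennreal (A2 * C * m x0 r)"
  proof -
    have "emeasure \<mu> (ball (X n) (5 * S n)) \<le> ennreal (D ^ 3) * emeasure \<mu> (ball (X n) (S n))" for n
    proof (cases "S n = 0")
      case False
      then have "m (X n) (5 * S n) \<le> D ^ 3 * m (X n) (S n)"
        using S[of n] by (intro m_comp X) auto
      then show ?thesis using D1 by (simp add: emeasure_ball ennreal_mult[symmetric] ennreal_leI)
    qed simp
    then have "(\<Sum>n. emeasure \<mu> (ball (X n) (5 * S n))) \<le> (\<Sum>n. ennreal (D ^ 3) * emeasure \<mu> (ball (X n) (S n)))"
      by (intro suminf_le) auto
    also have "\<dots> = ennreal (D ^ 3 * v)" using sumV D1 v(1) by (simp add: ennreal_mult)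
    also have "\<dots> \<le> ennreal (A2 * C * m x0 r)"
    proof (rule ennreal_leI)
      have "D ^ 3 * v \<le> D ^ 3 * (8 * D ^ 6 / \<epsilon>0 * C * m x0 r)" using v_le D1 by (intro mult_left_mono) auto
      also have "\<dots> = (8 * D ^ 9 / \<epsilon>0) * (C * m x0 r)" by (simp add: power_add[symmetric])
      also have "\<dots> \<le> A2 * (C * m x0 r)" using A2_ge(1) C(2) by (intro mult_right_mono) auto
      finally show "D ^ 3 * v \<le> A2 * C * m x0 r" by (simp add: mult_ac)
    qed
    finally show ?thesis .
  qed
  have cov: "\<Sigma> \<inter> ball x0 r \<subseteq> G \<union> (\<Union>n. ball (X n) (5 * S n))"
    using UXS by (auto simp: G_def)
  show thesis
    by (rule that[of G f c X "\<lambda>n. 5 * S n"])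
      (use G_borel f c upG loG up0 lo0 coneG cov X S sum1 sum2 in \<open>auto simp: G_def\<close>)
qed

end

section \<open>Sets satisfying a cone condition\<close>

text \<open>McShane extension: \<open>h\<close> is the largest 1-Lipschitz function that does not
  exceed \<open>g\<close> on \<open>X\<close>.\<close>

lemma lipschitz_extension_real:
  fixes g :: "'a::metric_space \<Rightarrow> real"
  assumes g: "\<And>x y. x \<in> X \<Longrightarrow> y \<in> X \<Longrightarrow> \<bar>g x - g y\<bar> \<le> dist x y"
  obtains h where "\<And>x y. \<bar>h x - h y\<bar> \<le> dist x y" "\<And>x. x \<in> X \<Longrightarrow> h x = g x"
proof (cases "X = {}")
  case True
  then show thesis using that[of "\<lambda>_. 0"] by simp
next
  case False
  define h where "h v = (INF w\<in>X. g w + dist v w)" for v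
  have bdd: "bdd_below ((\<lambda>w. g w + dist v w) ` X)" for v
  proof -
    obtain w0 where w0: "w0 \<in> X" using False by auto
    show ?thesis
    proof (rule bdd_belowI2)
      fix w assume "w \<in> X"
      then show "g w0 - dist v w0 \<le> g w + dist v w"
        using g[OF w0, of w] dist_triangle[of w0 w v] by (simp add: dist_commute)
    qed
  qed
  have le: "h x \<le> h y + dist x y" for x y
  proof -
    have "h x - dist x y \<le> h y"
      unfolding h_def[of y]
    proof (rule cINF_greatest[OF False])
      fix w assume w: "w \<in> X"
      have "h x \<le> g w + dist x w" unfolding h_def by (rule cINF_lower[OF bdd w])
      then show "h x - dist x y \<le> g w + dist y w" using dist_triangle[of x w y] by linarith
    qed
    then show ?thesis by simp
  qed
  show thesis
  proof (rule that)
    show "\<bar>h x - h y\<bar> \<le> dist x y" for x y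
      using le[of x y] le[of y x] by (simp add: dist_commute abs_le_iff)
    show "h x = g x" if x: "x \<in> X" for x
    proof (rule antisym)
      show "h x \<le> g x" using cINF_lower[OF bdd x, of x] by (simp add: h_def)
      show "g x \<le> h x"
        unfolding h_def
      proof (rule cINF_greatest[OF False])
        fix w assume "w \<in> X"
        then show "g x \<le> g w + dist x w" using g[OF x, of w] by linarith
      qed
    qed
  qed
qed

lemma subspace_projection:
  fixes V :: "'a::euclidean_space set"
  assumes V: "subspace V" "dim V = d"
  obtains P and e :: "nat \<Rightarrow> 'a" where "linear P" "\<And>x. P x \<in> V"
    "\<And>x v. v \<in> V \<Longrightarrow> (x - P x) \<bullet> v = 0" "\<And>x. norm (P x) = L2_set (\<lambda>i. x \<bullet> e i) {..<d}"
proof -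
  obtain B where B: "B \<subseteq> V" "pairwise orthogonal B" "\<And>x. x \<in> B \<Longrightarrow> norm x = 1"
    "independent B" "card B = dim V" "span B = V"
    using orthonormal_basis_subspace[OF V(1)] by metis
  have fB: "finite B" using B(4) by (rule independent_imp_finite)
  obtain e where e: "bij_betw e {..<d} B"
    using ex_bij_betw_nat_finite[OF fB] B(5) V(2) by (auto simp: lessThan_atLeast0)
  define P where "P x = (\<Sum>b\<in>B. (x \<bullet> b) *\<^sub>R b)" for x
  have Pb: "P x \<bullet> b = x \<bullet> b" if b: "b \<in> B" for x b
  proof -
    have "P x \<bullet> b = (\<Sum>c\<in>B. if c = b then x \<bullet> b else 0)"
      unfolding P_def inner_sum_left
    proof (rule sum.cong)
      fix c assume "c \<in> B"
      then show "(x \<bullet> c) *\<^sub>R c \<bullet> b = (if c = b then x \<bullet> b else 0)"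
        using b B(2) B(3)[of b] by (auto simp: pairwise_def orthogonal_def norm_eq_1)
    qed simp
    then show ?thesis using fB b by simp
  qed
  show thesis
  proof (rule that[of P e])
    show "linear P"
      unfolding P_def by (rule linearI) (simp_all add: inner_add_left scaleR_left_distrib sum.distrib scaleR_sum_right)
    show "P x \<in> V" for x
      unfolding P_def using B(1) V(1) by (intro subspace_sum subspace_scale) auto
    show "(x - P x) \<bullet> v = 0" if "v \<in> V" for x v
      using orthogonal_to_span[of v B "x - P x"] that B(6) Pb by (auto simp: orthogonal_def inner_diff_left)
    show "norm (P x) = L2_set (\<lambda>i. x \<bullet> e i) {..<d}" for x
    proof -
      have "(norm (P x))\<^sup>2 = (\<Sum>b\<in>B. (norm ((x \<bullet> b) *\<^sub>R b))\<^sup>2)"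
        unfolding P_def using B(2) fB
        by (intro norm_sum_Pythagorean) (auto simp: pairwise_def orthogonal_def)
      also have "\<dots> = (\<Sum>b\<in>B. (x \<bullet> b)\<^sup>2)" by (intro sum.cong) (simp_all add: B(3))
      also have "\<dots> = (\<Sum>i<d. (x \<bullet> e i)\<^sup>2)" using sum.reindex_bij_betw[OF e, of "\<lambda>b. (x \<bullet> b)\<^sup>2"] by simp
      finally show ?thesis unfolding L2_set_def by (metis norm_ge_zero real_sqrt_unique)
    qed
  qed
qed

lemma projection_norm_le:
  fixes P :: "'a::euclidean_space \<Rightarrow> 'a"
  assumes P: "\<And>x. P x \<in> V" "\<And>x v. v \<in> V \<Longrightarrow> (x - P x) \<bullet> v = 0"
  shows "norm (P z) \<le> norm z"
proof -
  have "(z - P z) \<bullet> P z = 0" by (rule P(2)[OF P(1)])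
  then have "(norm ((z - P z) + P z))\<^sup>2 = (norm (z - P z))\<^sup>2 + (norm (P z))\<^sup>2"
    by (intro norm_add_Pythagorean) (simp add: orthogonal_def)
  then have "(norm (P z))\<^sup>2 \<le> (norm z)\<^sup>2" by simp
  then show ?thesis by (rule power2_le_imp_le) simp
qed

text \<open>\<open>P z\<close> is the point of \<open>V\<close> nearest to \<open>z\<close>, so
  \<open>z - P z\<close> is no longer than \<open>z - v\<close> and has at most half the length of
  \<open>z\<close>.\<close>

lemma cone_projection_bounds:
  fixes V :: "'a::euclidean_space set"
  assumes P: "linear P" "\<And>x. P x \<in> V" "\<And>x v. v \<in> V \<Longrightarrow> (x - P x) \<bullet> v = 0"
    and v: "v \<in> V" "norm (z - v) \<le> norm z / 2" and V: "subspace V"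
  shows "norm z \<le> 2 * norm (P z)" "norm (z - P z) \<le> norm (P z)"
proof -
  have "P z - v \<in> V" using P(2) v(1) V by (simp add: subspace_diff)
  then have "(z - P z) \<bullet> (P z - v) = 0" by (rule P(3))
  then have "(norm ((z - P z) + (P z - v)))\<^sup>2 = (norm (z - P z))\<^sup>2 + (norm (P z - v))\<^sup>2"
    by (intro norm_add_Pythagorean) (simp add: orthogonal_def)
  then have "(norm (z - P z))\<^sup>2 \<le> (norm (z - v))\<^sup>2" by simp
  then have "norm (z - P z) \<le> norm (z - v)" by (rule power2_le_imp_le) simp
  then have 1: "norm (z - P z) \<le> norm z / 2" using v(2) by linarith
  have 2: "norm z \<le> norm (P z) + norm (z - P z)" using norm_triangle_ineq[of "P z" "z - P z"] by simp
  show "norm z \<le> 2 * norm (P z)" "norm (z - P z) \<le> norm (P z)" using 1 2 by linarith+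
qed

text \<open>By the cone condition the projection \<open>P\<close> is injective on \<open>G\<close>,
  and the orthogonal part \<open>Q\<close> is a 1-Lipschitz function of it. Extending each
  coordinate separately costs the dimension, and the final projection costs the factor 2.\<close>

lemma lipschitz_graph_of_cone:
  fixes V :: "'a::euclidean_space set"
  assumes V: "subspace V" "dim V = d"
    and cone: "\<And>x y. x \<in> G \<Longrightarrow> y \<in> G \<Longrightarrow> \<exists>v\<in>V. norm ((y - x) - v) \<le> dist x y / 2"
  obtains F where "lipschitz_graph (2 * real DIM('a)) d F" "G \<subseteq> F"
proof -
  obtain P where P: "linear P" "\<And>x. P x \<in> V" "\<And>x v. v \<in> V \<Longrightarrow> (x - P x) \<bullet> v = 0"
    by (rule subspace_projection[OF V]) blast
  have Pl: "norm (P z) \<le> norm z" for z by (rule projection_norm_le[OF P(2,3)])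
  define Q where "Q z = z - P z" for z
  have Q: "Q x - Q y = Q (x - y)" for x y by (simp add: Q_def linear_diff[OF P(1)])
  have key: "norm (Q (y - x)) \<le> norm (P y - P x)" if xy: "x \<in> G" "y \<in> G" for x y
  proof -
    obtain v where v: "v \<in> V" "norm ((y - x) - v) \<le> norm (y - x) / 2"
      using cone[OF xy] by (auto simp: dist_norm norm_minus_commute)
    then show ?thesis
      using cone_projection_bounds(2)[OF P v V(1)] by (simp add: Q_def linear_diff[OF P(1)])
  qed
  define sel where "sel w = (SOME x. x \<in> G \<and> P x = w)" for w
  have sel: "sel w \<in> G" "P (sel w) = w" if "w \<in> P ` G" for w
    using someI_ex[of "\<lambda>x. x \<in> G \<and> P x = w"] that unfolding sel_def by auto
  have "\<exists>h. (\<forall>x y. \<bar>h x - h y\<bar> \<le> dist x y) \<and> (\<forall>w\<in>P ` G. h w = Q (sel w) \<bullet> b)" if b: "b \<in> Basis" for b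
  proof -
    have "\<bar>Q (sel w) \<bullet> b - Q (sel w') \<bullet> b\<bar> \<le> dist w w'" if "w \<in> P ` G" "w' \<in> P ` G" for w w'
    proof -
      have "\<bar>(Q (sel w) - Q (sel w')) \<bullet> b\<bar> \<le> norm (Q (sel w) - Q (sel w'))" by (rule Basis_le_norm[OF b])
      also have "\<dots> \<le> dist w w'" using key[of "sel w'" "sel w"] sel that by (simp add: Q dist_norm)
      finally show ?thesis by (simp add: inner_diff_left)
    qed
    from lipschitz_extension_real[of "P ` G" "\<lambda>w. Q (sel w) \<bullet> b", OF this] show ?thesis by metis
  qed
  then obtain h where h: "\<And>b x y. b \<in> Basis \<Longrightarrow> \<bar>h b x - h b y\<bar> \<le> dist x y"
    "\<And>b w. b \<in> Basis \<Longrightarrow> w \<in> P ` G \<Longrightarrow> h b w = Q (sel w) \<bullet> b" by metis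
  define H where "H w = (\<Sum>b\<in>Basis. h b w *\<^sub>R b)" for w :: 'a
  have HG: "H (P x) = Q x" if x: "x \<in> G" for x
  proof -
    have "P x \<in> P ` G" using x by simp
    then have "H (P x) = (\<Sum>b\<in>Basis. (Q (sel (P x)) \<bullet> b) *\<^sub>R b)"
      unfolding H_def by (intro sum.cong) (simp_all add: h(2))
    also have "\<dots> = Q (sel (P x))" by (rule euclidean_representation)
    also have "\<dots> = Q x"
      using key[OF x sel(1)[of "P x"]] sel(2)[of "P x"] x by (simp add: Q[symmetric])
    finally show ?thesis .
  qed
  have Hlip: "norm (H x - H y) \<le> real DIM('a) * dist x y" for x y
  proof -
    have "norm (H x - H y) \<le> (\<Sum>b\<in>Basis. norm ((h b x - h b y) *\<^sub>R b))"
      unfolding H_def sum_subtractf[symmetric] scaleR_diff_left[symmetric] by (rule norm_sum)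
    also have "\<dots> \<le> (\<Sum>b\<in>(Basis :: 'a set). dist x y)" by (intro sum_mono) (simp add: h(1))
    finally show ?thesis by simp
  qed
  \<comment> \<open>The coordinatewise extension may leave the orthogonal complement, so
    \<open>Q\<close> brings it back; on points coming from \<open>G\<close> nothing changes, as
    \<open>P (Q x) = 0\<close>.\<close>
  define f where "f w = Q (H w)" for w
  have "lipschitz_graph (2 * real DIM('a)) d {v + f v | v. v \<in> V}"
    unfolding lipschitz_graph_def
  proof (intro exI conjI)
    show "f ` V \<subseteq> V\<^sup>\<bottom>"
      using P(3) by (auto simp: orthogonal_comp_def orthogonal_def f_def Q_def inner_commute)
    show "(2 * real DIM('a))-lipschitz_on V f"
    proof (rule lipschitz_onI)
      fix x y
      have "norm (f x - f y) \<le> norm (H x - H y) + norm (P (H x - H y))"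
        unfolding f_def Q by (simp add: Q_def norm_triangle_ineq4)
      also have "\<dots> \<le> 2 * norm (H x - H y)" using Pl[of "H x - H y"] by simp
      also have "\<dots> \<le> 2 * real DIM('a) * dist x y" using Hlip[of x y] by simp
      finally show "dist (f x) (f y) \<le> 2 * real DIM('a) * dist x y" by (simp add: dist_norm)
    qed simp
  qed (use V in auto)
  moreover have "G \<subseteq> {v + f v | v. v \<in> V}"
  proof
    fix x assume x: "x \<in> G"
    have "P (Q x) = 0"
    proof -
      have "P (Q x) \<bullet> P (Q x) = Q x \<bullet> P (Q x)" using P(3)[OF P(2), of "Q x" "Q x"] by (simp add: inner_diff_left)
      also have "\<dots> = 0" unfolding Q_def[of x] by (rule P(3)[OF P(2)])
      finally show ?thesis by simp
    qed
    then have "f (P x) = Q x" by (simp add: f_def HG[OF x] Q_def[of "Q x"])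
    then have "x = P x + f (P x)" by (simp add: Q_def)
    then show "x \<in> {v + f v | v. v \<in> V}" using P(2) by blast
  qed
  ultimately show thesis by (rule that)
qed

lemma bilipschitz_of_cone:
  fixes V :: "'a::euclidean_space set"
  assumes V: "subspace V" "dim V = d"
    and cone: "\<And>x y. x \<in> G \<Longrightarrow> y \<in> G \<Longrightarrow> \<exists>v\<in>V. norm ((y - x) - v) \<le> dist x y / 2"
  shows "\<exists>f :: 'a \<Rightarrow> nat \<Rightarrow> real. \<forall>y\<in>G. \<forall>z\<in>G.
    inverse 2 * dist y z \<le> L2_set (\<lambda>i. f y i - f z i) {..<d} \<and>
    L2_set (\<lambda>i. f y i - f z i) {..<d} \<le> 2 * dist y z"
proof -
  obtain P and e :: "nat \<Rightarrow> 'a" where P: "linear P" "\<And>x. P x \<in> V" "\<And>x v. v \<in> V \<Longrightarrow> (x - P x) \<bullet> v = 0"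
    and e: "\<And>x. norm (P x) = L2_set (\<lambda>i. x \<bullet> e i) {..<d}"
    by (rule subspace_projection[OF V]) blast
  have *: "norm (y - z) \<le> 2 * norm (P (y - z)) \<and> norm (P (y - z)) \<le> norm (y - z)" if yz: "y \<in> G" "z \<in> G" for y z
  proof -
    obtain v where v: "v \<in> V" "norm ((y - z) - v) \<le> norm (y - z) / 2"
      using cone[OF yz(2,1)] by (auto simp: dist_norm norm_minus_commute)
    then show ?thesis
      using cone_projection_bounds(1)[OF P v V(1)] projection_norm_le[OF P(2,3)] by simp
  qed
  have eq: "L2_set (\<lambda>i. y \<bullet> e i - z \<bullet> e i) {..<d} = norm (P (y - z))" for y z
    by (simp add: e inner_diff_left)
  show ?thesis
  proof (intro exI[of _ "\<lambda>y i. y \<bullet> e i"] ballI)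
    fix y z assume yz: "y \<in> G" "z \<in> G"
    show "inverse 2 * dist y z \<le> L2_set (\<lambda>i. y \<bullet> e i - z \<bullet> e i) {..<d} \<and>
      L2_set (\<lambda>i. y \<bullet> e i - z \<bullet> e i) {..<d} \<le> 2 * dist y z"
      using *[OF yz] norm_ge_zero[of "y - z"] by (auto simp: eq dist_norm)
  qed
qed

section \<open>Comparison with Hausdorff measure\<close>

text \<open>Stated for an abstract set function so that it applies to the content and the outer
  measure on all sets and to \<mu> on measurable sets.\<close>

lemma countable_cover_le:
  fixes \<Phi> :: "'b set \<Rightarrow> ennreal"
  assumes mono: "\<And>A B. A \<subseteq> B \<Longrightarrow> B \<in> M \<Longrightarrow> \<Phi> A \<le> \<Phi> B"
    and sub: "\<And>A :: nat \<Rightarrow> 'b set. range A \<subseteq> M \<Longrightarrow> \<Phi> (\<Union>i. A i) \<le> (\<Sum>i. \<Phi> (A i))"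
    and M: "E \<inter> G \<in> M" "\<And>n. E \<inter> B n \<in> M" "E \<in> M"
    and cov: "E \<subseteq> G \<union> (\<Union>n::nat. B n)"
  shows "\<Phi> E \<le> \<Phi> (E \<inter> G) + (\<Sum>n. \<Phi> (E \<inter> B n))"
proof -
  define A where "A n = E \<inter> (case n of 0 \<Rightarrow> G | Suc k \<Rightarrow> B k)" for n
  have "E = (\<Union>n. A n)"
  proof (intro equalityI subsetI)
    fix x assume x: "x \<in> E"
    then consider "x \<in> G" | n where "x \<in> B n" using cov by blast
    then show "x \<in> (\<Union>n. A n)"
    proof cases
      case 1
      then have "x \<in> A 0" using x by (simp add: A_def)
      then show ?thesis by blast
    next
      case (2 n)
      then have "x \<in> A (Suc n)" using x by (simp add: A_def)
      then show ?thesis by blast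
    qed
  qed (auto simp: A_def)
  moreover have "range A \<subseteq> M" using M by (auto simp: A_def split: nat.split)
  ultimately have "\<Phi> E \<le> (\<Sum>n. \<Phi> (A n))" using sub[of A] by simp
  also have "\<dots> = (\<Sum>n. \<Phi> (A (n + 1))) + (\<Sum>n<1. \<Phi> (A n))"
    by (rule suminf_offset) (rule summableI)
  also have "\<dots> = \<Phi> (E \<inter> G) + (\<Sum>n. \<Phi> (E \<inter> B n))" by (simp add: A_def add.commute)
  finally show ?thesis .
qed

lemma hausdorff_delta_cover_le:
  assumes "E \<subseteq> G \<union> (\<Union>n::nat. B n)"
  shows "hausdorff_delta d \<delta> E \<le> hausdorff_delta d \<delta> (E \<inter> G) + (\<Sum>n. hausdorff_delta d \<delta> (E \<inter> B n))"
  by (rule countable_cover_le[where M = UNIV])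
     (simp_all add: assms hausdorff_delta_mono hausdorff_delta_UN)

lemma hausdorff_raw_cover_le:
  assumes "E \<subseteq> G \<union> (\<Union>n::nat. B n)"
  shows "hausdorff_raw d E \<le> hausdorff_raw d (E \<inter> G) + (\<Sum>n. hausdorff_raw d (E \<inter> B n))"
  by (rule countable_cover_le[where M = UNIV])
     (simp_all add: assms hausdorff_raw_mono hausdorff_raw_UN)

lemma UN_Int_balls: "(\<Union>n. N \<inter> ball x (real (Suc n))) = N"
proof -
  have "\<exists>n. dist x y < real (Suc n)" for y
  proof -
    obtain n where "dist x y < real n" using reals_Archimedean2 by blast
    then show ?thesis by (intro exI[of _ n]) simp
  qed
  then show ?thesis by (auto simp del: of_nat_Suc)
qed

lemma emeasure_cover_le:
  assumes "E \<in> sets N" "G \<in> sets N" "\<And>n. B n \<in> sets N" "E \<subseteq> G \<union> (\<Union>n::nat. B n)"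
  shows "emeasure N E \<le> emeasure N (E \<inter> G) + (\<Sum>n. emeasure N (E \<inter> B n))"
proof (rule countable_cover_le[where M = "sets N"])
  show "emeasure N (\<Union>i. A i) \<le> (\<Sum>i. emeasure N (A i))" if "range A \<subseteq> sets N" for A :: "nat \<Rightarrow> 'a set"
    using that by (rule emeasure_subadditive_countably)
qed (use assms in \<open>simp_all add: emeasure_mono\<close>)

lemma ennreal_geometric_decay:
  fixes a :: ennreal
  assumes "\<And>j::nat. a \<le> ennreal (K * (1/2) ^ j)"
  shows "a = 0"
proof -
  have "(\<lambda>j. ennreal (K * (1/2) ^ j)) \<longlonglongrightarrow> ennreal (K * 0)"
    by (intro tendsto_ennrealI tendsto_mult tendsto_const LIMSEQ_power_zero) simp
  then have "a \<le> ennreal (K * 0)" using assms by (intro LIMSEQ_le_const) auto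
  then show ?thesis by simp
qed

lemma ennreal_le_divideI:
  assumes "0 < q" "ennreal q * a \<le> ennreal b" "0 \<le> b"
  shows "a \<le> ennreal (b / q)"
proof -
  have "a \<noteq> top" using assms by (auto simp: ennreal_mult_top top_unique)
  then obtain x where x: "0 \<le> x" "a = ennreal x" by (cases a) auto
  then have "q * x \<le> b" using assms by (simp add: ennreal_mult[symmetric])
  then show ?thesis unfolding x(2) using assms(1) by (intro ennreal_leI) (simp add: pos_le_divide_eq mult.commute)
qed

context doubling_measure
begin

text \<open>Mass distribution principle: a covering set that meets \<open>E\<close> is replaced by a
  closed ball about one of their common points, with the diameter of the set as radius.\<close>

lemma emeasure_le_hausdorff_raw:
  assumes E: "E \<in> sets borel" and M: "0 < M" and r: "0 < r"
    and den: "\<And>x s. x \<in> E \<Longrightarrow> 0 < s \<Longrightarrow> s \<le> r \<Longrightarrow> m x s \<le> M * s ^ d"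
  shows "emeasure \<mu> E \<le> ennreal M * hausdorff_raw d E"
proof -
  \<comment> \<open>The density hypothesis concerns open balls, so closed ones are reached by
    letting \<open>s\<close> decrease to \<open>\<delta>\<close>. Radius 0 is included, because
    covering sets may be single points.\<close>
  have cb: "emeasure \<mu> (cball x \<delta>) \<le> ennreal M * ennreal \<delta> ^ d"
    if x: "x \<in> E" and \<delta>: "0 \<le> \<delta>" "\<delta> < r" for x \<delta>
  proof -
    have "((\<lambda>s. ennreal (M * s ^ d)) \<longlongrightarrow> ennreal (M * \<delta> ^ d)) (at_right \<delta>)"
      by (intro tendsto_ennrealI tendsto_intros)
    moreover have "\<forall>\<^sub>F s in at_right \<delta>. emeasure \<mu> (cball x \<delta>) \<le> ennreal (M * s ^ d)"
    proof (rule eventually_at_rightI[OF _ \<delta>(2)])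
      fix s assume s: "s \<in> {\<delta><..<r}"
      have "emeasure \<mu> (cball x \<delta>) \<le> emeasure \<mu> (ball x s)" using s by (intro emeasure_mono) auto
      also have "\<dots> \<le> ennreal (M * s ^ d)"
        unfolding emeasure_ball using den[OF x, of s] s \<delta> by (intro ennreal_leI) auto
      finally show "emeasure \<mu> (cball x \<delta>) \<le> ennreal (M * s ^ d)" .
    qed
    ultimately have "emeasure \<mu> (cball x \<delta>) \<le> ennreal (M * \<delta> ^ d)"
      by (rule tendsto_lowerbound) simp
    then show ?thesis using M \<delta> by (simp add: ennreal_mult ennreal_power)
  qed
  have "emeasure \<mu> E / ennreal M \<le> hausdorff_delta d (r / 2) E"
    unfolding hausdorff_delta_def
  proof (rule INF_greatest, clarify)
    fix U :: "nat \<Rightarrow> 'a set"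
    assume cov: "E \<subseteq> (\<Union>i. U i)" and U: "\<forall>i. bounded (U i) \<and> diameter (U i) \<le> r / 2"
    define p where "p i = (SOME x. x \<in> U i \<inter> E)" for i
    define B where "B i = (if U i \<inter> E = {} then {} else cball (p i) (diameter (U i)))" for i
    have B: "U i \<inter> E \<subseteq> B i" "emeasure \<mu> (B i) \<le> ennreal M * ennreal (diameter (U i)) ^ d" for i
    proof -
      have p: "p i \<in> U i" "p i \<in> E" if "U i \<inter> E \<noteq> {}"
        using some_in_eq[of "U i \<inter> E"] that by (auto simp: p_def)
      have Ui: "bounded (U i)" "diameter (U i) \<le> r / 2" using U by auto
      note dge = diameter_ge_0[OF Ui(1)]
      show "U i \<inter> E \<subseteq> B i"
      proof
        fix y assume y: "y \<in> U i \<inter> E"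
        then have ne: "U i \<inter> E \<noteq> {}" by auto
        show "y \<in> B i"
          using diameter_bounded_bound[OF Ui(1) p(1)[OF ne], of y] y ne by (simp add: B_def)
      qed
      show "emeasure \<mu> (B i) \<le> ennreal M * ennreal (diameter (U i)) ^ d"
      proof (cases "U i \<inter> E = {}")
        case False
        have "diameter (U i) < r" using Ui(2) r by simp
        from cb[OF p(2)[OF False] dge this] show ?thesis using False by (simp add: B_def)
      qed (simp add: B_def)
    qed
    have Bm: "B i \<in> sets borel" for i by (simp add: B_def)
    have "E \<subseteq> (\<Union>i. B i)"
    proof
      fix x assume x: "x \<in> E"
      then obtain i where "x \<in> U i" using cov by blast
      then have "x \<in> B i" using x B(1)[of i] by blast
      then show "x \<in> (\<Union>i. B i)" by blast
    qed
    then have "emeasure \<mu> E \<le> emeasure \<mu> (\<Union>i. B i)"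
      using Bm by (intro emeasure_mono) auto
    also have "\<dots> \<le> (\<Sum>i. emeasure \<mu> (B i))" using Bm by (intro emeasure_subadditive_countably) auto
    also have "\<dots> \<le> (\<Sum>i. ennreal M * ennreal (diameter (U i)) ^ d)" using B(2) by (intro suminf_le) auto
    also have "\<dots> = ennreal M * (\<Sum>i. ennreal (diameter (U i)) ^ d)" by simp
    finally have "emeasure \<mu> E / ennreal M \<le> ennreal M * (\<Sum>i. ennreal (diameter (U i)) ^ d) / ennreal M"
      by (rule divide_right_mono_ennreal)
    then show "emeasure \<mu> E / ennreal M \<le> (\<Sum>i. ennreal (diameter (U i)) ^ d)"
      using M by (simp add: mult.commute[of "ennreal M"] ennreal_mult_divide_eq)
  qed
  then have "ennreal M * (emeasure \<mu> E / ennreal M) \<le> ennreal M * hausdorff_delta d (r / 2) E"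
    by (rule mult_left_mono) simp
  moreover have "ennreal M * (emeasure \<mu> E / ennreal M) = emeasure \<mu> E"
    using M by (simp add: ennreal_times_divide mult.commute[of "ennreal M"] ennreal_mult_divide_eq)
  moreover have "ennreal M * hausdorff_delta d (r / 2) E \<le> ennreal M * hausdorff_raw d E"
    using r by (intro mult_left_mono hausdorff_delta_le_raw) auto
  ultimately show ?thesis by simp
qed

text \<open>Vitali: disjoint balls of radius \<open>s\<close> inside \<open>O'\<close> whose
  fivefold enlargements cover \<open>E\<close>. The enlargements have diameter at most
  \<open>10 * s\<close>, which explains the 10 in the density hypothesis and the choice
  \<open>10 * s \<le> \<delta>\<close>.\<close>

lemma hausdorff_raw_le_emeasure_open:
  assumes E: "E \<subseteq> O'" "open O'" and q: "0 \<le> q" and r: "0 < r"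
    and den: "\<And>x s. x \<in> E \<Longrightarrow> 0 < s \<Longrightarrow> s \<le> r \<Longrightarrow> q * (10 * s) ^ d \<le> m x s"
  shows "ennreal q * hausdorff_raw d E \<le> emeasure \<mu> O'"
  unfolding hausdorff_raw_def SUP_mult_left_ennreal
proof (rule SUP_least)
  fix \<delta> :: real assume "\<delta> \<in> {0<..}"
  then have \<delta>: "0 < \<delta>" by simp
  have "\<exists>s>0. s \<le> r \<and> 10 * s \<le> \<delta> \<and> ball x s \<subseteq> O'" if x: "x \<in> E" for x
  proof -
    obtain e where e: "0 < e" "ball x e \<subseteq> O'" using E x open_contains_ball by blast
    show ?thesis
      using e r \<delta> subset_ball[of "min e (min r (\<delta> / 10))" e x]
      by (intro exI[of _ "min e (min r (\<delta> / 10))"]) auto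
  qed
  then obtain s where s: "\<And>x. x \<in> E \<Longrightarrow> 0 < s x \<and> s x \<le> r \<and> 10 * s x \<le> \<delta> \<and> ball x (s x) \<subseteq> O'"
    by metis
  obtain X S where XS: "\<And>n::nat. X n \<in> E \<and> S n = s (X n) \<or> X n = 0 \<and> S n = 0"
    and disj: "disjoint_family (\<lambda>n. ball (X n) (S n))"
    and cov: "(\<Union>x\<in>E. ball x (s x)) \<subseteq> (\<Union>n. ball (X n) (5 * S n))"
    by (rule Vitali_covering_sequence[of E s r 0]) (use s in auto)
  have S0: "0 \<le> S n" "10 * S n \<le> \<delta>" for n using XS[of n] s[of "X n"] \<delta> by auto
  have diam: "diameter (ball (X n) (5 * S n)) \<le> 10 * S n" for n
  proof (rule diameter_le)
    fix y z assume "y \<in> ball (X n) (5 * S n)" "z \<in> ball (X n) (5 * S n)"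
    then show "norm (y - z) \<le> 10 * S n"
      using dist_triangle[of y z "X n"] by (simp add: dist_norm norm_minus_commute)
  qed (use S0 in simp)
  have "E \<subseteq> (\<Union>x\<in>E. ball x (s x))" using s by force
  then have "hausdorff_delta d \<delta> E \<le> (\<Sum>n. ennreal (diameter (ball (X n) (5 * S n))) ^ d)"
    using cov order_trans[OF diam S0(2)] by (intro hausdorff_delta_le) auto
  also have "\<dots> \<le> (\<Sum>n. ennreal ((10 * S n) ^ d))"
  proof (rule suminf_le)
    fix n
    have "ennreal (diameter (ball (X n) (5 * S n))) ^ d \<le> ennreal (10 * S n) ^ d"
      using diam[of n] by (intro power_mono ennreal_leI) auto
    also have "\<dots> = ennreal ((10 * S n) ^ d)" using S0(1)[of n] by (subst ennreal_power) auto
    finally show "ennreal (diameter (ball (X n) (5 * S n))) ^ d \<le> ennreal ((10 * S n) ^ d)" .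
  qed auto
  finally have "ennreal q * hausdorff_delta d \<delta> E \<le> ennreal q * (\<Sum>n. ennreal ((10 * S n) ^ d))"
    by (rule mult_left_mono) simp
  also have "\<dots> = (\<Sum>n. ennreal (q * (10 * S n) ^ d))" using q S0 by (simp add: ennreal_mult)
  also have "\<dots> \<le> (\<Sum>n. emeasure \<mu> (ball (X n) (S n)))"
  proof (rule suminf_le)
    fix n
    show "ennreal (q * (10 * S n) ^ d) \<le> emeasure \<mu> (ball (X n) (S n))"
      unfolding emeasure_ball
    proof (rule ennreal_leI)
      show "q * (10 * S n) ^ d \<le> m (X n) (S n)"
        using XS[of n] s[of "X n"] den[of "X n" "S n"] d1 by (auto simp: power_0_left)
    qed
  qed auto
  also have "\<dots> = emeasure \<mu> (\<Union>n. ball (X n) (S n))"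
    using disj by (intro suminf_emeasure) auto
  also have "\<dots> \<le> emeasure \<mu> O'"
  proof (rule emeasure_mono)
    have "ball (X n) (S n) \<subseteq> O'" for n
    proof (cases "S n = 0")
      case False
      then show ?thesis using XS[of n] s[of "X n"] by metis
    qed simp
    then show "(\<Union>n. ball (X n) (S n)) \<subseteq> O'" by blast
  qed (use E in simp)
  finally show "ennreal q * hausdorff_delta d \<delta> E \<le> emeasure \<mu> O'" .
qed

text \<open>Outer regularity shrinks the open neighbourhood to \<open>E\<close>. It is applied to
  the restriction of \<mu> to a ball, which is a finite measure.\<close>

lemma hausdorff_raw_le_emeasure:
  assumes E: "E \<in> sets borel" "E \<subseteq> ball x0 R" and q: "0 \<le> q" and r: "0 < r"
    and den: "\<And>x s. x \<in> E \<Longrightarrow> 0 < s \<Longrightarrow> s \<le> r \<Longrightarrow> q * (10 * s) ^ d \<le> m x s"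
  shows "ennreal q * hausdorff_raw d E \<le> emeasure \<mu> E"
proof -
  define M where "M = restr \<mu> (ball x0 R)"
  have M: "sets M = sets borel" by (simp add: M_def)
  have eM: "emeasure M A = emeasure \<mu> (ball x0 R \<inter> A)" if "A \<in> sets borel" for A
    unfolding M_def using that by (intro emeasure_restr) auto
  have "emeasure M (space M) \<noteq> \<infinity>"
    using eM[of UNIV] finite_ball[of x0 R] by (simp add: M_def)
  then have "emeasure M E = (INF U \<in> {U. E \<subseteq> U \<and> open U}. emeasure M U)"
    using E(1) by (intro outer_regular[OF M])
  moreover have "ennreal q * hausdorff_raw d E \<le> (INF U \<in> {U. E \<subseteq> U \<and> open U}. emeasure M U)"
  proof (rule INF_greatest)
    fix U assume "U \<in> {U. E \<subseteq> U \<and> open U}"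
    then have U: "E \<subseteq> U" "open U" by auto
    have "ennreal q * hausdorff_raw d E \<le> emeasure \<mu> (ball x0 R \<inter> U)"
      using E(2) U q r den by (intro hausdorff_raw_le_emeasure_open) auto
    then show "ennreal q * hausdorff_raw d E \<le> emeasure M U" using U(2) by (simp add: eM)
  qed
  moreover have "emeasure M E = emeasure \<mu> E" using E by (simp add: eM Int_absorb1)
  ultimately show ?thesis by simp
qed

lemma emeasure_compl_support: "emeasure \<mu> (- \<Sigma>) = 0"
proof -
  have "\<exists>r>0. emeasure \<mu> (ball x r) = 0" if "x \<in> - \<Sigma>" for x
    using that by (auto simp: msupport_def)
  then obtain r where r: "\<And>x. x \<in> - \<Sigma> \<Longrightarrow> 0 < r x \<and> emeasure \<mu> (ball x (r x)) = 0" by metis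
  obtain F' where F': "F' \<subseteq> (\<lambda>x. ball x (r x)) ` (- \<Sigma>)" "countable F'" "\<Union>F' = (\<Union>x\<in>- \<Sigma>. ball x (r x))"
    by (rule Lindelof[of "(\<lambda>x. ball x (r x)) ` (- \<Sigma>)"]) auto
  have "S \<in> null_sets \<mu>" if S: "S \<in> F'" for S
  proof -
    obtain x where "x \<in> - \<Sigma>" "S = ball x (r x)" using F'(1) S by blast
    then show ?thesis using r[of x] by (auto simp: null_sets_def)
  qed
  then have "\<Union>F' \<in> null_sets \<mu>" using F'(2) null_sets_UN'[of F' "\<lambda>x. x" \<mu>] by simp
  moreover have "- \<Sigma> \<subseteq> \<Union>F'" unfolding F'(3) using r by force
  ultimately show ?thesis
    using null_sets_subset[of "\<Union>F'" \<mu> "- \<Sigma>"] borel_closed[OF closed_msupport[OF sets_mu]] by auto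
qed

end

section \<open>Consequences\<close>

context flat_model
begin

definition ball_const :: real where
  "ball_const = enn2real (hausdorff_raw d ((SOME W :: 'a set. subspace W \<and> dim W = d) \<inter> ball 0 1))"

lemma hausdorff_raw_ball_const:
  shows ball_const_pos: "0 < ball_const"
    and hausdorff_raw_eq: "hausdorff_raw d E = ennreal ball_const * hausdorff d (E :: 'a set)"
proof -
  let ?S = "SOME W :: 'a set. subspace W \<and> dim W = d"
  define \<nu> where "\<nu> = hausdorff_raw d (?S \<inter> ball 0 1)"
  have h: "hausdorff d E = hausdorff_raw d E / \<nu>" for E :: "'a set" by (simp add: hausdorff_def \<nu>_def)
  have S: "subspace ?S \<and> dim ?S = d" using someI[of "\<lambda>W. subspace W \<and> dim W = d" W] W dimW by blast
  \<comment> \<open>For 0 and for \<open>top\<close> this quotient would be 0, so the value 1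
    excludes both.\<close>
  have "\<nu> / \<nu> = 1" using hausdorff_unit_ball[of ?S d] S d1 unfolding h by (simp add: \<nu>_def)
  then have \<nu>: "\<nu> \<noteq> 0" "\<nu> \<noteq> top" by (auto simp: divide_ennreal_def)
  have c: "ball_const = enn2real \<nu>" by (simp add: ball_const_def \<nu>_def)
  show "0 < ball_const" unfolding c using \<nu> by (simp add: enn2real_positive_iff less_top zero_less_iff_neq_zero)
  have "ennreal ball_const = \<nu>" unfolding c using \<nu> by (simp add: less_top)
  then show "hausdorff_raw d E = ennreal ball_const * hausdorff d E"
    using \<nu> unfolding h by (simp add: ennreal_times_divide mult.commute[of \<nu>] ennreal_mult_divide_eq)
qed

end

lemma ennreal_divide_leI:
  assumes "0 < N" "ennreal a \<le> ennreal N * b"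
  shows "ennreal (a / N) \<le> b"
proof (cases b)
  case (real x)
  then have "a \<le> N * x" using assms by (simp add: ennreal_mult[symmetric])
  then show ?thesis unfolding real using assms(1) by (intro ennreal_leI) (simp add: pos_divide_le_eq mult.commute)
qed simp

context doubling_measure
begin

text \<open>Quotient of the mass bound \<open>A1 * (c * r ^ d)\<close> for a ball and the lower
  density \<open>c / (10 ^ d * A1)\<close> on its good part, in units of
  \<open>r ^ d\<close>.\<close>

definition K0 :: real where "K0 = 10 ^ d * A1\<^sup>2"
definition lower_const :: real where "lower_const = 1 / (2 * A1\<^sup>2) / ball_const"
text \<open>Makes \<open>3 * K0 * \<eta>\<close> half of the lower regularity constant
  \<open>1 / (2 * A1\<^sup>2)\<close>, as the A-infinity estimate requires. It is also at most
  \<open>(1/2) ^ d\<close>, which makes bad radii at least halve.\<close>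

definition \<eta> :: real where "\<eta> = 1 / (12 * A1\<^sup>2 * K0)"

lemma lower_const_pos: "0 < lower_const"
  using A1_ge(4) ball_const_pos by (simp add: lower_const_def)

lemma K0_ge: "10 ^ d \<le> K0" "1 \<le> K0"
proof -
  have "1 \<le> A1\<^sup>2" using A1_ge(4) by (rule one_le_power)
  then have "10 ^ d * 1 \<le> 10 ^ d * A1\<^sup>2" by (intro mult_left_mono) auto
  then show "10 ^ d \<le> K0" by (simp add: K0_def)
  moreover have "(1::real) \<le> 10 ^ d" by (rule one_le_power) simp
  ultimately show "1 \<le> K0" by linarith
qed

lemma \<eta>_bounds: "0 < \<eta>" "\<eta> \<le> 1/12" "\<eta> \<le> (1/2) ^ d" "12 * A1\<^sup>2 * K0 * \<eta> = 1"
proof -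
  have A: "1 \<le> A1\<^sup>2" using A1_ge(4) by (rule one_le_power)
  have "0 < A1\<^sup>2" "0 < K0" using A K0_ge by linarith+
  then have pos: "0 < 12 * A1\<^sup>2 * K0" by (intro mult_pos_pos) simp_all
  show "0 < \<eta>" "12 * A1\<^sup>2 * K0 * \<eta> = 1" using pos by (auto simp: \<eta>_def)
  have "12 * 1 * K0 \<le> 12 * A1\<^sup>2 * K0" using A K0_ge by (intro mult_right_mono) auto
  then have ge: "12 \<le> 12 * A1\<^sup>2 * K0" "10 ^ d \<le> 12 * A1\<^sup>2 * K0" using K0_ge by linarith+
  show "\<eta> \<le> 1/12" unfolding \<eta>_def using ge(1) by (intro divide_left_mono) auto
  have "(2::real) ^ d \<le> 10 ^ d" by (intro power_mono) auto
  then have "1 / (12 * A1\<^sup>2 * K0) \<le> 1 / 2 ^ d" using ge(2) pos by (intro divide_left_mono) auto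
  then show "\<eta> \<le> (1/2) ^ d" by (simp add: \<eta>_def power_one_over)
qed

lemma \<Sigma>_borel: "\<Sigma> \<in> sets borel"
  by (rule borel_closed[OF closed_msupport[OF sets_mu]])

lemma emeasure_Int_support: "E \<in> sets borel \<Longrightarrow> emeasure \<mu> (\<Sigma> \<inter> E) = emeasure \<mu> E"
proof -
  assume E: "E \<in> sets borel"
  have "AE x in \<mu>. x \<in> \<Sigma>"
    using emeasure_compl_support \<Sigma>_borel by (intro AE_I[of _ _ "- \<Sigma>"]) auto
  then show ?thesis using E \<Sigma>_borel by (intro emeasure_eq_AE) auto
qed

context
  fixes C :: real
  assumes C: "carleson C" "0 \<le> C" "C \<le> C2" "A2 * C \<le> \<eta>"
begin

lemma good_set:
  assumes x0: "x0 \<in> \<Sigma>" and r: "0 < r"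
  obtains G c f X \<rho> where
    "G \<in> sets borel" "G \<subseteq> \<Sigma> \<inter> ball x0 r" "rigid f" "0 < c"
    "\<And>E. E \<in> sets borel \<Longrightarrow> E \<subseteq> G \<Longrightarrow> emeasure \<mu> E \<le> ennreal (A1 * c) * hausdorff_raw d E"
    "\<And>E. E \<in> sets borel \<Longrightarrow> E \<subseteq> G \<Longrightarrow> ennreal (c / (10 ^ d * A1)) * hausdorff_raw d E \<le> emeasure \<mu> E"
    "m x0 r \<le> A1 * (c * r ^ d)" "c * r ^ d \<le> A1 * m x0 r"
    "\<And>x y. x \<in> G \<Longrightarrow> y \<in> G \<Longrightarrow> \<exists>v\<in>f ` W. norm ((y - x) - v) \<le> dist x y / 2"
    "\<Sigma> \<inter> ball x0 r \<subseteq> G \<union> (\<Union>n::nat. ball (X n) (\<rho> n))" "\<And>n. X n \<in> \<Sigma>" "\<And>n. 0 \<le> \<rho> n"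
    "(\<Sum>n. ennreal (\<rho> n ^ d)) \<le> ennreal (\<eta> * r ^ d)"
    "(\<Sum>n. emeasure \<mu> (ball (X n) (\<rho> n))) \<le> ennreal (\<eta> * m x0 r)"
proof -
  obtain G c f X \<rho> where G: "G \<in> sets borel" "G \<subseteq> \<Sigma> \<inter> ball x0 r" and f: "rigid f" and c: "0 < c"
    and up: "\<And>x s. x \<in> G \<Longrightarrow> 0 < s \<Longrightarrow> s \<le> r \<Longrightarrow> m x s \<le> A1 * (c * s ^ d)"
    and lo: "\<And>x s. x \<in> G \<Longrightarrow> 0 < s \<Longrightarrow> s \<le> r \<Longrightarrow> c * s ^ d \<le> A1 * m x s"
    and mc: "m x0 r \<le> A1 * (c * r ^ d)" "c * r ^ d \<le> A1 * m x0 r"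
    and cone: "\<And>x y. x \<in> G \<Longrightarrow> y \<in> G \<Longrightarrow> \<exists>v\<in>W. norm ((y - x) - f v) \<le> dist x y / 2"
    and cov: "\<Sigma> \<inter> ball x0 r \<subseteq> G \<union> (\<Union>n::nat. ball (X n) (\<rho> n))" "\<And>n. X n \<in> \<Sigma>" "\<And>n. 0 \<le> \<rho> n"
    and sums: "(\<Sum>n. ennreal (\<rho> n ^ d)) \<le> ennreal (A2 * C * r ^ d)"
      "(\<Sum>n. emeasure \<mu> (ball (X n) (\<rho> n))) \<le> ennreal (A2 * C * m x0 r)"
    by (rule good_bad_decomposition[OF C(1-3) x0 r]) blast
  have A: "0 < A1" using A1_ge(4) by simp
  show thesis
  proof (rule that[OF G f c _ _ mc _ cov])
    fix E assume E: "E \<in> sets borel" "E \<subseteq> G"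
    show "emeasure \<mu> E \<le> ennreal (A1 * c) * hausdorff_raw d E"
      using E(2) up A c by (intro emeasure_le_hausdorff_raw[OF E(1) _ r]) (auto simp: mult.assoc)
    show "ennreal (c / (10 ^ d * A1)) * hausdorff_raw d E \<le> emeasure \<mu> E"
    proof (rule hausdorff_raw_le_emeasure[OF E(1) _ _ r])
      show "E \<subseteq> ball x0 r" using E(2) G(2) by blast
      show "0 \<le> c / (10 ^ d * A1)" using A c by simp
      fix x s assume x: "x \<in> E" "0 < s" "s \<le> r"
      have "c * s ^ d \<le> A1 * m x s" using lo[of x s] x E(2) by blast
      then show "c / (10 ^ d * A1) * (10 * s) ^ d \<le> m x s"
        using A by (simp add: power_mult_distrib pos_divide_le_eq mult.commute)
    qed
  next
    fix x y assume "x \<in> G" "y \<in> G"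
    then show "\<exists>v\<in>f ` W. norm ((y - x) - v) \<le> dist x y / 2" using cone by auto
  next
    show "(\<Sum>n. ennreal (\<rho> n ^ d)) \<le> ennreal (\<eta> * r ^ d)"
      by (rule order_trans[OF sums(1) ennreal_leI[OF mult_right_mono[OF C(4)]]]) (use r in simp)
    show "(\<Sum>n. emeasure \<mu> (ball (X n) (\<rho> n))) \<le> ennreal (\<eta> * m x0 r)"
      by (rule order_trans[OF sums(2) ennreal_leI[OF mult_right_mono[OF C(4)]]]) simp
  qed
qed

section \<open>Upper regularity of the support\<close>

lemma hausdorff_raw_good:
  assumes c: "0 < c" and r: "0 < r" and e: "0 \<le> e"
    and lo: "ennreal (c / (10 ^ d * A1)) * hausdorff_raw d E \<le> ennreal (e * M)"
    and M: "0 \<le> M" "M \<le> A1 * (c * r ^ d)"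
  shows "hausdorff_raw d (E :: 'a set) \<le> ennreal (e * K0 * r ^ d)"
proof -
  have A: "0 < A1" using A1_ge(4) by simp
  define q where "q = c / (10 ^ d * A1)"
  have q: "0 < q" using A c by (simp add: q_def)
  have "hausdorff_raw d E \<le> ennreal (e * M / q)"
    using lo e M q unfolding q_def[symmetric] by (intro ennreal_le_divideI) auto
  also have "\<dots> \<le> ennreal (e * (A1 * (c * r ^ d)) / q)"
    using M e q by (intro ennreal_leI divide_right_mono mult_left_mono) auto
  also have "e * (A1 * (c * r ^ d)) / q = e * K0 * r ^ d"
    using A c by (simp add: q_def K0_def power2_eq_square)
  finally show ?thesis .
qed

text \<open>A single term of the series is already at most \<open>(r / 2) ^ d\<close>. The halving
  of radii is what makes the induction on scales in \<open>hausdorff_delta_upper\<close>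
  work.\<close>

lemma bad_radius:
  assumes r: "0 < r" and \<rho>: "\<And>n. 0 \<le> \<rho> n" "(\<Sum>n. ennreal (\<rho> n ^ d)) \<le> ennreal (\<eta> * r ^ d)"
  shows "\<rho> n \<le> r / 2"
proof -
  have "ennreal (\<rho> n ^ d) = (\<Sum>i\<in>{n}. ennreal (\<rho> i ^ d))" by simp
  also have "\<dots> \<le> (\<Sum>i. ennreal (\<rho> i ^ d))" by (intro sum_le_suminf) auto
  also have "\<dots> \<le> ennreal ((1/2) ^ d * r ^ d)"
    using \<rho>(2) mult_right_mono[OF \<eta>_bounds(3), of "r ^ d"] r by (auto intro: order_trans ennreal_leI)
  finally have "\<rho> n ^ d \<le> (r / 2) ^ d" using r by (simp add: power_divide)
  then show ?thesis using power_mono_iff[of "\<rho> n" "r / 2" d] \<rho>(1)[of n] r d1 by auto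
qed

text \<open>At fixed mesh \<open>\<delta>\<close> a ball of radius at most
  \<open>\<delta> / 2\<close> is its own cover, which starts the induction without any prior
  finiteness of \<open>hausdorff_raw\<close>. The constant reproduces itself: the good part takes
  \<open>K0\<close>, and the bad balls take \<open>2 * K0 * \<eta>\<close>, which is at most
  \<open>K0\<close>.\<close>

lemma hausdorff_delta_upper:
  assumes \<delta>: "0 < \<delta>"
  shows "x \<in> \<Sigma> \<Longrightarrow> 0 < r \<Longrightarrow> r \<le> 2 ^ n * (\<delta> / 2) \<Longrightarrow>
    hausdorff_delta d \<delta> (\<Sigma> \<inter> ball x r) \<le> ennreal (2 * K0 * r ^ d)"
proof (induction n arbitrary: x r)
  case 0
  have diam: "diameter (\<Sigma> \<inter> ball x r) \<le> 2 * r"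
  proof (rule diameter_le)
    fix y z assume "y \<in> \<Sigma> \<inter> ball x r" "z \<in> \<Sigma> \<inter> ball x r"
    then show "norm (y - z) \<le> 2 * r"
      using dist_triangle[of y z x] by (simp add: dist_norm norm_minus_commute)
  qed (use 0 in simp)
  have "hausdorff_delta d \<delta> (\<Sigma> \<inter> ball x r) \<le> (\<Sum>i\<in>{()}. ennreal (diameter (\<Sigma> \<inter> ball x r)) ^ d)"
    using diam 0 \<delta> by (intro hausdorff_delta_finite_cover[OF d1]) (auto intro: bounded_subset[OF bounded_ball])
  also have "\<dots> \<le> ennreal (2 * r) ^ d" using diam by (auto intro: power_mono ennreal_leI)
  also have "\<dots> = ennreal ((2 * r) ^ d)" using 0 by (subst ennreal_power) auto
  also have "\<dots> \<le> ennreal (2 * K0 * r ^ d)"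
  proof (rule ennreal_leI)
    have "(2::real) ^ d \<le> 10 ^ d" by (intro power_mono) auto
    then have "2 ^ d \<le> 2 * K0" using K0_ge by linarith
    then show "(2 * r) ^ d \<le> 2 * K0 * r ^ d" using 0 by (simp add: power_mult_distrib)
  qed
  finally show ?case .
next
  case (Suc n)
  note x0 = Suc.prems(1) and r = Suc.prems(2)
  obtain G c f X \<rho> where G: "G \<in> sets borel" "G \<subseteq> \<Sigma> \<inter> ball x r" "0 < c"
    and lo: "\<And>E. E \<in> sets borel \<Longrightarrow> E \<subseteq> G \<Longrightarrow> ennreal (c / (10 ^ d * A1)) * hausdorff_raw d E \<le> emeasure \<mu> E"
    and mc: "m x r \<le> A1 * (c * r ^ d)"
    and cov: "\<Sigma> \<inter> ball x r \<subseteq> G \<union> (\<Union>n::nat. ball (X n) (\<rho> n))" "\<And>n. X n \<in> \<Sigma>" "\<And>n. 0 \<le> \<rho> n"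
    and sum: "(\<Sum>n. ennreal (\<rho> n ^ d)) \<le> ennreal (\<eta> * r ^ d)"
    by (rule good_set[OF x0 r]) blast
  have "emeasure \<mu> G \<le> ennreal (1 * m x r)"
    using G(2) emeasure_mono[of G "ball x r" \<mu>] by (simp add: emeasure_ball)
  with lo[OF G(1) order_refl] have "ennreal (c / (10 ^ d * A1)) * hausdorff_raw d G \<le> ennreal (1 * m x r)"
    by (rule order_trans)
  from hausdorff_raw_good[OF G(3) r _ this _ mc] have Gle: "hausdorff_raw d G \<le> ennreal (K0 * r ^ d)"
    by simp
  let ?E = "\<Sigma> \<inter> ball x r"
  have "hausdorff_delta d \<delta> ?E \<le> hausdorff_delta d \<delta> (?E \<inter> G) + (\<Sum>n. hausdorff_delta d \<delta> (?E \<inter> ball (X n) (\<rho> n)))"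
    by (rule hausdorff_delta_cover_le[OF cov(1)])
  also have "\<dots> \<le> ennreal (K0 * r ^ d) + (\<Sum>n. ennreal (2 * K0) * ennreal (\<rho> n ^ d))"
  proof (intro add_mono suminf_le)
    have "hausdorff_delta d \<delta> (?E \<inter> G) \<le> hausdorff_raw d G"
      by (rule order_trans[OF hausdorff_delta_mono hausdorff_delta_le_raw[OF \<delta>]]) auto
    then show "hausdorff_delta d \<delta> (?E \<inter> G) \<le> ennreal (K0 * r ^ d)" using Gle by simp
    fix n
    show "hausdorff_delta d \<delta> (?E \<inter> ball (X n) (\<rho> n)) \<le> ennreal (2 * K0) * ennreal (\<rho> n ^ d)"
    proof (cases "\<rho> n = 0")
      case True
      have "hausdorff_delta d \<delta> ({} :: 'a set) \<le> hausdorff_raw d ({} :: 'a set)"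
        by (rule hausdorff_delta_le_raw[OF \<delta>])
      then show ?thesis using True by (simp add: hausdorff_raw_empty[OF d1])
    next
      case False
      have \<rho>: "0 < \<rho> n" "\<rho> n \<le> r / 2" using cov(3)[of n] False bad_radius[OF r cov(3) sum] by auto
      have "hausdorff_delta d \<delta> (?E \<inter> ball (X n) (\<rho> n)) \<le> hausdorff_delta d \<delta> (\<Sigma> \<inter> ball (X n) (\<rho> n))"
        by (intro hausdorff_delta_mono) auto
      also have "\<dots> \<le> ennreal (2 * K0 * \<rho> n ^ d)"
        using \<rho> Suc.prems(3) by (intro Suc.IH cov) auto
      finally show ?thesis using K0_ge \<rho> by (simp add: ennreal_mult)
    qed
  qed auto
  also have "\<dots> \<le> ennreal (K0 * r ^ d) + ennreal (2 * K0) * ennreal (\<eta> * r ^ d)"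
    using sum by (auto intro: add_left_mono mult_left_mono)
  also have "\<dots> = ennreal (K0 * r ^ d + 2 * K0 * (\<eta> * r ^ d))"
    using K0_ge \<eta>_bounds(1) r by (simp add: ennreal_mult[symmetric] ennreal_plus[symmetric] del: ennreal_plus)
  also have "\<dots> \<le> ennreal (2 * K0 * r ^ d)"
  proof (rule ennreal_leI)
    have "(2 * \<eta>) * (K0 * r ^ d) \<le> 1 * (K0 * r ^ d)"
      using \<eta>_bounds(2) K0_ge r by (intro mult_right_mono) auto
    then show "K0 * r ^ d + 2 * K0 * (\<eta> * r ^ d) \<le> 2 * K0 * r ^ d" by (simp add: mult_ac)
  qed
  finally show ?case .
qed

lemma hausdorff_raw_upper:
  assumes x: "x \<in> \<Sigma>" and r: "0 < r"
  shows "hausdorff_raw d (\<Sigma> \<inter> ball x r) \<le> ennreal (2 * K0 * r ^ d)"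
  unfolding hausdorff_raw_def
proof (rule SUP_least)
  fix \<delta> :: real assume "\<delta> \<in> {0<..}"
  then have \<delta>: "0 < \<delta>" by simp
  obtain n where "2 * r / \<delta> < 2 ^ n" using real_arch_pow[of 2 "2 * r / \<delta>"] by auto
  then have "r \<le> 2 ^ n * (\<delta> / 2)" using \<delta> by (simp add: field_simps)
  then show "hausdorff_delta d \<delta> (\<Sigma> \<inter> ball x r) \<le> ennreal (2 * K0 * r ^ d)"
    by (rule hausdorff_delta_upper[OF \<delta> x r])
qed

lemma hausdorff_raw_bad_le:
  assumes X: "\<And>n. X n \<in> \<Sigma>" and \<rho>: "\<And>n::nat. 0 \<le> \<rho> n"
    and sum: "(\<Sum>n. ennreal (\<rho> n ^ d)) \<le> ennreal (\<eta> * s)" and s: "0 \<le> s" and K: "0 \<le> K"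
    and E: "\<And>x r. x \<in> \<Sigma> \<Longrightarrow> 0 < r \<Longrightarrow> hausdorff_raw d (E \<inter> ball x r) \<le> ennreal (K * r ^ d)"
  shows "(\<Sum>n. hausdorff_raw d (E \<inter> ball (X n) (\<rho> n))) \<le> ennreal (K * \<eta> * s)"
proof -
  have "(\<Sum>n. hausdorff_raw d (E \<inter> ball (X n) (\<rho> n))) \<le> (\<Sum>n. ennreal K * ennreal (\<rho> n ^ d))"
  proof (rule suminf_le)
    fix n
    show "hausdorff_raw d (E \<inter> ball (X n) (\<rho> n)) \<le> ennreal K * ennreal (\<rho> n ^ d)"
    proof (cases "\<rho> n = 0")
      case False
      then have "0 < \<rho> n" using \<rho>[of n] by simp
      then show ?thesis using E[OF X] K by (simp add: ennreal_mult)
    qed (simp add: hausdorff_raw_empty[OF d1])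
  qed auto
  also have "\<dots> \<le> ennreal K * ennreal (\<eta> * s)" using sum by (auto intro: mult_left_mono)
  finally show ?thesis using K s \<eta>_bounds(1) by (simp add: ennreal_mult mult.assoc)
qed

section \<open>Lower regularity with large pieces in a cone\<close>

lemma hausdorff_raw_lower:
  assumes x: "x \<in> \<Sigma>" and r: "0 < r"
  obtains G V where "G \<in> sets borel" "G \<subseteq> \<Sigma> \<inter> ball x r" "ennreal (r ^ d / (2 * A1\<^sup>2)) \<le> hausdorff_raw d G"
    "subspace V" "dim V = d" "\<And>x y. x \<in> G \<Longrightarrow> y \<in> G \<Longrightarrow> \<exists>v\<in>V. norm ((y - x) - v) \<le> dist x y / 2"
proof -
  obtain G c f X \<rho> where G: "G \<in> sets borel" "G \<subseteq> \<Sigma> \<inter> ball x r" and f: "rigid f" and c: "0 < c"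
    and up: "\<And>E. E \<in> sets borel \<Longrightarrow> E \<subseteq> G \<Longrightarrow> emeasure \<mu> E \<le> ennreal (A1 * c) * hausdorff_raw d E"
    and mc: "c * r ^ d \<le> A1 * m x r"
    and cone: "\<And>x y. x \<in> G \<Longrightarrow> y \<in> G \<Longrightarrow> \<exists>v\<in>f ` W. norm ((y - x) - v) \<le> dist x y / 2"
    and cov: "\<Sigma> \<inter> ball x r \<subseteq> G \<union> (\<Union>n::nat. ball (X n) (\<rho> n))"
    and sum: "(\<Sum>n. emeasure \<mu> (ball (X n) (\<rho> n))) \<le> ennreal (\<eta> * m x r)"
    by (rule good_set[OF x r]) blast
  have A: "0 < A1" using A1_ge(4) by simp
  show thesis
  proof (rule that[OF G _ rigid_image_subspace[OF f] _ cone])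
    show "dim (f ` W) = d"
    proof -
      have "inj_on f W"
        by (rule inj_onI) (metis rigid_dist[OF f] dist_eq_0_iff)
      then have "inj_on f (span W)" using W by (metis span_eq_iff)
      then show ?thesis using f dimW dim_image_eq[of f W] by (simp add: rigid_def)
    qed
    let ?E = "\<Sigma> \<inter> ball x r"
    have "ennreal (m x r) = emeasure \<mu> ?E" by (simp add: emeasure_Int_support emeasure_ball)
    also have "\<dots> \<le> emeasure \<mu> (?E \<inter> G) + (\<Sum>n. emeasure \<mu> (?E \<inter> ball (X n) (\<rho> n)))"
      by (rule emeasure_cover_le[OF _ _ _ cov]) (use G(1) \<Sigma>_borel in simp_all)
    \<comment> \<open>The bad balls carry a fraction \<open>\<eta>\<close> of the mass, so
      \<open>G\<close> keeps more than half of it; the density comparison on \<open>G\<close>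
      converts this into Hausdorff measure.\<close>
    also have "\<dots> \<le> emeasure \<mu> G + ennreal (\<eta> * m x r)"
    proof (rule add_mono)
      show "emeasure \<mu> (?E \<inter> G) \<le> emeasure \<mu> G" using G(1) by (intro emeasure_mono) auto
      have "(\<Sum>n. emeasure \<mu> (?E \<inter> ball (X n) (\<rho> n))) \<le> (\<Sum>n. emeasure \<mu> (ball (X n) (\<rho> n)))"
        by (intro suminf_le emeasure_mono) auto
      then show "(\<Sum>n. emeasure \<mu> (?E \<inter> ball (X n) (\<rho> n))) \<le> ennreal (\<eta> * m x r)" using sum by simp
    qed
    also have "\<dots> \<le> ennreal (A1 * c) * hausdorff_raw d G + ennreal (m x r / 2)"
    proof (intro add_mono ennreal_leI up[OF G(1) order_refl])
      have "\<eta> * m x r \<le> 1/12 * m x r" using \<eta>_bounds(2) by (rule mult_right_mono) simp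
      then show "\<eta> * m x r \<le> m x r / 2" using measure_nonneg[of \<mu> "ball x r"] by linarith
    qed
    finally have le: "ennreal (m x r) \<le> ennreal (A1 * c) * hausdorff_raw d G + ennreal (m x r / 2)" .
    show "ennreal (r ^ d / (2 * A1\<^sup>2)) \<le> hausdorff_raw d G"
    proof (cases "hausdorff_raw d G")
      case (real h)
      then have "ennreal (A1 * c) * hausdorff_raw d G + ennreal (m x r / 2) = ennreal (A1 * c * h + m x r / 2)"
        using A c by (simp add: ennreal_mult)
      moreover have "0 \<le> A1 * c * h + m x r / 2" using A c real by simp
      ultimately have "m x r \<le> A1 * c * h + m x r / 2" using le by (metis ennreal_le_iff)
      then have "m x r \<le> 2 * (A1 * c * h)" by linarith
      then have "A1 * m x r \<le> A1 * (2 * (A1 * c * h))" using A by (intro mult_left_mono) simp_all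
      then have "c * r ^ d \<le> A1 * (2 * (A1 * c * h))" using mc by linarith
      then have "c * r ^ d \<le> c * (2 * A1\<^sup>2 * h)" by (simp add: power2_eq_square mult_ac)
      then have "r ^ d \<le> 2 * A1\<^sup>2 * h" using c by simp
      then show ?thesis
        unfolding real using A by (intro ennreal_leI) (simp add: pos_divide_le_eq mult_ac)
    qed simp
  qed
qed

text \<open>The density comparison makes the good part of \<open>N\<close> null in every ball. The
  rest lies in bad balls whose \<open>\<rho> n ^ d\<close> sum to at most half of
  \<open>r ^ d\<close>, so each generation halves the bound; upper regularity provides a finite one
  to begin with.\<close>

lemma hausdorff_raw_null:
  assumes N: "N \<in> sets borel" "N \<subseteq> \<Sigma>" "emeasure \<mu> N = 0"
  shows "hausdorff_raw d N = 0"
proof -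
  have decay: "x \<in> \<Sigma> \<Longrightarrow> 0 < r \<Longrightarrow> hausdorff_raw d (N \<inter> ball x r) \<le> ennreal (2 * K0 * (1/2) ^ j * r ^ d)" for x r j
  proof (induction j arbitrary: x r)
    case 0
    have "hausdorff_raw d (N \<inter> ball x r) \<le> hausdorff_raw d (\<Sigma> \<inter> ball x r)"
      using N(2) by (intro hausdorff_raw_mono) auto
    then show ?case using hausdorff_raw_upper[OF 0] by simp
  next
    case (Suc j)
    obtain G c f X \<rho> where G: "G \<in> sets borel" "G \<subseteq> \<Sigma> \<inter> ball x r" "0 < c"
      and lo: "\<And>E. E \<in> sets borel \<Longrightarrow> E \<subseteq> G \<Longrightarrow> ennreal (c / (10 ^ d * A1)) * hausdorff_raw d E \<le> emeasure \<mu> E"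
      and cov: "\<Sigma> \<inter> ball x r \<subseteq> G \<union> (\<Union>n::nat. ball (X n) (\<rho> n))" "\<And>n. X n \<in> \<Sigma>" "\<And>n. 0 \<le> \<rho> n"
      and sum: "(\<Sum>n. ennreal (\<rho> n ^ d)) \<le> ennreal (\<eta> * r ^ d)"
      by (rule good_set[OF Suc.prems]) blast
    let ?E = "N \<inter> ball x r"
    have NG: "?E \<inter> G \<in> sets borel" using N(1) G(1) by simp
    have "emeasure \<mu> (?E \<inter> G) \<le> emeasure \<mu> N" using N(1) by (intro emeasure_mono) auto
    then have "emeasure \<mu> (?E \<inter> G) = 0" using N(3) by simp
    then have "ennreal (c / (10 ^ d * A1)) * hausdorff_raw d (?E \<inter> G) \<le> 0"
      using lo[OF NG] by simp
    then have G0: "hausdorff_raw d (?E \<inter> G) = 0" using G(3) A1_ge(4) by auto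
    have "hausdorff_raw d ?E \<le> hausdorff_raw d (?E \<inter> G) + (\<Sum>n. hausdorff_raw d (?E \<inter> ball (X n) (\<rho> n)))"
      by (rule hausdorff_raw_cover_le[OF order_trans[OF _ cov(1)]]) (use N(2) in blast)
    also have "\<dots> \<le> (\<Sum>n. hausdorff_raw d (N \<inter> ball (X n) (\<rho> n)))"
      unfolding G0 by (auto intro!: suminf_le hausdorff_raw_mono)
    also have "\<dots> \<le> ennreal (2 * K0 * (1/2) ^ j * \<eta> * r ^ d)"
      using K0_ge Suc.prems(2) by (intro hausdorff_raw_bad_le[OF cov(2,3) sum]) (auto intro: Suc.IH)
    also have "\<dots> \<le> ennreal (2 * K0 * (1/2) ^ Suc j * r ^ d)"
    proof (rule ennreal_leI)
      have "\<eta> * (2 * K0 * (1/2) ^ j * r ^ d) \<le> (1/2) * (2 * K0 * (1/2) ^ j * r ^ d)"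
        using \<eta>_bounds(2) K0_ge Suc.prems(2) by (intro mult_right_mono) auto
      then show "2 * K0 * (1/2) ^ j * \<eta> * r ^ d \<le> 2 * K0 * (1/2) ^ Suc j * r ^ d" by (simp add: mult_ac)
    qed
    finally show ?case .
  qed
  have zero: "hausdorff_raw d (N \<inter> ball x r) = 0" if "x \<in> \<Sigma>" "0 < r" for x r
  proof (rule ennreal_geometric_decay)
    show "hausdorff_raw d (N \<inter> ball x r) \<le> ennreal (2 * K0 * r ^ d * (1/2) ^ j)" for j
      using decay[OF that, of j] by (simp add: mult_ac)
  qed
  show ?thesis
  proof (cases "\<Sigma> = {}")
    case True
    then show ?thesis using N(2) by (simp add: hausdorff_raw_empty[OF d1])
  next
    case False
    then obtain x where x: "x \<in> \<Sigma>" by auto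
    have "hausdorff_raw d N \<le> (\<Sum>n. hausdorff_raw d (N \<inter> ball x (real (Suc n))))"
      using hausdorff_raw_UN[of d "\<lambda>n. N \<inter> ball x (real (Suc n))"] unfolding UN_Int_balls .
    also have "\<dots> = 0" using zero[OF x] by (simp del: of_nat_Suc)
    finally show ?thesis by simp
  qed
qed

text \<open>The same iteration with masses of balls instead of powers of radii; it needs the other
  of the two sums that the decomposition controls.\<close>

lemma emeasure_null:
  assumes N: "N \<in> sets borel" "N \<subseteq> \<Sigma>" "hausdorff_raw d N = 0"
  shows "emeasure \<mu> N = 0"
proof -
  have decay: "x \<in> \<Sigma> \<Longrightarrow> 0 < r \<Longrightarrow> emeasure \<mu> (N \<inter> ball x r) \<le> ennreal ((1/2) ^ j) * emeasure \<mu> (ball x r)" for x r j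
  proof (induction j arbitrary: x r)
    case 0
    then show ?case using emeasure_mono[of "N \<inter> ball x r" "ball x r" \<mu>] by simp
  next
    case (Suc j)
    obtain G c f X \<rho> where G: "G \<in> sets borel" "G \<subseteq> \<Sigma> \<inter> ball x r" "0 < c"
      and up: "\<And>E. E \<in> sets borel \<Longrightarrow> E \<subseteq> G \<Longrightarrow> emeasure \<mu> E \<le> ennreal (A1 * c) * hausdorff_raw d E"
      and cov: "\<Sigma> \<inter> ball x r \<subseteq> G \<union> (\<Union>n::nat. ball (X n) (\<rho> n))" "\<And>n. X n \<in> \<Sigma>" "\<And>n. 0 \<le> \<rho> n"
      and sum: "(\<Sum>n. emeasure \<mu> (ball (X n) (\<rho> n))) \<le> ennreal (\<eta> * m x r)"
      by (rule good_set[OF Suc.prems]) blast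
    let ?E = "N \<inter> ball x r"
    have NG: "?E \<inter> G \<in> sets borel" using N(1) G(1) by simp
    have "hausdorff_raw d (?E \<inter> G) = 0"
      using hausdorff_raw_mono[of "?E \<inter> G" N d] N by auto
    then have G0: "emeasure \<mu> (?E \<inter> G) = 0" using up[OF NG] by simp
    have "emeasure \<mu> ?E \<le> emeasure \<mu> (?E \<inter> G) + (\<Sum>n. emeasure \<mu> (?E \<inter> ball (X n) (\<rho> n)))"
      by (rule emeasure_cover_le[OF _ _ _ order_trans[OF _ cov(1)]]) (use N G(1) in auto)
    also have "\<dots> \<le> (\<Sum>n. ennreal ((1/2) ^ j) * emeasure \<mu> (ball (X n) (\<rho> n)))"
      unfolding G0 add_0
    proof (rule suminf_le)
      fix n
      show "emeasure \<mu> (?E \<inter> ball (X n) (\<rho> n)) \<le> ennreal ((1/2) ^ j) * emeasure \<mu> (ball (X n) (\<rho> n))"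
      proof (cases "\<rho> n = 0")
        case False
        then have "0 < \<rho> n" using cov(3)[of n] by simp
        then have "emeasure \<mu> (N \<inter> ball (X n) (\<rho> n)) \<le> ennreal ((1/2) ^ j) * emeasure \<mu> (ball (X n) (\<rho> n))"
          by (rule Suc.IH[OF cov(2)])
        moreover have "emeasure \<mu> (?E \<inter> ball (X n) (\<rho> n)) \<le> emeasure \<mu> (N \<inter> ball (X n) (\<rho> n))"
          using N(1) by (intro emeasure_mono) auto
        ultimately show ?thesis by (rule order_trans[rotated])
      qed simp
    qed auto
    also have "\<dots> \<le> ennreal ((1/2) ^ j) * ennreal (\<eta> * m x r)"
      using sum by (auto intro: mult_left_mono)
    also have "\<dots> \<le> ennreal ((1/2) ^ j) * ennreal (1/2 * m x r)"
      using \<eta>_bounds(2) by (intro mult_left_mono ennreal_leI mult_right_mono) auto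
    also have "\<dots> = ennreal ((1/2) ^ Suc j) * emeasure \<mu> (ball x r)"
      by (simp add: emeasure_ball ennreal_mult[symmetric])
    finally show ?case .
  qed
  have zero: "emeasure \<mu> (N \<inter> ball x r) = 0" if "x \<in> \<Sigma>" "0 < r" for x r
  proof (rule ennreal_geometric_decay)
    show "emeasure \<mu> (N \<inter> ball x r) \<le> ennreal (m x r * (1/2) ^ j)" for j
      using decay[OF that, of j] by (simp add: emeasure_ball ennreal_mult[symmetric] mult.commute)
  qed
  show ?thesis
  proof (cases "\<Sigma> = {}")
    case False
    then obtain x where x: "x \<in> \<Sigma>" by auto
    have "range (\<lambda>n. N \<inter> ball x (real (Suc n))) \<subseteq> sets \<mu>" using N(1) by auto
    from emeasure_subadditive_countably[OF this]
    have "emeasure \<mu> N \<le> (\<Sum>n. emeasure \<mu> (N \<inter> ball x (real (Suc n))))"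
      unfolding UN_Int_balls .
    also have "\<dots> = 0" using zero[OF x] by (simp del: of_nat_Suc)
    finally show ?thesis by simp
  qed (use N(2) in simp)
qed

text \<open>On the good part the small mass of \<open>E\<close> bounds its Hausdorff measure; on the
  bad balls upper regularity suffices, whatever \<open>E\<close> is. Together they stay below half
  of the lower regularity bound.\<close>

lemma hausdorff_raw_A_infinity:
  assumes x: "x \<in> \<Sigma>" and r: "0 < r" and E: "E \<in> sets borel" "E \<subseteq> ball x r"
    and small: "emeasure \<mu> E \<le> ennreal \<eta> * emeasure \<mu> (ball x r)"
  shows "hausdorff_raw d (\<Sigma> \<inter> E) \<le> ennreal (1/2) * hausdorff_raw d (\<Sigma> \<inter> ball x r)"
proof -
  obtain G c f X \<rho> where G: "G \<in> sets borel" "G \<subseteq> \<Sigma> \<inter> ball x r" "0 < c"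
    and lo: "\<And>E. E \<in> sets borel \<Longrightarrow> E \<subseteq> G \<Longrightarrow> ennreal (c / (10 ^ d * A1)) * hausdorff_raw d E \<le> emeasure \<mu> E"
    and mc: "m x r \<le> A1 * (c * r ^ d)"
    and cov: "\<Sigma> \<inter> ball x r \<subseteq> G \<union> (\<Union>n::nat. ball (X n) (\<rho> n))" "\<And>n. X n \<in> \<Sigma>" "\<And>n. 0 \<le> \<rho> n"
    and sum: "(\<Sum>n. ennreal (\<rho> n ^ d)) \<le> ennreal (\<eta> * r ^ d)"
    by (rule good_set[OF x r]) blast
  let ?E = "\<Sigma> \<inter> E"
  have EG: "?E \<inter> G \<in> sets borel" using E(1) G(1) \<Sigma>_borel by (intro sets.Int)
  have "emeasure \<mu> (?E \<inter> G) \<le> emeasure \<mu> E" using E(1) by (intro emeasure_mono) auto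
  also have "\<dots> \<le> ennreal (\<eta> * m x r)" using small \<eta>_bounds(1) by (simp add: emeasure_ball ennreal_mult)
  finally have "ennreal (c / (10 ^ d * A1)) * hausdorff_raw d (?E \<inter> G) \<le> ennreal (\<eta> * m x r)"
    using lo[OF EG] by (auto intro: order_trans)
  then have 1: "hausdorff_raw d (?E \<inter> G) \<le> ennreal (\<eta> * K0 * r ^ d)"
    using \<eta>_bounds(1) mc by (intro hausdorff_raw_good[OF G(3) r]) auto
  have 2: "(\<Sum>n. hausdorff_raw d (?E \<inter> ball (X n) (\<rho> n))) \<le> ennreal (2 * K0 * \<eta> * r ^ d)"
  proof (rule hausdorff_raw_bad_le[OF cov(2,3) sum])
    fix y s assume "y \<in> \<Sigma>" "0 < (s::real)"
    then show "hausdorff_raw d (?E \<inter> ball y s) \<le> ennreal (2 * K0 * s ^ d)"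
      using hausdorff_raw_mono[of "?E \<inter> ball y s" "\<Sigma> \<inter> ball y s" d] hausdorff_raw_upper[of y s]
      by (auto intro: order_trans)
  qed (use r K0_ge in auto)
  have "hausdorff_raw d ?E \<le> hausdorff_raw d (?E \<inter> G) + (\<Sum>n. hausdorff_raw d (?E \<inter> ball (X n) (\<rho> n)))"
    by (rule hausdorff_raw_cover_le[OF order_trans[OF _ cov(1)]]) (use E(2) in blast)
  also have "\<dots> \<le> ennreal (\<eta> * K0 * r ^ d) + ennreal (2 * K0 * \<eta> * r ^ d)" using 1 2 by (rule add_mono)
  also have "\<dots> = ennreal (\<eta> * K0 * r ^ d + 2 * K0 * \<eta> * r ^ d)"
    using \<eta>_bounds(1) K0_ge r by (simp add: ennreal_plus[symmetric] del: ennreal_plus)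
  also have "\<eta> * K0 * r ^ d + 2 * K0 * \<eta> * r ^ d = 1/2 * (r ^ d / (2 * A1\<^sup>2))"
    using \<eta>_bounds(4) A1_ge(4) by (simp add: field_simps)
  also have "ennreal (1/2 * (r ^ d / (2 * A1\<^sup>2))) = ennreal (1/2) * ennreal (r ^ d / (2 * A1\<^sup>2))"
    using r by (intro ennreal_mult) auto
  also have "\<dots> \<le> ennreal (1/2) * hausdorff_raw d (\<Sigma> \<inter> ball x r)"
  proof (rule mult_left_mono)
    obtain G' V where "G' \<subseteq> \<Sigma> \<inter> ball x r" "ennreal (r ^ d / (2 * A1\<^sup>2)) \<le> hausdorff_raw d G'"
      by (rule hausdorff_raw_lower[OF x r])
    then show "ennreal (r ^ d / (2 * A1\<^sup>2)) \<le> hausdorff_raw d (\<Sigma> \<inter> ball x r)"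
      using hausdorff_raw_mono by (meson order_trans)
  qed simp
  finally show ?thesis .
qed

section \<open>Normalized regularity, Lipschitz graphs and uniform rectifiability\<close>

lemma hausdorff_lower:
  assumes x: "x \<in> \<Sigma>" and r: "0 < r"
  obtains G V where "G \<in> sets borel" "G \<subseteq> \<Sigma> \<inter> ball x r" "ennreal (lower_const * r ^ d) \<le> hausdorff d G"
    "subspace V" "dim V = d" "\<And>x y. x \<in> G \<Longrightarrow> y \<in> G \<Longrightarrow> \<exists>v\<in>V. norm ((y - x) - v) \<le> dist x y / 2"
proof -
  obtain G V where G: "G \<in> sets borel" "G \<subseteq> \<Sigma> \<inter> ball x r" "ennreal (r ^ d / (2 * A1\<^sup>2)) \<le> hausdorff_raw d G"
    and V: "subspace V" "dim V = d" "\<And>x y. x \<in> G \<Longrightarrow> y \<in> G \<Longrightarrow> \<exists>v\<in>V. norm ((y - x) - v) \<le> dist x y / 2"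
    by (rule hausdorff_raw_lower[OF x r]) blast
  have "ennreal (lower_const * r ^ d) \<le> hausdorff d G"
    using ennreal_divide_leI[OF ball_const_pos G(3)[unfolded hausdorff_raw_eq]] by (simp add: lower_const_def)
  then show thesis using that G V by blast
qed

lemma big_pieces: "big_pieces_lipschitz_graphs d \<Sigma>"
proof -
  show ?thesis
    unfolding big_pieces_lipschitz_graphs_def
  proof (rule exI[of _ lower_const], intro exI[of _ "2 * real DIM('a)"] conjI ballI allI impI)
    fix x r assume x: "x \<in> \<Sigma>" and r: "(0::real) < r"
    obtain G V where G: "G \<in> sets borel" "G \<subseteq> \<Sigma> \<inter> ball x r" "ennreal (lower_const * r ^ d) \<le> hausdorff d G"
      and V: "subspace V" "dim V = d"
        "\<And>x y. x \<in> G \<Longrightarrow> y \<in> G \<Longrightarrow> \<exists>v\<in>V. norm ((y - x) - v) \<le> dist x y / 2"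
      by (rule hausdorff_lower[OF x r]) blast
    obtain F where F: "lipschitz_graph (2 * real DIM('a)) d F" "G \<subseteq> F"
      by (rule lipschitz_graph_of_cone[OF V])
    show "\<exists>A G. A \<in> sets borel \<and> A \<subseteq> \<Sigma> \<inter> ball x r \<and>
        ennreal (lower_const * r ^ d) \<le> hausdorff d A \<and> lipschitz_graph (2 * real DIM('a)) d G \<and> A \<subseteq> G"
      using G F by blast
  qed (use lower_const_pos in auto)
qed

lemma ahlfors: "ahlfors_regular d \<Sigma>"
proof -
  define c where "c = 2 * K0 / ball_const"
  have c: "0 < c" using K0_ge ball_const_pos by (simp add: c_def)
  define b where "b = inverse lower_const"
  have b: "0 < b" using lower_const_pos by (simp add: b_def)
  show ?thesis
    unfolding ahlfors_regular_def
  \<comment> \<open>One constant has to serve both bounds: the inverse of \<open>b\<close> is the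
    lower one and \<open>c\<close> the upper one, so their sum works for both.\<close>
  proof (intro exI[of _ "b + c"] conjI ballI allI impI)
    fix x r assume x: "x \<in> \<Sigma>" and r: "(0::real) < r"
    obtain G V where G: "G \<subseteq> \<Sigma> \<inter> ball x r" "ennreal (lower_const * r ^ d) \<le> hausdorff d G"
      by (rule hausdorff_lower[OF x r])
    have "inverse (b + c) \<le> inverse b" using b c by (intro le_imp_inverse_le) auto
    then have "inverse (b + c) * r ^ d \<le> lower_const * r ^ d" using r by (intro mult_right_mono) (auto simp: b_def)
    then have "ennreal (inverse (b + c) * r ^ d) \<le> hausdorff d G" using G(2) by (meson ennreal_leI order_trans)
    also have "\<dots> \<le> hausdorff d (\<Sigma> \<inter> ball x r)"
      unfolding hausdorff_def by (intro divide_right_mono_ennreal hausdorff_raw_mono G(1))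
    finally show "ennreal (inverse (b + c) * r ^ d) \<le> hausdorff d (\<Sigma> \<inter> ball x r)" .
    have "hausdorff d (\<Sigma> \<inter> ball x r) \<le> ennreal (2 * K0 * r ^ d / ball_const)"
      using hausdorff_raw_upper[OF x r] ball_const_pos K0_ge r
      unfolding hausdorff_raw_eq by (intro ennreal_le_divideI) auto
    also have "\<dots> \<le> ennreal ((b + c) * r ^ d)"
      using b r by (intro ennreal_leI) (simp add: c_def distrib_right)
    finally show "hausdorff d (\<Sigma> \<inter> ball x r) \<le> ennreal ((b + c) * r ^ d)" .
  qed (use b c in simp)
qed

lemma unif_rectifiable: "uniformly_rectifiable d \<Sigma>"
proof -
  show ?thesis
    unfolding uniformly_rectifiable_def
  proof (rule conjI[OF ahlfors], rule exI[of _ "2::real"], intro exI[of _ lower_const] conjI ballI allI impI)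
    fix x r assume x: "x \<in> \<Sigma>" and r: "(0::real) < r"
    obtain G V where G: "G \<in> sets borel" "G \<subseteq> \<Sigma> \<inter> ball x r" "ennreal (lower_const * r ^ d) \<le> hausdorff d G"
      and V: "subspace V" "dim V = d"
        "\<And>x y. x \<in> G \<Longrightarrow> y \<in> G \<Longrightarrow> \<exists>v\<in>V. norm ((y - x) - v) \<le> dist x y / 2"
      by (rule hausdorff_lower[OF x r]) blast
    from bilipschitz_of_cone[where G = G, OF V] obtain f :: "'a \<Rightarrow> nat \<Rightarrow> real" where f: "\<forall>y\<in>G. \<forall>z\<in>G.
        inverse 2 * dist y z \<le> L2_set (\<lambda>i. f y i - f z i) {..<d} \<and>
        L2_set (\<lambda>i. f y i - f z i) {..<d} \<le> 2 * dist y z" ..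
    show "\<exists>A (f :: 'a \<Rightarrow> nat \<Rightarrow> real). A \<in> sets borel \<and> A \<subseteq> \<Sigma> \<inter> ball x r \<and>
        ennreal (lower_const * r ^ d) \<le> hausdorff d A \<and>
        (\<forall>y\<in>A. \<forall>z\<in>A. inverse 2 * dist y z \<le> L2_set (\<lambda>i. f y i - f z i) {..<d} \<and>
                      L2_set (\<lambda>i. f y i - f z i) {..<d} \<le> 2 * dist y z)"
      by (intro exI[of _ G] exI[of _ f] conjI G f)
  qed (use lower_const_pos in auto)
qed

section \<open>Comparison of the measure with the restricted Hausdorff measure\<close>

abbreviation "\<nu> \<equiv> restr (hausdorff_measure d) \<Sigma>"

lemma emeasure_\<nu>: "E \<in> sets borel \<Longrightarrow> emeasure \<nu> E = hausdorff d (\<Sigma> \<inter> E)"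
  using \<Sigma>_borel by (simp add: emeasure_restr emeasure_hausdorff_measure[OF d1])

lemma null_sets_\<nu>: "E \<in> sets borel \<Longrightarrow> E \<in> null_sets \<nu> \<longleftrightarrow> E \<in> null_sets \<mu>"
proof -
  assume E: "E \<in> sets borel"
  have "emeasure \<nu> E = 0 \<longleftrightarrow> hausdorff_raw d (\<Sigma> \<inter> E) = 0"
    using ball_const_pos by (simp add: emeasure_\<nu>[OF E] hausdorff_raw_eq)
  also have "\<dots> \<longleftrightarrow> emeasure \<mu> (\<Sigma> \<inter> E) = 0"
    using hausdorff_raw_null[of "\<Sigma> \<inter> E"] emeasure_null[of "\<Sigma> \<inter> E"] E \<Sigma>_borel by auto
  also have "\<dots> \<longleftrightarrow> emeasure \<mu> E = 0" by (simp add: emeasure_Int_support[OF E])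
  finally show ?thesis using E by (simp add: null_sets_def)
qed

lemma mutually_absolutely_continuous: "absolutely_continuous \<mu> \<nu>" "absolutely_continuous \<nu> \<mu>"
  unfolding absolutely_continuous_def
  by (rule subsetI, metis null_setsD2 null_sets_\<nu> sets_mu sets_restr sets_hausdorff_measure)+

lemma radon_\<nu>: "radon_measure \<nu>"
  unfolding radon_measure_def
proof (intro conjI allI)
  fix x
  have "hausdorff_raw d (\<Sigma> \<inter> ball x 1) < top"
  proof (cases "\<Sigma> \<inter> ball x 1 = {}")
    case False
    then obtain y where y: "y \<in> \<Sigma>" "dist x y < 1" by auto
    \<comment> \<open>Upper regularity speaks of balls centred on the support, so the ball is
      recentred at one of its support points.\<close>
    have "\<Sigma> \<inter> ball x 1 \<subseteq> \<Sigma> \<inter> ball y 2"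
    proof
      fix z assume "z \<in> \<Sigma> \<inter> ball x 1"
      then show "z \<in> \<Sigma> \<inter> ball y 2" using y dist_triangle[of y z x] by (simp add: dist_commute)
    qed
    then have "hausdorff_raw d (\<Sigma> \<inter> ball x 1) \<le> ennreal (2 * K0 * 2 ^ d)"
      using hausdorff_raw_upper[OF y(1), of 2] hausdorff_raw_mono by (meson order_trans zero_less_numeral)
    then show ?thesis using ennreal_less_top order_le_less_trans by blast
  qed (simp add: hausdorff_raw_empty[OF d1])
  then have "hausdorff d (\<Sigma> \<inter> ball x 1) < top"
    using ball_const_pos by (auto simp: hausdorff_raw_eq ennreal_mult_less_top)
  then show "\<exists>r>0. emeasure \<nu> (ball x r) < top" by (intro exI[of _ 1]) (simp add: emeasure_\<nu>)
qed simp

lemma A_infinity_\<nu>: "A_infinity \<mu> \<nu>"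
  unfolding A_infinity_def
proof (intro conjI radon radon_\<nu>)
  show "doubling \<mu> \<or> doubling \<nu>" using D1 doubling by (auto simp: doubling_def)
  show "\<exists>\<epsilon>\<in>{0<..<1}. \<exists>\<delta>\<in>{0<..<1}. \<forall>x\<in>\<Sigma>. \<forall>r>0. \<forall>A\<in>sets borel. A \<subseteq> ball x r \<longrightarrow>
      emeasure \<mu> A \<le> ennreal \<epsilon> * emeasure \<mu> (ball x r) \<longrightarrow> emeasure \<nu> A \<le> ennreal \<delta> * emeasure \<nu> (ball x r)"
  proof (rule bexI[of _ \<eta>], intro bexI[of _ "1/2::real"] ballI allI impI)
    fix x r A assume *: "x \<in> \<Sigma>" "(0::real) < r" "A \<in> sets borel" "A \<subseteq> ball x r"
      "emeasure \<mu> A \<le> ennreal \<eta> * emeasure \<mu> (ball x r)"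
    have "ennreal ball_const * hausdorff d (\<Sigma> \<inter> A) \<le> ennreal ball_const * (ennreal (1/2) * hausdorff d (\<Sigma> \<inter> ball x r))"
      using hausdorff_raw_A_infinity[OF *] unfolding hausdorff_raw_eq by (simp only: mult.left_commute)
    then have "hausdorff d (\<Sigma> \<inter> A) \<le> ennreal (1/2) * hausdorff d (\<Sigma> \<inter> ball x r)"
      using ball_const_pos by (subst (asm) ennreal_mult_le_mult_iff) auto
    then show "emeasure \<nu> A \<le> ennreal (1/2) * emeasure \<nu> (ball x r)" using *(3) by (simp add: emeasure_\<nu>)
  qed (use \<eta>_bounds in auto)
qed

end

end

theorem theorem1p9:
  fixes d :: nat and C\<^sub>\<delta> :: real
  assumes "1 \<le> d" and "d \<le> CARD('n::finite)" and "C\<^sub>\<delta> \<ge> 1"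
  shows "\<exists>C\<^sub>1::real. C\<^sub>1 > 0 \<and>
    (\<forall>\<mu> :: (real ^ 'n) measure.
       radon_measure \<mu> \<longrightarrow> doubling_with C\<^sub>\<delta> \<mu> \<longrightarrow>
       (\<forall>x\<in>msupport \<mu>. \<forall>r>0.
          (\<integral>\<^sup>+y\<in>ball x (2 * r). (\<integral>\<^sup>+t\<in>{0<..<2 * r}. alpha d \<mu> y t / ennreal t \<partial>lborel) \<partial>\<mu>)
            \<le> ennreal C\<^sub>1 * emeasure \<mu> (ball x r)) \<longrightarrow>
       uniformly_rectifiable d (msupport \<mu>) \<and>
       big_pieces_lipschitz_graphs d (msupport \<mu>) \<and>
       absolutely_continuous \<mu> (restr (hausdorff_measure d) (msupport \<mu>)) \<and>
       absolutely_continuous (restr (hausdorff_measure d) (msupport \<mu>)) \<mu> \<and>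
       A_infinity \<mu> (restr (hausdorff_measure d) (msupport \<mu>)))"
proof -
  obtain W :: "(real ^ 'n) set" where W: "subspace W" "dim W = d"
    using choose_subspace_of_subspace[of d "UNIV :: (real ^ 'n) set"] assms(2) by auto
  \<comment> \<open>The constants of the locale involve only \<open>d\<close> and
    \<open>C\<^sub>\<delta>\<close>, but they must be named before \<mu> is given. The null measure
    has empty support and so satisfies the locale assumptions trivially.\<close>
  interpret zero: doubling_measure d W "null_measure borel" C\<^sub>\<delta>
    by standard (use assms W in \<open>auto simp: radon_measure_def doubling_with_def intro: exI[of _ 1]\<close>)
  \<comment> \<open>The first bound secures the starting approximations; the second makes the bad
    balls a fraction \<open>\<eta>\<close> of mass and of \<open>r ^ d\<close>.\<close>
  define C where "C = min zero.C2 (zero.\<eta> / zero.A2)"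
  have C: "0 < C" "C \<le> zero.C2" "zero.A2 * C \<le> zero.\<eta>"
    using zero.consts_pos(3) zero.\<eta>_bounds(1) zero.A2_ge(3) by (auto simp: C_def min_def field_simps)
  show ?thesis
  proof (intro exI[of _ C] conjI[OF C(1)] allI impI)
    fix \<mu> :: "(real ^ 'n) measure"
    assume \<mu>: "radon_measure \<mu>" "doubling_with C\<^sub>\<delta> \<mu>"
      and carl: "\<forall>x\<in>msupport \<mu>. \<forall>r>0.
          (\<integral>\<^sup>+y\<in>ball x (2 * r). (\<integral>\<^sup>+t\<in>{0<..<2 * r}. alpha d \<mu> y t / ennreal t \<partial>lborel) \<partial>\<mu>)
            \<le> ennreal C * emeasure \<mu> (ball x r)"
    interpret doubling_measure d W \<mu> C\<^sub>\<delta>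
      by standard (use assms W \<mu> in auto)
    have "carleson C" unfolding carleson_def by (rule carl)
    note hyp = this less_imp_le[OF C(1)] C(2,3)
    show "uniformly_rectifiable d (msupport \<mu>) \<and>
       big_pieces_lipschitz_graphs d (msupport \<mu>) \<and>
       absolutely_continuous \<mu> (restr (hausdorff_measure d) (msupport \<mu>)) \<and>
       absolutely_continuous (restr (hausdorff_measure d) (msupport \<mu>)) \<mu> \<and>
       A_infinity \<mu> (restr (hausdorff_measure d) (msupport \<mu>))"
      using unif_rectifiable[OF hyp] big_pieces[OF hyp] mutually_absolutely_continuous[OF hyp]
        A_infinity_\<nu>[OF hyp] by blast
  qed
qed

end
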